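(* Below $X,Y,Z$ are predicates on natural numbers (elements of $2^{\mathbb{N}}$) and $n$ is a natural number (coding an estimator). For $k>0$, a predicate $P(n,X,Y)$ and a level $k+2$ estimator $s$, let $G(P,s)$ be the game in which player I plays $X_0$, player II plays $Y_0$, player I plays $X_1$, player II plays $Y_1$, and so on (each move a bit, producing $X$ and $Y$), where player I wins iff $\forall s_{k+1}\in s\ \exists s_k\in s_{k+1}\ P(s_k,X,Y)$, and player II wins iff $\forall s_{k+1}\in s\ \exists s_k\in s_{k+1}\ \neg P(s_k,X,Y)$. (a) Lightface projective determinacy holds if and only if for every $k>0$ and every primitive recursive predicate $P(n,X,Y)$, for some (equivalently, for every) level $k+2$ estimator $s$ (sufficiently good relative to $P$), one of the players has a winning strategy in $G(P,s)$. (b) Projective determinacy holds if and only if for every $k>0$ and every primitive recursive predicate $P(n,X,Y,Z)$, for some (equivalently, for every) level $k+3$ estimator $t$ (sufficiently good relative to $P$), for every $Z$ there is $s\in t$ such that one of the players has a winning strategy in $G(P(\cdot,\cdot,\cdot,Z),s)$.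
   Context: Valid notions of estimators, defined by recursion on the level: * A notion (set) $R$ of $0$-estimators is valid iff $R$ is a set of pairs of natural numbers and there are $a_{\min}\in\mathbb{N}$ and $f\in\mathbb{N}^{\mathbb{N}}$ such that $(a,b)\in R\Leftrightarrow a\ge a_{\min}\wedge b\ge f(a)$. * A notion (set) $R$ of $(m+1)$-estimators is valid iff (1) every element of $R$ is a finite set; (2) $\bigcup R$ is a valid notion of $m$-estimators, and $x\in R\wedge y\in\bigcup R\Rightarrow x\cup\{y\}\in R$; (3) for every valid notion $S$ of $m$-estimators there is $r\in R$ with $r\subseteq S$. "For every level $m$ estimator $s$ (sufficiently good relative to $P$), $\psi(s)$" means: there is a valid notion $R$ of $m$-estimators (which may depend on $P$) such that $\psi(s)$ holds for every $s\in R$. "For some level $m$ estimator $s$ (sufficiently good relative to $P$), $\psi(s)$" means: for every valid notion $R$ of $m$-estimators there is $s\in R$ with $\psi(s)$. Estimators are hereditarily finite and are identified with natural numbers via a standard coding when used as the argument $n$ of $P$. $P$ is primitive recursive with $X,Y$ (and $Z$) given as oracles; hence only boundedly many bits matter for a given $s$ and the game is effectively finite. The two winning conditions need not be complementary; a winning strategy for a player is one guaranteeing that player's own winning condition. Projective determinacy: every two-player game of length $\omega$ on integers with projective payoff set is determined. Lightface projective determinacy: the same for payoff sets that are lightface projective (definable in second order arithmetic without real parameters). *)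

theory Defs
  imports "HOL-Analysis.Analysis" "HOL-Library.FSet" "HOL-Library.Nat_Bijection"
begin

section \<open>Estimators\<close>

text \<open>Hereditarily finite objects over pairs of natural numbers: a 0-estimator is some
  \<open>EPair a b\<close>, an $(m+1)$-estimator is some \<open>ESet F\<close> with \<open>F\<close> a finite set of $m$-estimators.\<close>

datatype est = EPair nat nat | ESet "est fset"

primrec elems :: "est \<Rightarrow> est set" where
  "elems (EPair a b) = {}"
| "elems (ESet F) = fset F"

text \<open>In the successor case, \<open>\<Union>(elems ` R)\<close> is the union of the notion \<open>R\<close> and
  \<open>ESet (finsert y F)\<close> is $x \cup \{y\}$ for $x$ = \<open>ESet F\<close>.\<close>

primrec valid_notion :: "nat \<Rightarrow> est set \<Rightarrow> bool" where
  "valid_notion 0 R \<longleftrightarrow>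
     (\<forall>x\<in>R. \<exists>a b. x = EPair a b) \<and>
     (\<exists>amin. \<exists>f :: nat \<Rightarrow> nat. \<forall>a b. EPair a b \<in> R \<longleftrightarrow> a \<ge> amin \<and> b \<ge> f a)"
| "valid_notion (Suc m) R \<longleftrightarrow>
     (\<forall>x\<in>R. \<exists>F. x = ESet F) \<and>
     valid_notion m (\<Union>(elems ` R)) \<and>
     (\<forall>F y. ESet F \<in> R \<longrightarrow> y \<in> \<Union>(elems ` R) \<longrightarrow> ESet (finsert y F) \<in> R) \<and>
     (\<forall>S. valid_notion m S \<longrightarrow> (\<exists>r\<in>R. elems r \<subseteq> S))"

definition for_every_estimator :: "nat \<Rightarrow> (est \<Rightarrow> bool) \<Rightarrow> bool" where
  "for_every_estimator m \<psi> \<longleftrightarrow> (\<exists>R. valid_notion m R \<and> (\<forall>s\<in>R. \<psi> s))"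

definition for_some_estimator :: "nat \<Rightarrow> (est \<Rightarrow> bool) \<Rightarrow> bool" where
  "for_some_estimator m \<psi> \<longleftrightarrow> (\<forall>R. valid_notion m R \<longrightarrow> (\<exists>s\<in>R. \<psi> s))"

text \<open>Coding by natural numbers: Cantor pairing for pairs, binary (Ackermann) coding for finite
  sets, and the parity of the code separates the two kinds.\<close>

primrec est_code :: "est \<Rightarrow> nat" where
  "est_code (EPair a b) = sum_encode (Inl (prod_encode (a, b)))"
| "est_code (ESet F) = sum_encode (Inr (set_encode (fset (est_code |`| F))))"

lemma est_code_eq_iff: "est_code x = est_code y \<longleftrightarrow> x = y"
proof (induction x arbitrary: y)
  case (EPair a b)
  then show ?case by (cases y) (auto simp: sum_encode_eq)
next
  case (ESet F)
  show ?case
  proof (cases y)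
    case (EPair a b)
    then show ?thesis by (simp add: sum_encode_eq)
  next
    case y: (ESet G)
    have inj: "x = w" if "x \<in> fset F" "est_code x = est_code w" for x w
      using ESet.IH[of x w] that by simp
    have "F = G" if eq: "est_code ` fset F = est_code ` fset G"
    proof -
      have "fset F \<subseteq> fset G"
      proof
        fix x assume x: "x \<in> fset F"
        then have "est_code x \<in> est_code ` fset G"
          using eq by blast
        then obtain w where "w \<in> fset G" "est_code x = est_code w"
          by blast
        then show "x \<in> fset G"
          using inj[OF x] by simp
      qed
      moreover have "fset G \<subseteq> fset F"
      proof
        fix w assume "w \<in> fset G"
        then have "est_code w \<in> est_code ` fset F"
          using eq by blast
        then obtain x where "x \<in> fset F" "est_code x = est_code w"
          by auto
        then show "w \<in> fset F"
          using inj by blast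
      qed
      ultimately show "F = G"
        by (simp add: fset_inject[symmetric])
    qed
    then show ?thesis
      using y inj_on_set_encode by (auto simp: sum_encode_eq inj_on_eq_iff)
  qed
qed

section \<open>Primitive recursion relative to oracles\<close>

type_synonym pred = "nat \<Rightarrow> bool"

text \<open>\<open>prim_rec p n F\<close>: \<open>F Xs v\<close> is primitive recursive in its number arguments \<open>v\<close>
  (a list of length \<open>n\<close>), uniformly in the oracles \<open>Xs\<close> (a list of length \<open>p\<close>).\<close>

inductive prim_rec :: "nat \<Rightarrow> nat \<Rightarrow> (pred list \<Rightarrow> nat list \<Rightarrow> nat) \<Rightarrow> bool" for p where
  zero: "prim_rec p n (\<lambda>Xs v. 0)"
| succ: "prim_rec p 1 (\<lambda>Xs v. Suc (hd v))"
| proj: "i < n \<Longrightarrow> prim_rec p n (\<lambda>Xs v. v ! i)"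
| query: "i < p \<Longrightarrow> prim_rec p 1 (\<lambda>Xs v. of_bool ((Xs ! i) (hd v)))"
| comp: "prim_rec p (length gs) f \<Longrightarrow> \<forall>g\<in>set gs. prim_rec p n g \<Longrightarrow>
    prim_rec p n (\<lambda>Xs v. f Xs (map (\<lambda>g. g Xs v) gs))"
| prec: "prim_rec p n f \<Longrightarrow> prim_rec p (Suc (Suc n)) g \<Longrightarrow>
    prim_rec p (Suc n)
      (\<lambda>Xs v. rec_nat (f Xs (tl v)) (\<lambda>i r. g Xs (i # r # tl v)) (hd v))"

definition prim_rec_pred2 :: "(nat \<Rightarrow> pred \<Rightarrow> pred \<Rightarrow> bool) \<Rightarrow> bool" where
  "prim_rec_pred2 P \<longleftrightarrow>
     (\<exists>F. prim_rec 2 1 F \<and> (\<forall>n X Y. F [X, Y] [n] = of_bool (P n X Y)))"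

definition prim_rec_pred3 :: "(nat \<Rightarrow> pred \<Rightarrow> pred \<Rightarrow> pred \<Rightarrow> bool) \<Rightarrow> bool" where
  "prim_rec_pred3 P \<longleftrightarrow>
     (\<exists>F. prim_rec 3 1 F \<and> (\<forall>n X Y Z. F [X, Y, Z] [n] = of_bool (P n X Y Z)))"

section \<open>Games of length $\omega$\<close>

text \<open>A play \<open>p\<close> is the sequence of all moves, player I making those with even index. A strategy
  maps a position (the finite list of moves made so far) to a move. The argument \<open>W\<close> is the set
  of plays won by the player in question.\<close>

definition winning_strategy_I :: "(nat \<Rightarrow> 'a) set \<Rightarrow> ('a list \<Rightarrow> 'a) \<Rightarrow> bool" where
  "winning_strategy_I W \<sigma> \<longleftrightarrow>
     (\<forall>p. (\<forall>i. even i \<longrightarrow> p i = \<sigma> (map p [0..<i])) \<longrightarrow> p \<in> W)"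

definition winning_strategy_II :: "(nat \<Rightarrow> 'a) set \<Rightarrow> ('a list \<Rightarrow> 'a) \<Rightarrow> bool" where
  "winning_strategy_II W \<tau> \<longleftrightarrow>
     (\<forall>p. (\<forall>i. odd i \<longrightarrow> p i = \<tau> (map p [0..<i])) \<longrightarrow> p \<in> W)"

definition one_player_wins :: "(nat \<Rightarrow> 'a) set \<Rightarrow> (nat \<Rightarrow> 'a) set \<Rightarrow> bool" where
  "one_player_wins W_I W_II \<longleftrightarrow>
     (\<exists>\<sigma>. winning_strategy_I W_I \<sigma>) \<or> (\<exists>\<tau>. winning_strategy_II W_II \<tau>)"

definition determined :: "(nat \<Rightarrow> 'a) set \<Rightarrow> bool" where
  "determined A \<longleftrightarrow> one_player_wins A (- A)"

section \<open>The estimator games\<close>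

definition moves_I :: "(nat \<Rightarrow> 'a) \<Rightarrow> nat \<Rightarrow> 'a" where
  "moves_I p i = p (2 * i)"

definition moves_II :: "(nat \<Rightarrow> 'a) \<Rightarrow> nat \<Rightarrow> 'a" where
  "moves_II p i = p (2 * i + 1)"

definition G_wins_I :: "(nat \<Rightarrow> pred \<Rightarrow> pred \<Rightarrow> bool) \<Rightarrow> est \<Rightarrow> (nat \<Rightarrow> bool) set" where
  "G_wins_I P s =
     {p. \<forall>s'\<in>elems s. \<exists>s''\<in>elems s'. P (est_code s'') (moves_I p) (moves_II p)}"

definition G_wins_II :: "(nat \<Rightarrow> pred \<Rightarrow> pred \<Rightarrow> bool) \<Rightarrow> est \<Rightarrow> (nat \<Rightarrow> bool) set" where
  "G_wins_II P s =
     {p. \<forall>s'\<in>elems s. \<exists>s''\<in>elems s'. \<not> P (est_code s'') (moves_I p) (moves_II p)}"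

definition G_decided :: "(nat \<Rightarrow> pred \<Rightarrow> pred \<Rightarrow> bool) \<Rightarrow> est \<Rightarrow> bool" where
  "G_decided P s \<longleftrightarrow> one_player_wins (G_wins_I P s) (G_wins_II P s)"

section \<open>Projective determinacy\<close>

text \<open>Projective subsets of Baire space: the closure of the Borel sets under complements and
  continuous images. The topology on \<open>nat \<Rightarrow> nat\<close> is the product of discrete topologies.\<close>

inductive projective :: "(nat \<Rightarrow> nat) set \<Rightarrow> bool" where
  borel: "A \<in> sets borel \<Longrightarrow> projective A"
| compl: "projective A \<Longrightarrow> projective (- A)"
| image: "projective A \<Longrightarrow> continuous_on UNIV f \<Longrightarrow> projective (f ` A)"

definition projective_determinacy :: bool where
  "projective_determinacy \<longleftrightarrow> (\<forall>A. projective A \<longrightarrow> determined A)"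

text \<open>Second order arithmetic with number variables and function variables (ranging over
  \<open>nat \<Rightarrow> nat\<close>), interpreted in the standard model. \<open>App j t\<close> is the $j$-th function variable
  applied to \<open>t\<close>.\<close>

datatype soa_term =
    Var nat
  | Zero
  | Succ soa_term
  | Plus soa_term soa_term
  | Times soa_term soa_term
  | App nat soa_term

datatype soa_formula =
    Equal soa_term soa_term
  | Less soa_term soa_term
  | Neg soa_formula
  | Conj soa_formula soa_formula
  | ExNum nat soa_formula
  | ExFun nat soa_formula

primrec soa_val :: "(nat \<Rightarrow> nat) \<Rightarrow> (nat \<Rightarrow> nat \<Rightarrow> nat) \<Rightarrow> soa_term \<Rightarrow> nat" where
  "soa_val e E (Var i) = e i"
| "soa_val e E Zero = 0"
| "soa_val e E (Succ t) = Suc (soa_val e E t)"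
| "soa_val e E (Plus t u) = soa_val e E t + soa_val e E u"
| "soa_val e E (Times t u) = soa_val e E t * soa_val e E u"
| "soa_val e E (App j t) = E j (soa_val e E t)"

primrec soa_sat :: "(nat \<Rightarrow> nat) \<Rightarrow> (nat \<Rightarrow> nat \<Rightarrow> nat) \<Rightarrow> soa_formula \<Rightarrow> bool" where
  "soa_sat e E (Equal t u) \<longleftrightarrow> soa_val e E t = soa_val e E u"
| "soa_sat e E (Less t u) \<longleftrightarrow> soa_val e E t < soa_val e E u"
| "soa_sat e E (Neg \<phi>) \<longleftrightarrow> \<not> soa_sat e E \<phi>"
| "soa_sat e E (Conj \<phi> \<theta>) \<longleftrightarrow> soa_sat e E \<phi> \<and> soa_sat e E \<theta>"
| "soa_sat e E (ExNum i \<phi>) \<longleftrightarrow> (\<exists>a. soa_sat (e(i := a)) E \<phi>)"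
| "soa_sat e E (ExFun j \<phi>) \<longleftrightarrow> (\<exists>x. soa_sat e (E(j := x)) \<phi>)"

text \<open>The element of Baire space is the value of function variable 0. Requiring the equivalence
  under all assignments of the other variables rules out parameters.\<close>

definition lightface_projective :: "(nat \<Rightarrow> nat) set \<Rightarrow> bool" where
  "lightface_projective A \<longleftrightarrow> (\<exists>\<phi>. \<forall>e E. soa_sat e E \<phi> \<longleftrightarrow> E 0 \<in> A)"

definition lightface_projective_determinacy :: bool where
  "lightface_projective_determinacy \<longleftrightarrow> (\<forall>A. lightface_projective A \<longrightarrow> determined A)"

end

theory Submission
  imports Defs
begin

text \<open>If $\sigma$ wins for player I the game with payoff ``for some level $k$ estimator $s_k$,
  $P(s_k, X, Y)$'', then by compactness of the set of plays following $\sigma$ the finite sets of level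
  $k$ estimators that contain a witness for every such play form a valid notion of level $k+1$
  estimators, and $\sigma$ wins $G(P, s)$ for every finite set $s$ of these; similarly for player II,
  since ``for every'' implies ``for some''. This payoff is projective, so determinacy yields decided
  games.

  Call a set of bit sequences limit computable at level $k$ if some primitive recursive $P$ gives its
  correct value for every level $k$ estimator. The quantifier ``there is $Y \in 2^{\mathbb{N}}$'' raises
  the level by at most two: one asks for a $Y$ such that
  $\forall s_{k+1} \in s\, \exists s_k \in s_{k+1}\, P(s_k, X, Y)$, and compactness of $2^{\mathbb{N}}$
  handles the negative case. Since a number or a function is the limit of a table of bits, all sets
  definable in second order arithmetic are limit computable. If such a payoff is not determined, every
  strategy has a refuting play, and compactness of the space of strategies shows that for every $s$,
  $G(P, s)$ is not decided. Moves in $\mathbb{N}$ are played in unary. The boldface case uses that the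
  projective sets are those definable with a real parameter, and compactness in $Z$.\<close>

section \<open>Valid notions\<close>

text \<open>The valid notions of a level are closed under intersection and nonempty. So
  \<open>for_every_estimator\<close> commutes with conjunction and implies its dual
  \<open>for_some_estimator\<close>, and both directions can aim at the strong quantifier:
  determinacy gives decided games for every estimator, an undetermined set gives undecided games for
  every estimator, and the latter refutes even the weak version.

  Clause (3) of validity asks for a finite part of an arbitrary valid notion, which is just what a
  finite subcover provides. The compact space is in turn that of plays, strategies, quantified sets
  and parameters. Strategies form a compact space only because moves are bits; this forces a coding
  of numerical moves, and with it a rule for plays in which some number is never completed.

  A given \<open>P\<close> need not converge, so the payoff built from it must use one of the two
  quantifiers; in the converse direction \<open>P\<close> is constructed to converge, and the
  conditions of I and II approximate a set and its complement. Estimators have numerical codes, so a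
  quantifier over valid notions is one over reals; this keeps the payoff inside second order
  arithmetic.\<close>

primrec lev :: "nat \<Rightarrow> est set" where
  "lev 0 = {EPair a b |a b. True}"
| "lev (Suc m) = {ESet F |F. fset F \<subseteq> lev m}"

lemma valid_notion_subset_lev: "valid_notion m R \<Longrightarrow> R \<subseteq> lev m"
proof (induction m arbitrary: R)
  case 0
  then show ?case unfolding valid_notion.simps(1) by force
next
  case (Suc m)
  then have U: "\<Union>(elems ` R) \<subseteq> lev m" and R: "\<forall>x\<in>R. \<exists>F. x = ESet F"
    unfolding valid_notion.simps(2) by blast+
  show ?case
  proof
    fix x assume x: "x \<in> R"
    then have "elems x \<subseteq> lev m" using U by blast
    with x R show "x \<in> lev (Suc m)" by fastforce
  qed
qed

text \<open>Clause (3) is the hard one. It is applied to \<open>R\<close> and to \<open>S\<close>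
  with the target cut down to both unions; by clause (2) each of the two finite sets may absorb the
  other, and their union lies in \<open>R \<inter> S\<close>. Nonemptiness is carried along because
  it turns for every into for some.\<close>

lemma valid_notion_Int:
  "valid_notion m R \<Longrightarrow> valid_notion m S \<Longrightarrow> valid_notion m (R \<inter> S) \<and> R \<inter> S \<noteq> {}"
proof (induction m arbitrary: R S)
  case 0
  from 0 obtain a f where af: "\<forall>x\<in>R. \<exists>a b. x = EPair a b" "\<And>c d. EPair c d \<in> R \<longleftrightarrow> c \<ge> a \<and> d \<ge> (f c :: nat)"
    by auto
  from 0 obtain a' f' where af': "\<And>c d. EPair c d \<in> S \<longleftrightarrow> c \<ge> a' \<and> d \<ge> (f' c :: nat)"
    by auto
  have eq: "EPair c d \<in> R \<inter> S \<longleftrightarrow> c \<ge> max a a' \<and> d \<ge> max (f c) (f' c)" for c d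
    using af af' by auto
  then have "EPair (max a a') (max (f (max a a')) (f' (max a a'))) \<in> R \<inter> S" by blast
  moreover have "valid_notion 0 (R \<inter> S)"
    using af(1) eq unfolding valid_notion.simps
    by (intro conjI exI[of _ "max a a'"] exI[of _ "\<lambda>c. max (f c) (f' c)"]) auto
  ultimately show ?case by blast
next
  case (Suc m)
  let ?UR = "\<Union>(elems ` R)" and ?US = "\<Union>(elems ` S)"
  \<comment> \<open>Clause (2), iterated over a finite set.\<close>
  have *: "ESet (F |\<union>| G) \<in> T" if "valid_notion (Suc m) T" "ESet F \<in> T" "fset G \<subseteq> \<Union>(elems ` T)" for T F G
    using that(3)
  proof (induction G)
    case (insert x G)
    then have "ESet (F |\<union>| G) \<in> T" "x \<in> \<Union>(elems ` T)" by auto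
    with that(1) have "ESet (finsert x (F |\<union>| G)) \<in> T" unfolding valid_notion.simps(2) by blast
    then show ?case by simp
  qed (use that(2) in simp)
  have U: "valid_notion m (?UR \<inter> ?US)" using Suc by simp
  have ex: "\<exists>F. ESet F \<in> R \<inter> S \<and> fset F \<subseteq> T" if T: "valid_notion m T" for T
  proof -
    have T': "valid_notion m (T \<inter> (?UR \<inter> ?US))" using Suc.IH[OF T U] by blast
    have "\<forall>x\<in>R. \<exists>F. x = ESet F" "\<exists>r\<in>R. elems r \<subseteq> T \<inter> (?UR \<inter> ?US)" using Suc.prems(1) T' unfolding valid_notion.simps(2) by blast+
    then obtain F where F: "ESet F \<in> R" "fset F \<subseteq> T \<inter> (?UR \<inter> ?US)" by fastforce
    have "\<forall>x\<in>S. \<exists>F. x = ESet F" "\<exists>r\<in>S. elems r \<subseteq> T \<inter> (?UR \<inter> ?US)" using Suc.prems(2) T' unfolding valid_notion.simps(2) by blast+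
    then obtain G where G: "ESet G \<in> S" "fset G \<subseteq> T \<inter> (?UR \<inter> ?US)" by fastforce
    have "ESet (F |\<union>| G) \<in> R" using *[OF Suc.prems(1) F(1)] G(2) by blast
    moreover have "ESet (G |\<union>| F) \<in> S" using *[OF Suc.prems(2) G(1)] F(2) by blast
    ultimately show ?thesis using F G by (intro exI[of _ "F |\<union>| G"]) (auto simp: funion_commute)
  qed
  have step: "ESet (finsert y F) \<in> R \<inter> S" if "ESet F \<in> R \<inter> S" "y \<in> ?UR \<inter> ?US" for F y
    using that Suc.prems unfolding valid_notion.simps(2) by blast
  \<comment> \<open>A common element of the two unions can be adjoined to any common member, and
    \<open>ex\<close> provides one.\<close>
  have Ueq: "\<Union>(elems ` (R \<inter> S)) = ?UR \<inter> ?US"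
  proof
    show "?UR \<inter> ?US \<subseteq> \<Union>(elems ` (R \<inter> S))"
    proof
      fix y assume y: "y \<in> ?UR \<inter> ?US"
      obtain F where "ESet F \<in> R \<inter> S" using ex[OF U] by blast
      from step[OF this y] show "y \<in> \<Union>(elems ` (R \<inter> S))" by force
    qed
  qed auto
  have "valid_notion (Suc m) (R \<inter> S)"
    unfolding valid_notion.simps(2) Ueq
  proof (intro conjI allI impI)
    show "\<forall>x\<in>R \<inter> S. \<exists>F. x = ESet F" using Suc.prems(1) by simp
    show "\<exists>r\<in>R \<inter> S. elems r \<subseteq> T" if "valid_notion m T" for T
      using ex[OF that] by force
  qed (use U step in auto)
  moreover have "R \<inter> S \<noteq> {}" using ex[OF U] by blast
  ultimately show ?case by blast
qed

lemma for_every_imp_for_some: "for_every_estimator m \<psi> \<Longrightarrow> for_some_estimator m \<psi>"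
  unfolding for_every_estimator_def for_some_estimator_def using valid_notion_Int by blast

lemma for_every_mono: "for_every_estimator m \<psi> \<Longrightarrow> (\<And>s. \<psi> s \<Longrightarrow> \<theta> s) \<Longrightarrow> for_every_estimator m \<theta>"
  unfolding for_every_estimator_def by blast

lemma for_every_conj:
  "for_every_estimator m \<psi> \<Longrightarrow> for_every_estimator m \<theta> \<Longrightarrow> for_every_estimator m (\<lambda>s. \<psi> s \<and> \<theta> s)"
  unfolding for_every_estimator_def using valid_notion_Int by blast

lemma not_for_some: "\<not> for_some_estimator m \<psi> \<longleftrightarrow> for_every_estimator m (\<lambda>s. \<not> \<psi> s)"
  unfolding for_every_estimator_def for_some_estimator_def by blast

lemma valid_notion_Suc_subsets:
  assumes "valid_notion m R"
  shows "valid_notion (Suc m) {ESet F |F. fset F \<subseteq> R}"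
proof -
  have U: "\<Union>(elems ` {ESet F |F. fset F \<subseteq> R}) = R"
  proof
    show "R \<subseteq> \<Union>(elems ` {ESet F |F. fset F \<subseteq> R})"
    proof
      fix x assume "x \<in> R"
      then have "ESet {|x|} \<in> {ESet F |F. fset F \<subseteq> R}" by auto
      then show "x \<in> \<Union>(elems ` {ESet F |F. fset F \<subseteq> R})" by (rule UN_I) simp
    qed
  qed auto
  \<comment> \<open>Clause (3) is met by the empty set, whatever \<open>S\<close> is.\<close>
  have "\<exists>r\<in>{ESet F |F. fset F \<subseteq> R}. elems r \<subseteq> S" for S
    by (rule bexI[of _ "ESet {||}"]) simp_all
  then show ?thesis using assms unfolding valid_notion.simps(2) U by fastforce
qed

lemma valid_notion_lev: "valid_notion m (lev m)"
proof (induction m)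
  case 0
  have "\<forall>a b. EPair a b \<in> lev 0 \<longleftrightarrow> a \<ge> 0 \<and> b \<ge> (\<lambda>_. 0 :: nat) a" by simp
  then show ?case unfolding valid_notion.simps(1) by (intro conjI exI[of _ "0::nat"] exI[of _ "\<lambda>_. 0 :: nat"]) simp_all
next
  case (Suc m)
  from valid_notion_Suc_subsets[OF this] show ?case unfolding lev.simps(2) .
qed

lemma for_every_all_elems:
  assumes "for_every_estimator m \<psi>"
  shows "for_every_estimator (Suc m) (\<lambda>s. \<forall>s'\<in>elems s. \<psi> s')"
proof -
  from assms obtain R where "valid_notion m R" "\<forall>s\<in>R. \<psi> s"
    unfolding for_every_estimator_def by blast
  with valid_notion_Suc_subsets[of m R] show ?thesis
    unfolding for_every_estimator_def
    by (intro exI[of _ "{ESet F |F. fset F \<subseteq> R}"]) (auto simp del: valid_notion.simps)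
qed

text \<open>The witnessing notion consists of all finite sets of level \<open>m\<close> estimators
  with \<open>\<psi>\<close>. Monotonicity gives clause (2), \<open>ex\<close> is clause (3), and
  adjoining arbitrary estimators to one good set \<open>F0\<close> shows that the union is all of
  \<open>lev m\<close>.\<close>

lemma for_every_Suc_upward:
  assumes mono: "\<And>F G. F |\<subseteq>| G \<Longrightarrow> \<psi> (ESet F) \<Longrightarrow> \<psi> (ESet G)"
    and ex: "\<And>S. valid_notion m S \<Longrightarrow> \<exists>F. fset F \<subseteq> S \<and> \<psi> (ESet F)"
  shows "for_every_estimator (Suc m) \<psi>"
proof -
  let ?R = "{ESet F |F. fset F \<subseteq> lev m \<and> \<psi> (ESet F)}"
  obtain F0 where F0: "fset F0 \<subseteq> lev m" "\<psi> (ESet F0)" using ex[OF valid_notion_lev] by blast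
  have U: "\<Union>(elems ` ?R) = lev m"
  proof
    show "lev m \<subseteq> \<Union>(elems ` ?R)"
    proof
      fix x assume "x \<in> lev m"
      then have "ESet (finsert x F0) \<in> ?R" using F0 mono[OF fsubset_finsertI F0(2)] by simp
      then show "x \<in> \<Union>(elems ` ?R)" by (rule UN_I) simp
    qed
  qed fastforce
  have "\<exists>r\<in>?R. elems r \<subseteq> S" if "valid_notion m S" for S
  proof -
    from ex[OF that] obtain F where "fset F \<subseteq> S" "\<psi> (ESet F)" by blast
    then show ?thesis using valid_notion_subset_lev[OF that] by (intro bexI[of _ "ESet F"]) auto
  qed
  moreover have "ESet (finsert y F) \<in> ?R" if "ESet F \<in> ?R" "y \<in> lev m" for F y
    using that mono[OF fsubset_finsertI, of F] by simp
  ultimately have "valid_notion (Suc m) ?R"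
    unfolding valid_notion.simps(2) U using valid_notion_lev by blast
  then show ?thesis unfolding for_every_estimator_def by (intro exI[of _ ?R]) (auto simp del: valid_notion.simps)
qed

text \<open>The same for conditions on plain finite sets, the form in which compactness produces
  them.\<close>

lemma for_every_Suc_upward_finite:
  assumes mono: "\<And>A B. finite B \<Longrightarrow> A \<subseteq> B \<Longrightarrow> \<psi> A \<Longrightarrow> \<psi> B"
    and ex: "\<And>S. valid_notion m S \<Longrightarrow> \<exists>F. finite F \<and> F \<subseteq> S \<and> \<psi> F"
  shows "for_every_estimator (Suc m) (\<lambda>s. \<psi> (elems s))"
proof (rule for_every_Suc_upward)
  fix F G :: "est fset" assume "F |\<subseteq>| G" "\<psi> (elems (ESet F))"
  then show "\<psi> (elems (ESet G))" using mono[of "fset G" "fset F"] by (simp add: less_eq_fset.rep_eq)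
next
  fix S assume "valid_notion m S"
  from ex[OF this] obtain F where "finite F" "F \<subseteq> S" "\<psi> F" by blast
  then show "\<exists>F. fset F \<subseteq> S \<and> \<psi> (elems (ESet F))"
    by (intro exI[of _ "Abs_fset F"]) (simp add: Abs_fset_inverse)
qed

text \<open>A singleton suffices, since any valid notion meets the one on which
  \<open>\<psi>\<close> holds.\<close>

lemma for_every_ex_elem:
  assumes "for_every_estimator m \<psi>"
  shows "for_every_estimator (Suc m) (\<lambda>s. \<exists>s'\<in>elems s. \<psi> s')"
proof (rule for_every_Suc_upward_finite[of "\<lambda>A. \<exists>s'\<in>A. \<psi> s'"])
  fix S assume S: "valid_notion m S"
  from assms have "for_some_estimator m \<psi>" by (rule for_every_imp_for_some)
  with S obtain s where "s \<in> S" "\<psi> s" unfolding for_some_estimator_def by blast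
  then show "\<exists>F. finite F \<and> F \<subseteq> S \<and> (\<exists>s'\<in>F. \<psi> s')" by (intro exI[of _ "{s}"]) auto
qed auto

section \<open>Compactness and the estimator games\<close>

text \<open>Tychonoff for a power of \<open>bool\<close> over an arbitrary index type:
  \<open>nat\<close> for plays, sets and parameters, \<open>bool list\<close> for strategies. The
  set \<open>D\<close> of coordinates gives the basic neighbourhood of \<open>X\<close> on which the
  choice of \<open>i\<close> remains good.\<close>

lemma cantor_space_compact:
  fixes W :: "('a \<Rightarrow> bool) \<Rightarrow> 'i \<Rightarrow> bool"
  assumes "\<And>X. \<exists>i\<in>S. \<exists>D. finite D \<and> (\<forall>Y. (\<forall>d\<in>D. Y d = X d) \<longrightarrow> W Y i)"
  shows "\<exists>F. finite F \<and> F \<subseteq> S \<and> (\<forall>X. \<exists>i\<in>F. W X i)"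
proof -
  from assms obtain i D where iD: "\<And>X. i X \<in> S" "\<And>X. finite (D X)"
      "\<And>X Y. (\<forall>d\<in>D X. Y d = X d) \<Longrightarrow> W Y (i X)"
    by metis
  let ?T = "product_topology (\<lambda>_::'a. discrete_topology (UNIV :: bool set)) UNIV"
  define C where "C X = PiE UNIV (\<lambda>d. if d \<in> D X then {X d} else UNIV)" for X
  have compact: "compact_space ?T"
    by (simp add: compact_space_product_topology compact_space_discrete_topology)
  have op: "openin ?T (C X)" for X
  proof -
    have "{d. (if d \<in> D X then {X d} else UNIV) \<noteq> (UNIV :: bool set)} \<subseteq> D X" by auto
    then show ?thesis
      using finite_subset[OF _ iD(2)[of X]] by (auto simp: C_def openin_PiE_gen)
  qed
  have "X \<in> C X" for X by (simp add: C_def PiE_UNIV_domain)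
  then have cover: "topspace ?T \<subseteq> \<Union>(range C)" by (simp add: subset_iff) blast
  obtain F where F: "finite F" "F \<subseteq> range C" "topspace ?T \<subseteq> \<Union>F"
    using compact[unfolded compact_space_alt, rule_format, of "range C"] op cover by auto
  then obtain G where G: "finite G" "F = C ` G" by (meson finite_subset_image subset_UNIV)
  have "\<exists>j\<in>i ` G. W X j" for X
  proof -
    have "X \<in> \<Union>(C ` G)" using F(3) G by auto
    then obtain Y where Y: "Y \<in> G" "X \<in> C Y" by blast
    then have "\<forall>d\<in>D Y. X d = Y d" by (auto simp: C_def PiE_UNIV_domain Pi_iff split: if_splits)
    with Y iD(3) show ?thesis by blast
  qed
  with G iD(1) show ?thesis by (intro exI[of _ "i ` G"]) auto
qed

text \<open>Continuity into the discrete two-point space.\<close>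

definition locally_decided :: "((nat \<Rightarrow> bool) \<Rightarrow> bool) \<Rightarrow> bool" where
  "locally_decided Q \<longleftrightarrow> (\<forall>p. \<exists>N. \<forall>q. (\<forall>i<N. q i = p i) \<longrightarrow> Q q = Q p)"

text \<open>\<open>b\<close> names the player, \<open>True\<close> for I, so that one argument
  covers both players.\<close>

definition follows :: "bool \<Rightarrow> ('a list \<Rightarrow> 'a) \<Rightarrow> (nat \<Rightarrow> 'a) \<Rightarrow> bool" where
  "follows b \<sigma> p \<longleftrightarrow> (\<forall>i. even i = b \<longrightarrow> p i = \<sigma> (map p [0..<i]))"

lemma winning_strategy_I_follows: "winning_strategy_I W \<sigma> \<longleftrightarrow> (\<forall>p. follows True \<sigma> p \<longrightarrow> p \<in> W)"
  unfolding winning_strategy_I_def follows_def by auto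

lemma winning_strategy_II_follows: "winning_strategy_II W \<sigma> \<longleftrightarrow> (\<forall>p. follows False \<sigma> p \<longrightarrow> p \<in> W)"
  unfolding winning_strategy_II_def follows_def by auto

lemma ex_sequence_course_of_values: "\<exists>p. \<forall>i. p i = F i (map p [0..<i])"
proof -
  define L where "L = rec_nat [] (\<lambda>i l. l @ [F i l])"
  have L: "L 0 = []" "\<And>i. L (Suc i) = L i @ [F i (L i)]" by (simp_all add: L_def)
  have "map (\<lambda>i. F i (L i)) [0..<i] = L i" for i
    by (induction i) (simp_all add: L)
  then show ?thesis by (intro exI[of _ "\<lambda>i. F i (L i)"]) simp
qed

text \<open>With \<open>B\<close> the predicate or its negation this is the winning condition of I
  or of II.\<close>

definition est_payoff :: "(est \<Rightarrow> (nat \<Rightarrow> bool) \<Rightarrow> bool) \<Rightarrow> est \<Rightarrow> (nat \<Rightarrow> bool) set" where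
  "est_payoff B s = {p. \<forall>s'\<in>elems s. \<exists>s''\<in>elems s'. B s'' p}"

lemma for_every_est_payoff_won:
  assumes loc: "\<And>s. locally_decided (B s)"
    and \<sigma>: "\<And>p. follows b \<sigma> p \<Longrightarrow> for_some_estimator m (\<lambda>s. B s p)"
  shows "for_every_estimator (m + 2) (\<lambda>s. \<exists>\<sigma>. \<forall>p. follows b \<sigma> p \<longrightarrow> p \<in> est_payoff B s)"
proof -
  have "for_every_estimator (Suc m) (\<lambda>s. \<forall>p. follows b \<sigma> p \<longrightarrow> (\<exists>s'\<in>elems s. B s' p))"
  proof (rule for_every_Suc_upward_finite[where \<psi> = "\<lambda>A. \<forall>p. follows b \<sigma> p \<longrightarrow> (\<exists>s'\<in>A. B s' p)"])
    fix S assume S: "valid_notion m S"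
    \<comment> \<open>Compactness is applied on the whole Cantor space, so the condition is made
      vacuous for plays that do not follow \<open>\<sigma>\<close>; a deviation shows at a finite
      position and hence on a neighbourhood.\<close>
    have "\<exists>F. finite F \<and> F \<subseteq> S \<and> (\<forall>p. \<exists>s\<in>F. follows b \<sigma> p \<longrightarrow> B s p)"
    proof (rule cantor_space_compact)
      fix p
      show "\<exists>s\<in>S. \<exists>D. finite D \<and> (\<forall>q. (\<forall>d\<in>D. q d = p d) \<longrightarrow> follows b \<sigma> q \<longrightarrow> B s q)"
      proof (cases "follows b \<sigma> p")
        case True
        from \<sigma>[OF this] S obtain s where s: "s \<in> S" "B s p" unfolding for_some_estimator_def by blast
        have "\<exists>N. \<forall>q. (\<forall>i<N. q i = p i) \<longrightarrow> B s q = B s p"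
          using loc unfolding locally_decided_def by simp
        then obtain N where "\<forall>q. (\<forall>i<N. q i = p i) \<longrightarrow> B s q = B s p" by (rule exE)
        with s(2) have "\<forall>q. (\<forall>d\<in>{..<N}. q d = p d) \<longrightarrow> follows b \<sigma> q \<longrightarrow> B s q"
          by (metis lessThan_iff)
        with s(1) show ?thesis by (intro bexI[of _ s] exI[of _ "{..<N}"]) simp_all
      next
        case False
        obtain s where s: "s \<in> S" using valid_notion_Int[OF S S] by blast
        from False obtain i where i: "even i = b" "p i \<noteq> \<sigma> (map p [0..<i])"
          unfolding follows_def by blast
        have "\<not> follows b \<sigma> q" if "\<forall>d\<in>{..i}. q d = p d" for q
        proof -
          have "map q [0..<i] = map p [0..<i]" "q i = p i" using that by simp_all
          then show ?thesis using i unfolding follows_def by metis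
        qed
        with s show ?thesis by (intro bexI[of _ s] exI[of _ "{..i}"] conjI finite_atMost allI impI) blast+
      qed
    qed
    then obtain F where "finite F" "F \<subseteq> S" "\<forall>p. \<exists>s\<in>F. follows b \<sigma> p \<longrightarrow> B s p" by blast
    then show "\<exists>F. finite F \<and> F \<subseteq> S \<and> (\<forall>p. follows b \<sigma> p \<longrightarrow> (\<exists>s'\<in>F. B s' p))"
      by (intro exI[of _ F]) blast
  qed blast
  from for_every_all_elems[OF this] show ?thesis
    unfolding est_payoff_def by (auto elim!: for_every_mono)
qed

text \<open>A single \<open>s'\<close> in \<open>s\<close> all of whose elements fail at
  \<open>p\<close> refutes membership of \<open>p\<close> in \<open>est_payoff B s\<close>. Such an
  \<open>s'\<close> refutes a whole neighbourhood of strategies, so finitely many refute all of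
  them.\<close>

lemma for_every_est_payoff_not_won:
  assumes loc: "\<And>s. locally_decided (B s)"
    and ex: "\<And>\<sigma>. \<exists>p. follows b \<sigma> p \<and> for_every_estimator m (\<lambda>s. \<not> B s p)"
  shows "for_every_estimator (m + 2) (\<lambda>s. \<not> (\<exists>\<sigma>. \<forall>p. follows b \<sigma> p \<longrightarrow> p \<in> est_payoff B s))"
proof -
  let ?C = "\<lambda>p s'. \<forall>s''\<in>elems s'. \<not> B s'' p"
  have "for_every_estimator (Suc (Suc m)) (\<lambda>s. \<forall>\<sigma>. \<exists>p. follows b \<sigma> p \<and> (\<exists>s'\<in>elems s. ?C p s'))"
  proof (rule for_every_Suc_upward_finite[where \<psi> = "\<lambda>A. \<forall>\<sigma>. \<exists>p. follows b \<sigma> p \<and> (\<exists>s'\<in>A. ?C p s')"])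
    fix S assume S: "valid_notion (Suc m) S"
    have "\<exists>F. finite F \<and> F \<subseteq> S \<and> (\<forall>\<sigma>. \<exists>s'\<in>F. \<exists>p. follows b \<sigma> p \<and> ?C p s')"
    proof (rule cantor_space_compact)
      fix \<sigma> :: "bool list \<Rightarrow> bool"
      from ex obtain p where p: "follows b \<sigma> p" "for_every_estimator m (\<lambda>s. \<not> B s p)" by blast
      from p(2) obtain R where R: "valid_notion m R" "\<forall>s\<in>R. \<not> B s p"
        unfolding for_every_estimator_def by blast
      \<comment> \<open>Clause (3) for \<open>S\<close> yields a finite set of estimators that all
        fail at \<open>p\<close>.\<close>
      from S R(1) obtain s' where s': "s' \<in> S" "elems s' \<subseteq> R" unfolding valid_notion.simps(2) by blast
      have "finite (elems s')" by (cases s') auto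
      have "\<forall>s. \<exists>N. \<forall>q. (\<forall>i<N. q i = p i) \<longrightarrow> B s q = B s p"
        using loc unfolding locally_decided_def by simp
      from choice[OF this] obtain M where M: "\<forall>s q. (\<forall>i<M s. q i = p i) \<longrightarrow> B s q = B s p" by (rule exE)
      \<comment> \<open>\<open>N\<close> moves of \<open>p\<close> settle \<open>B\<close> for all
        the finitely many elements of \<open>s'\<close>.\<close>
      define N where "N = Max (insert 0 (M ` elems s'))"
      have N: "M s \<le> N" if "s \<in> elems s'" for s
        using that \<open>finite (elems s')\<close> by (auto simp: N_def intro!: Max_ge)
      have "\<exists>q. follows b \<tau> q \<and> ?C q s'" if \<tau>: "\<forall>d\<in>(\<lambda>i. map p [0..<i]) ` {..<N}. \<tau> d = \<sigma> d" for \<tau>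
      proof -
        \<comment> \<open>The opponent repeats \<open>p\<close> against \<open>\<tau>\<close>. As
          \<open>\<tau>\<close> agrees with \<open>\<sigma>\<close> along \<open>p\<close>, the play
          \<open>q\<close> stays on \<open>p\<close> for \<open>N\<close> moves.\<close>
        obtain q where q: "\<And>i. q i = (if even i = b then \<tau> (map q [0..<i]) else p i)"
          using ex_sequence_course_of_values[of "\<lambda>i l. if even i = b then \<tau> l else p i"] by blast
        have eq: "q i = p i" if "i < N" for i
          using that
        proof (induction i rule: less_induct)
          case (less i)
          then have 1: "map q [0..<i] = map p [0..<i]" by simp
          have 2: "\<tau> (map p [0..<i]) = \<sigma> (map p [0..<i])" using \<tau> less.prems by blast
          have 3: "even i = b \<longrightarrow> p i = \<sigma> (map p [0..<i])" using p(1) unfolding follows_def by blast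
          show ?case unfolding q[of i] 1 2 using 3 by metis
        qed
        have "follows b \<tau> q" unfolding follows_def
          by (intro allI impI, subst q) simp
        moreover have "?C q s'"
        proof
          fix s assume s: "s \<in> elems s'"
          have "B s q = B s p" using M[rule_format, of s q] eq N[OF s] by (meson order.strict_trans2)
          then show "\<not> B s q" using s s' R by blast
        qed
        ultimately show ?thesis by (intro exI[of _ q] conjI)
      qed
      with s'(1) show "\<exists>s'\<in>S. \<exists>D. finite D \<and> (\<forall>\<tau>. (\<forall>d\<in>D. \<tau> d = \<sigma> d) \<longrightarrow> (\<exists>p. follows b \<tau> p \<and> ?C p s'))"
        by (intro bexI[of _ s'] exI[of _ "(\<lambda>i. map p [0..<i]) ` {..<N}"] conjI allI impI) simp_all
    qed
    then obtain F where "finite F" "F \<subseteq> S" "\<forall>\<sigma>. \<exists>s'\<in>F. \<exists>p. follows b \<sigma> p \<and> ?C p s'" by blast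
    then show "\<exists>F. finite F \<and> F \<subseteq> S \<and> (\<forall>\<sigma>. \<exists>p. follows b \<sigma> p \<and> (\<exists>s'\<in>F. ?C p s'))"
      by (intro exI[of _ F]) blast
  qed blast
  then show ?thesis
    unfolding est_payoff_def by (simp only: add_2_eq_Suc') (erule for_every_mono, blast)
qed

section \<open>Primitive recursion\<close>

text \<open>Only lists of the right lengths matter, since \<^const>\<open>hd\<close> and \<^const>\<open>nth\<close> are unspecified on others.\<close>

definition pr :: "nat \<Rightarrow> nat \<Rightarrow> (pred list \<Rightarrow> nat list \<Rightarrow> nat) \<Rightarrow> bool" where
  "pr p n F \<longleftrightarrow> (\<exists>G. prim_rec p n G \<and> (\<forall>Xs v. length Xs = p \<longrightarrow> length v = n \<longrightarrow> F Xs v = G Xs v))"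

abbreviation prp :: "nat \<Rightarrow> nat \<Rightarrow> (pred list \<Rightarrow> nat list \<Rightarrow> bool) \<Rightarrow> bool" where
  "prp p n Q \<equiv> pr p n (\<lambda>Xs v. of_bool (Q Xs v))"

named_theorems pr_intros

lemma pr_cong:
  assumes "pr p n F" "\<And>Xs v. length Xs = p \<Longrightarrow> length v = n \<Longrightarrow> F' Xs v = F Xs v"
  shows "pr p n F'"
  using assms unfolding pr_def by metis

lemma pr_prim_rec: "prim_rec p n F \<Longrightarrow> pr p n F"
  unfolding pr_def by blast

lemma pr_nth [pr_intros]: "i < n \<Longrightarrow> pr p n (\<lambda>Xs v. v ! i)"
  by (intro pr_prim_rec prim_rec.proj)

lemma pr_comp:
  assumes "pr p (length gs) f" "\<And>g. g \<in> set gs \<Longrightarrow> pr p n g"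
  shows "pr p n (\<lambda>Xs v. f Xs (map (\<lambda>g. g Xs v) gs))"
proof -
  from assms(1) obtain F where F: "prim_rec p (length gs) F"
      "\<And>Xs v. length Xs = p \<Longrightarrow> length v = length gs \<Longrightarrow> f Xs v = F Xs v"
    unfolding pr_def by blast
  have "\<forall>g\<in>set gs. \<exists>G. prim_rec p n G \<and> (\<forall>Xs v. length Xs = p \<longrightarrow> length v = n \<longrightarrow> g Xs v = G Xs v)"
    using assms(2) unfolding pr_def by blast
  then obtain C where C: "\<And>g. g \<in> set gs \<Longrightarrow> prim_rec p n (C g)"
      "\<And>g Xs v. g \<in> set gs \<Longrightarrow> length Xs = p \<Longrightarrow> length v = n \<Longrightarrow> g Xs v = C g Xs v"
    by metis
  have "prim_rec p n (\<lambda>Xs v. F Xs (map (\<lambda>g. g Xs v) (map C gs)))"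
    using F(1) C(1) by (intro prim_rec.comp) auto
  moreover have "f Xs (map (\<lambda>g. g Xs v) gs) = F Xs (map (\<lambda>g. g Xs v) (map C gs))"
    if "length Xs = p" "length v = n" for Xs v
  proof -
    have eq: "map (\<lambda>g. g Xs v) (map C gs) = map (\<lambda>g. g Xs v) gs" using C(2) that by simp
    show ?thesis unfolding eq using F(2) that by simp
  qed
  ultimately show ?thesis unfolding pr_def by blast
qed

text \<open>Closure of a function is proved once at projections and transferred by this rule and its
  analogues to arbitrary arguments.\<close>

lemma pr_apply1:
  assumes "pr p 1 (\<lambda>Xs v. f Xs (v ! 0))" "pr p n g"
  shows "pr p n (\<lambda>Xs v. f Xs (g Xs v))"
  using pr_comp[of p "[g]" "\<lambda>Xs v. f Xs (v ! 0)" n] assms by simp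

lemma pr_apply2:
  assumes "pr p 2 (\<lambda>Xs v. f Xs (v ! 0) (v ! 1))" "pr p n g" "pr p n h"
  shows "pr p n (\<lambda>Xs v. f Xs (g Xs v) (h Xs v))"
  using pr_comp[of p "[g, h]" "\<lambda>Xs v. f Xs (v ! 0) (v ! 1)" n] assms
  by (auto simp: numeral_2_eq_2)

text \<open>Recursion, sums and bounded quantifiers put their bound variables in front of the list,
  so outer variables occur behind \<open>tl\<close>.\<close>

lemma pr_nth_tl [pr_intros]:
  "Suc i < n \<Longrightarrow> pr p n (\<lambda>Xs v. tl v ! i)"
  "Suc (Suc i) < n \<Longrightarrow> pr p n (\<lambda>Xs v. tl (tl v) ! i)"
  "Suc (Suc (Suc i)) < n \<Longrightarrow> pr p n (\<lambda>Xs v. tl (tl (tl v)) ! i)"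
  by (rule pr_cong, erule pr_nth, simp add: nth_tl)+

lemma pr_Suc [pr_intros]: "pr p n f \<Longrightarrow> pr p n (\<lambda>Xs v. Suc (f Xs v))"
  using pr_comp[of p "[f]" "\<lambda>Xs v. Suc (hd v)" n] pr_prim_rec[OF prim_rec.succ[of p]] by simp

lemma pr_0 [pr_intros]: "pr p n (\<lambda>Xs v. 0)"
  by (intro pr_prim_rec prim_rec.zero)

lemma pr_const [pr_intros]: "pr p n (\<lambda>Xs v. c)"
  by (induction c) (intro pr_intros)+

lemma pr_query [pr_intros]: "i < p \<Longrightarrow> pr p n f \<Longrightarrow> prp p n (\<lambda>Xs v. (Xs ! i) (f Xs v))"
  using pr_comp[of p "[f]" "\<lambda>Xs v. of_bool ((Xs ! i) (hd v))" n] pr_prim_rec[OF prim_rec.query[of i p]] by simp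

lemma pr_rec [pr_intros]:
  assumes "pr p n a" "pr p (Suc (Suc n)) (\<lambda>Xs v. h Xs (v ! 0) (v ! 1) (tl (tl v)))" "pr p n m"
  shows "pr p n (\<lambda>Xs v. rec_nat (a Xs v) (\<lambda>i r. h Xs i r v) (m Xs v))"
proof -
  from assms(1) obtain A where A: "prim_rec p n A"
      "\<And>Xs v. length Xs = p \<Longrightarrow> length v = n \<Longrightarrow> a Xs v = A Xs v"
    unfolding pr_def by blast
  from assms(2) obtain H where H: "prim_rec p (Suc (Suc n)) H"
      "\<And>Xs v. length Xs = p \<Longrightarrow> length v = Suc (Suc n) \<Longrightarrow> h Xs (v ! 0) (v ! 1) (tl (tl v)) = H Xs v"
    unfolding pr_def by blast
  let ?gs = "m # map (\<lambda>i Xs v. v ! i) [0..<n]"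
  let ?R = "\<lambda>Xs v. rec_nat (A Xs (tl v)) (\<lambda>i r. H Xs (i # r # tl v)) (hd v)"
  have "pr p n (\<lambda>Xs v. ?R Xs (map (\<lambda>g. g Xs v) ?gs))"
    using pr_prim_rec[OF prim_rec.prec[OF A(1) H(1)]] assms(3)
    by (intro pr_comp) (auto intro: pr_intros)
  moreover have "?R Xs (map (\<lambda>g. g Xs v) ?gs) = rec_nat (a Xs v) (\<lambda>i r. h Xs i r v) (m Xs v)"
    if "length Xs = p" "length v = n" for Xs and v :: "nat list"
  proof -
    have "map (\<lambda>g. g Xs v) ?gs = m Xs v # v"
      using that map_nth[of v] by (simp add: comp_def)
    then show ?thesis using that A(2) H(2)[of Xs "_ # _ # v"] by simp
  qed
  ultimately show ?thesis by (elim pr_cong) simp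
qed

lemma pr_add [pr_intros]: "pr p n f \<Longrightarrow> pr p n g \<Longrightarrow> pr p n (\<lambda>Xs v. f Xs v + g Xs v)"
proof (rule pr_apply2[of p "\<lambda>Xs. (+)"])
  have "pr p 2 (\<lambda>Xs v. rec_nat (v ! 0) (\<lambda>i r. Suc r) (v ! 1))" by (intro pr_intros) auto
  moreover have "rec_nat a (\<lambda>i r. Suc r) b = a + b" for a b :: nat by (induction b) auto
  ultimately show "pr p 2 (\<lambda>Xs v. v ! 0 + v ! 1)" by simp
qed

lemma pr_mult [pr_intros]: "pr p n f \<Longrightarrow> pr p n g \<Longrightarrow> pr p n (\<lambda>Xs v. f Xs v * g Xs v)"
proof (rule pr_apply2[of p "\<lambda>Xs. (*)"])
  have "pr p 2 (\<lambda>Xs v. rec_nat 0 (\<lambda>i r. r + v ! 0) (v ! 1))" by (intro pr_intros) auto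
  moreover have "rec_nat 0 (\<lambda>i r. r + a) b = a * b" for a b :: nat by (induction b) auto
  ultimately show "pr p 2 (\<lambda>Xs v. v ! 0 * v ! 1)" by simp
qed

lemma pr_pred [pr_intros]: "pr p n f \<Longrightarrow> pr p n (\<lambda>Xs v. f Xs v - Suc 0)"
proof (rule pr_apply1[of p "\<lambda>Xs a. a - Suc 0"])
  have "pr p 1 (\<lambda>Xs v. rec_nat 0 (\<lambda>i r. i) (v ! 0))" by (intro pr_intros) auto
  moreover have "rec_nat 0 (\<lambda>i r. i) b = b - Suc 0" for b :: nat by (induction b) auto
  ultimately show "pr p 1 (\<lambda>Xs v. v ! 0 - Suc 0)" by simp
qed

lemma pr_diff [pr_intros]: "pr p n f \<Longrightarrow> pr p n g \<Longrightarrow> pr p n (\<lambda>Xs v. f Xs v - g Xs v)"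
proof (rule pr_apply2[of p "\<lambda>Xs. (-)"])
  have "pr p 2 (\<lambda>Xs v. rec_nat (v ! 0) (\<lambda>i r. r - Suc 0) (v ! 1))" by (intro pr_intros) auto
  moreover have "rec_nat a (\<lambda>i r. r - Suc 0) b = a - b" for a b :: nat by (induction b) auto
  ultimately show "pr p 2 (\<lambda>Xs v. v ! 0 - v ! 1)" by simp
qed

lemma prp_not [pr_intros]: "prp p n Q \<Longrightarrow> prp p n (\<lambda>Xs v. \<not> Q Xs v)"
proof -
  assume "prp p n Q"
  then have "pr p n (\<lambda>Xs v. 1 - of_bool (Q Xs v))" by (intro pr_intros)
  then show ?thesis by (elim pr_cong) simp
qed

lemma prp_conj [pr_intros]: "prp p n Q \<Longrightarrow> prp p n R \<Longrightarrow> prp p n (\<lambda>Xs v. Q Xs v \<and> R Xs v)"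
proof -
  assume "prp p n Q" "prp p n R"
  then have "pr p n (\<lambda>Xs v. of_bool (Q Xs v) * of_bool (R Xs v))" by (intro pr_intros)
  then show ?thesis by (elim pr_cong) simp
qed

lemma prp_disj [pr_intros]: "prp p n Q \<Longrightarrow> prp p n R \<Longrightarrow> prp p n (\<lambda>Xs v. Q Xs v \<or> R Xs v)"
proof -
  assume "prp p n Q" "prp p n R"
  then have "prp p n (\<lambda>Xs v. \<not> (\<not> Q Xs v \<and> \<not> R Xs v))" by (intro prp_not prp_conj)
  then show ?thesis by (elim pr_cong) simp
qed

lemma prp_imp [pr_intros]: "prp p n Q \<Longrightarrow> prp p n R \<Longrightarrow> prp p n (\<lambda>Xs v. Q Xs v \<longrightarrow> R Xs v)"
proof -
  assume "prp p n Q" "prp p n R"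
  then have "prp p n (\<lambda>Xs v. \<not> Q Xs v \<or> R Xs v)" by (intro prp_not prp_disj)
  then show ?thesis by (elim pr_cong) auto
qed

lemma prp_iff [pr_intros]: "prp p n Q \<Longrightarrow> prp p n R \<Longrightarrow> prp p n (\<lambda>Xs v. Q Xs v = R Xs v)"
proof -
  assume "prp p n Q" "prp p n R"
  then have "prp p n (\<lambda>Xs v. (Q Xs v \<longrightarrow> R Xs v) \<and> (R Xs v \<longrightarrow> Q Xs v))" by (intro prp_imp prp_conj)
  then show ?thesis by (elim pr_cong) auto
qed

lemma prp_less [pr_intros]: "pr p n f \<Longrightarrow> pr p n g \<Longrightarrow> prp p n (\<lambda>Xs v. f Xs v < g Xs v)"
proof -
  assume "pr p n f" "pr p n g"
  then have "pr p n (\<lambda>Xs v. 1 - (1 - (g Xs v - f Xs v)))" by (intro pr_intros)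
  then show ?thesis by (elim pr_cong) auto
qed

lemma prp_le [pr_intros]: "pr p n f \<Longrightarrow> pr p n g \<Longrightarrow> prp p n (\<lambda>Xs v. f Xs v \<le> g Xs v)"
proof -
  assume "pr p n f" "pr p n g"
  then have "prp p n (\<lambda>Xs v. \<not> g Xs v < f Xs v)" by (intro prp_not prp_less)
  then show ?thesis by (elim pr_cong) auto
qed

lemma prp_eq [pr_intros]: "pr p n f \<Longrightarrow> pr p n g \<Longrightarrow> prp p n (\<lambda>Xs v. f Xs v = g Xs v)"
proof -
  assume "pr p n f" "pr p n g"
  then have "prp p n (\<lambda>Xs v. f Xs v \<le> g Xs v \<and> g Xs v \<le> f Xs v)" by (intro prp_conj prp_le)
  then show ?thesis by (elim pr_cong) auto
qed

lemma pr_sum [pr_intros]: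
  assumes "pr p (Suc n) (\<lambda>Xs v. f Xs (v ! 0) (tl v))" "pr p n m"
  shows "pr p n (\<lambda>Xs v. \<Sum>i<m Xs v. f Xs i v)"
proof -
  \<comment> \<open>In the recursion the accumulator stands between the summation index and the
    outer variables; composing with projections drops it.\<close>
  have "pr p (Suc (Suc n)) (\<lambda>Xs v. f Xs (v ! 0) (tl (tl v)))"
  proof -
    let ?gs = "(\<lambda>Xs v. v ! 0) # map (\<lambda>i Xs v. v ! Suc (Suc i)) [0..<n] :: (pred list \<Rightarrow> nat list \<Rightarrow> nat) list"
    have "pr p (Suc (Suc n)) (\<lambda>Xs v. (\<lambda>Xs v. f Xs (v ! 0) (tl v)) Xs (map (\<lambda>g. g Xs v) ?gs))"
      using assms(1) by (intro pr_comp) (auto intro: pr_intros)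
    moreover have "map (\<lambda>g. g Xs v) ?gs = v ! 0 # tl (tl v)" if "length v = Suc (Suc n)" for Xs and v :: "nat list"
      using that by (intro nth_equalityI) (auto simp: nth_tl nth_Cons')
    ultimately show ?thesis by (elim pr_cong) simp
  qed
  with assms(2) have "pr p n (\<lambda>Xs v. rec_nat 0 (\<lambda>i r. r + f Xs i v) (m Xs v))"
    by (intro pr_intros) auto
  moreover have "rec_nat 0 (\<lambda>i r. r + f Xs i v) k = (\<Sum>i<k. f Xs i v)" for Xs v k
    by (induction k) auto
  ultimately show ?thesis by simp
qed

lemma prp_bex [pr_intros]:
  assumes "prp p (Suc n) (\<lambda>Xs v. Q Xs (v ! 0) (tl v))" "pr p n m"
  shows "prp p n (\<lambda>Xs v. \<exists>i<m Xs v. Q Xs i v)"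
proof -
  from assms have "prp p n (\<lambda>Xs v. 0 < (\<Sum>i<m Xs v. of_bool (Q Xs i v) :: nat))"
    by (intro prp_less pr_0 pr_sum) auto
  moreover have "0 < (\<Sum>i<m Xs v. of_bool (Q Xs i v) :: nat) \<longleftrightarrow> (\<exists>i<m Xs v. Q Xs i v)" for Xs v
    by (subst zero_less_iff_neq_zero) auto
  ultimately show ?thesis by simp
qed

lemma prp_ball [pr_intros]:
  assumes "prp p (Suc n) (\<lambda>Xs v. Q Xs (v ! 0) (tl v))" "pr p n m"
  shows "prp p n (\<lambda>Xs v. \<forall>i<m Xs v. Q Xs i v)"
proof -
  have "prp p n (\<lambda>Xs v. \<not> (\<exists>i<m Xs v. \<not> Q Xs i v))" using assms by (intro prp_not prp_bex) auto
  then show ?thesis by (elim pr_cong) auto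
qed

lemma pr_half [pr_intros]: "pr p n f \<Longrightarrow> pr p n (\<lambda>Xs v. f Xs v div 2)"
proof (rule pr_apply1[of p "\<lambda>Xs a. a div 2"])
  \<comment> \<open>Halving satisfies \<open>Suc i div 2 = i - i div 2\<close>.\<close>
  have "pr p 1 (\<lambda>Xs v. rec_nat 0 (\<lambda>i r. i - r) (v ! 0))" by (intro pr_intros) auto
  moreover have "rec_nat 0 (\<lambda>i r. i - r) b = b div 2" for b :: nat by (induction b) auto
  ultimately show "pr p 1 (\<lambda>Xs v. v ! 0 div 2)" by simp
qed

lemma prp_odd [pr_intros]: "pr p n f \<Longrightarrow> prp p n (\<lambda>Xs v. odd (f Xs v))"
proof -
  assume "pr p n f"
  then have "prp p n (\<lambda>Xs v. \<not> f Xs v div 2 + f Xs v div 2 = f Xs v)" by (intro pr_intros)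
  moreover have "a div 2 + a div 2 = a \<longleftrightarrow> even a" for a :: nat by presburger
  ultimately show ?thesis by simp
qed

lemma pr_power2 [pr_intros]: "pr p n f \<Longrightarrow> pr p n (\<lambda>Xs v. 2 ^ f Xs v)"
proof (rule pr_apply1[of p "\<lambda>Xs a. 2 ^ a"])
  have "pr p 1 (\<lambda>Xs v. rec_nat 1 (\<lambda>i r. r + r) (v ! 0))" by (intro pr_intros) auto
  moreover have "rec_nat 1 (\<lambda>i r. r + r) b = (2 :: nat) ^ b" for b :: nat by (induction b) auto
  ultimately show "pr p 1 (\<lambda>Xs v. 2 ^ (v ! 0))" by simp
qed

lemma pr_prod_encode [pr_intros]:
  "pr p n f \<Longrightarrow> pr p n g \<Longrightarrow> pr p n (\<lambda>Xs v. prod_encode (f Xs v, g Xs v))"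
proof -
  have "pr p 1 (\<lambda>Xs v. rec_nat 0 (\<lambda>i r. r + Suc i) (v ! 0))" by (intro pr_intros) auto
  moreover have "rec_nat 0 (\<lambda>i r. r + Suc i) b = triangle b" for b :: nat
    by (induction b) (auto simp: triangle_Suc)
  ultimately have "pr p 1 (\<lambda>Xs v. triangle (v ! 0))" by simp
  note tri = pr_apply1[of p "\<lambda>Xs. triangle", OF this]
  assume "pr p n f" "pr p n g"
  then have "pr p n (\<lambda>Xs v. triangle (f Xs v + g Xs v) + f Xs v)" by (intro tri pr_intros)
  then show ?thesis by (simp add: prod_encode_def)
qed

lemma prp_set_decode [pr_intros]:
  "pr p n f \<Longrightarrow> pr p n g \<Longrightarrow> prp p n (\<lambda>Xs v. f Xs v \<in> set_decode (g Xs v))"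
proof (rule pr_apply2[of p "\<lambda>Xs a b. of_bool (a \<in> set_decode b)"])
  have "prp p 2 (\<lambda>Xs v. odd (rec_nat (v ! 1) (\<lambda>i r. r div 2) (v ! 0)))" by (intro pr_intros) auto
  moreover have "rec_nat a (\<lambda>i r. r div 2) b = a div 2 ^ b" for a b :: nat
    by (induction b) (auto simp flip: div_mult2_eq simp: mult.commute)
  ultimately show "prp p 2 (\<lambda>Xs v. v ! 0 \<in> set_decode (v ! 1))" by (simp add: set_decode_def)
qed

section \<open>Limit computability\<close>

text \<open>The Ackermann membership relation. \<open>sum_encode\<close> sends set codes to odd
  numbers, and \<open>n div 2\<close> recovers the set code.\<close>

definition has_code :: "nat \<Rightarrow> nat \<Rightarrow> bool" where
  "has_code n m \<longleftrightarrow> odd n \<and> m \<in> set_decode (n div 2)"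

lemma has_code_est_code: "has_code (est_code s) m \<longleftrightarrow> (\<exists>s'\<in>elems s. m = est_code s')"
  by (cases s) (auto simp: has_code_def sum_encode_def set_encode_inverse)

text \<open>Members have smaller codes, which makes quantifiers over elements bounded and therefore
  primitive recursive.\<close>

lemma has_code_less: "has_code n m \<Longrightarrow> m < n"
proof -
  assume "has_code n m"
  then have "odd (n div 2 div 2 ^ m)" by (simp add: has_code_def set_decode_def)
  then have "n div 2 div 2 ^ m \<noteq> 0" by (intro notI) simp
  then have "2 ^ m \<le> n div 2" by (simp add: div_eq_0_iff)
  moreover have "m < 2 ^ m" by (rule less_exp)
  ultimately show ?thesis by linarith
qed

lemma est_code_less: "s' \<in> elems s \<Longrightarrow> est_code s' < est_code s"
  using has_code_est_code has_code_less by blast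

lemma prp_has_code [pr_intros]:
  "pr p n f \<Longrightarrow> pr p n g \<Longrightarrow> prp p n (\<lambda>Xs v. has_code (f Xs v) (g Xs v))"
  unfolding has_code_def by (intro pr_intros)

lemma pr_apply4:
  assumes "pr p 4 (\<lambda>Xs v. f Xs (v ! 0) (v ! 1) (v ! 2) (v ! 3))"
    "pr p n g" "pr p n h" "pr p n k" "pr p n l"
  shows "pr p n (\<lambda>Xs v. f Xs (g Xs v) (h Xs v) (k Xs v) (l Xs v))"
  using pr_comp[of p "[g, h, k, l]" "\<lambda>Xs v. f Xs (v ! 0) (v ! 1) (v ! 2) (v ! 3)" n] assms
  by (auto simp: numeral_eq_Suc)

text \<open>Limits are computed from numbers \<open>y\<close>, read as bit strings, and not from
  oracles, so that a search through candidates for a quantified set can be a bounded search through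
  numbers.\<close>

definition matches :: "nat \<Rightarrow> pred \<Rightarrow> nat \<Rightarrow> bool" where
  "matches N X y \<longleftrightarrow> (\<forall>i<N. i \<in> set_decode y \<longleftrightarrow> X i)"

lemma matches_mono: "matches N X y \<Longrightarrow> M \<le> N \<Longrightarrow> matches M X y"
  unfolding matches_def by simp

lemma ex_matches: "\<exists>y<2 ^ N. matches N X y"
proof (intro exI conjI)
  let ?A = "{i. i < N \<and> X i}"
  have "set_encode ?A \<le> (\<Sum>i<N. 2 ^ i)"
    unfolding set_encode_def by (rule sum_mono2) auto
  also have "\<dots> < (2::nat) ^ N" by (induction N) auto
  finally show "set_encode ?A < 2 ^ N" .
  show "matches N X (set_encode ?A)" by (simp add: matches_def set_encode_inverse)
qed

abbreviation approximates ::
  "nat \<Rightarrow> (nat \<Rightarrow> nat \<Rightarrow> bool) \<Rightarrow> (nat \<Rightarrow> nat) \<Rightarrow> (pred \<Rightarrow> bool) \<Rightarrow> pred \<Rightarrow> bool" where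
  "approximates k P h Q X \<equiv>
     for_every_estimator k (\<lambda>s. \<forall>y. matches (h (est_code s)) X y \<longrightarrow> P (est_code s) y = Q X)"

text \<open>The number \<open>h n\<close> bounds the bits of \<open>X\<close> that \<open>P\<close> needs at the estimator coded by \<open>n\<close>.\<close>

definition limit_computable :: "nat \<Rightarrow> (pred \<Rightarrow> bool) \<Rightarrow> bool" where
  "limit_computable k Q \<longleftrightarrow> (\<exists>P h. (\<forall>p. prp p 2 (\<lambda>Xs v. P (v ! 0) (v ! 1))) \<and>
     (\<forall>p. pr p 1 (\<lambda>Xs v. h (v ! 0))) \<and>
     (\<forall>X. approximates k P h Q X))"

text \<open>An ordinary limit is a limit along level 0: the pairs with first entry at least
  \<open>N\<close> form a valid notion, with bound 0 on the second entry, and their codes are at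
  least \<open>N\<close>.\<close>

lemma limit_computable_0:
  assumes "\<And>p. prp p 2 (\<lambda>Xs v. P (v ! 0) (v ! 1))" "\<And>p. pr p 1 (\<lambda>Xs v. h (v ! 0))"
    and lim: "\<And>X. \<exists>N. \<forall>n\<ge>N. \<forall>y. matches (h n) X y \<longrightarrow> P n y = Q X"
  shows "limit_computable 0 Q"
proof -
  have "approximates 0 P h Q X" for X
  proof -
    from lim[of X] obtain N where N: "\<And>n y. n \<ge> N \<Longrightarrow> matches (h n) X y \<Longrightarrow> P n y = Q X" by blast
    let ?R = "{EPair a b |a b. a \<ge> N}"
    have "valid_notion 0 ?R" unfolding valid_notion.simps(1)
      by (intro conjI exI[of _ N] exI[of _ "\<lambda>_. 0 :: nat"]) auto
    moreover have "est_code s \<ge> N" if s: "s \<in> ?R" for s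
    proof -
      from s obtain a b where "s = EPair a b" "a \<ge> N" by blast
      then show ?thesis using le_prod_encode_1[of a b] by (simp add: sum_encode_def)
    qed
    ultimately show ?thesis unfolding for_every_estimator_def using N by (intro exI[of _ ?R]) blast
  qed
  with assms(1,2) show ?thesis unfolding limit_computable_def by blast
qed

lemma limit_computable_not: "limit_computable k Q \<Longrightarrow> limit_computable k (\<lambda>X. \<not> Q X)"
proof -
  assume "limit_computable k Q"
  then obtain P h where P: "\<forall>p. prp p 2 (\<lambda>Xs v. P (v ! 0) (v ! 1))" "\<forall>p. pr p 1 (\<lambda>Xs v. h (v ! 0))"
    "\<forall>X. approximates k P h Q X"
    unfolding limit_computable_def by blast
  show ?thesis unfolding limit_computable_def
  proof (rule exI[of _ "\<lambda>n y. \<not> P n y"], rule exI[of _ h], intro conjI allI)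
    show "prp p 2 (\<lambda>Xs v. \<not> P (v ! 0) (v ! 1))" for p using P(1) by (intro prp_not) blast
  qed (use P(2,3) in simp_all)
qed

lemma limit_computable_conj:
  assumes "limit_computable k Q" "limit_computable k R"
  shows "limit_computable k (\<lambda>X. Q X \<and> R X)"
proof -
  from assms(1) obtain P h where P: "\<forall>p. prp p 2 (\<lambda>Xs v. P (v ! 0) (v ! 1))" "\<forall>p. pr p 1 (\<lambda>Xs v. h (v ! 0))"
    "\<And>X. approximates k P h Q X"
    unfolding limit_computable_def by blast
  from assms(2) obtain P' h' where P': "\<forall>p. prp p 2 (\<lambda>Xs v. P' (v ! 0) (v ! 1))" "\<forall>p. pr p 1 (\<lambda>Xs v. h' (v ! 0))"
    "\<And>X. approximates k P' h' R X"
    unfolding limit_computable_def by blast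
  show ?thesis unfolding limit_computable_def
  proof (rule exI[of _ "\<lambda>n y. P n y \<and> P' n y"], rule exI[of _ "\<lambda>n. h n + h' n"], intro conjI allI)
    show "prp p 2 (\<lambda>Xs v. P (v ! 0) (v ! 1) \<and> P' (v ! 0) (v ! 1))" for p
      using P(1) P'(1) by (intro prp_conj) blast+
    show "pr p 1 (\<lambda>Xs v. h (v ! 0) + h' (v ! 0))" for p
      using P(2) P'(2) by (intro pr_add) blast+
    fix X
    show "for_every_estimator k (\<lambda>s. \<forall>y. matches (h (est_code s) + h' (est_code s)) X y \<longrightarrow>
        (P (est_code s) y \<and> P' (est_code s) y) = (Q X \<and> R X))"
      using for_every_conj[OF P(3)[of X] P'(3)[of X]]
      by (rule for_every_mono) (metis matches_mono le_add1 le_add2)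
  qed
qed

text \<open>A monotone majorant of \<open>h\<close>. Codes decrease along membership, so its value
  at a set bounds the bits needed by the elements and by their elements.\<close>

definition partial_sum :: "(nat \<Rightarrow> nat) \<Rightarrow> nat \<Rightarrow> nat" where
  "partial_sum h n = (\<Sum>i<Suc n. h i)"

lemma le_partial_sum: "s' \<in> elems s \<Longrightarrow> h (est_code s') \<le> partial_sum h (est_code s)"
proof -
  assume "s' \<in> elems s"
  then have "est_code s' < est_code s" by (rule est_code_less)
  then show ?thesis unfolding partial_sum_def by (intro member_le_sum) auto
qed

lemma partial_sum_mono: "m \<le> n \<Longrightarrow> partial_sum h m \<le> partial_sum h n"
  unfolding partial_sum_def by (rule sum_mono2) auto

lemma le_partial_sum2:
  "s' \<in> elems s \<Longrightarrow> s'' \<in> elems s' \<Longrightarrow> h (est_code s'') \<le> partial_sum h (est_code s)"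
proof -
  assume s: "s' \<in> elems s" "s'' \<in> elems s'"
  have "est_code s' < est_code s" using s(1) by (rule est_code_less)
  then show ?thesis using le_partial_sum[OF s(2), of h] partial_sum_mono[of "est_code s'" "est_code s" h]
    by simp
qed

lemma pr_partial_sum:
  assumes "pr p 1 (\<lambda>Xs v. h (v ! 0))" "pr p n f"
  shows "pr p n (\<lambda>Xs v. partial_sum h (f Xs v))"
proof (rule pr_apply1[of p "\<lambda>Xs. partial_sum h", OF _ assms(2)])
  have "pr p 2 (\<lambda>Xs v. h (v ! 0))" by (rule pr_apply1[of p "\<lambda>Xs. h", OF assms(1) pr_nth]) simp
  then show "pr p 1 (\<lambda>Xs v. partial_sum h (v ! 0))" unfolding partial_sum_def
    by (intro pr_sum pr_Suc pr_nth) (simp_all add: numeral_2_eq_2)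
qed

text \<open>The new predicate asks whether some element satisfies \<open>P\<close>; its answer is
  right once all elements are right and there is at least one.\<close>

lemma limit_computable_Suc:
  assumes "limit_computable k Q"
  shows "limit_computable (Suc k) Q"
proof -
  from assms obtain P h where P: "\<forall>p. prp p 2 (\<lambda>Xs v. P (v ! 0) (v ! 1))" "\<forall>p. pr p 1 (\<lambda>Xs v. h (v ! 0))"
    "\<And>X. approximates k P h Q X"
    unfolding limit_computable_def by blast
  show ?thesis unfolding limit_computable_def
  proof (rule exI[of _ "\<lambda>n y. \<exists>m<n. has_code n m \<and> P m y"], rule exI[of _ "partial_sum h"], intro conjI allI)
    fix p
    have "prp p n (\<lambda>Xs v. P (f Xs v) (g Xs v))" if "pr p n f" "pr p n g" for n f g
      using pr_apply2[of p "\<lambda>Xs a b. of_bool (P a b)"] P(1) that by blast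
    note PP = this
    show "prp p 2 (\<lambda>Xs v. \<exists>m<v ! 0. has_code (v ! 0) m \<and> P m (v ! 1))"
      by (intro prp_bex prp_conj prp_has_code PP pr_nth pr_nth_tl) simp_all
    show "pr p 1 (\<lambda>Xs v. partial_sum h (v ! 0))" using P(2) by (intro pr_partial_sum pr_intros) auto
  next
    fix X
    let ?\<psi> = "\<lambda>s. \<forall>y. matches (h (est_code s)) X y \<longrightarrow> P (est_code s) y = Q X"
    show "for_every_estimator (Suc k) (\<lambda>s. \<forall>y. matches (partial_sum h (est_code s)) X y \<longrightarrow>
        (\<exists>m<est_code s. has_code (est_code s) m \<and> P m y) = Q X)"
      \<comment> \<open>The first conjunct supplies an element, for the second holds also of the
        empty set.\<close>
      using for_every_conj[OF for_every_ex_elem[OF P(3)[of X]] for_every_all_elems[OF P(3)[of X]]]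
    proof (rule for_every_mono, intro allI impI)
      fix s y
      assume s: "(\<exists>s'\<in>elems s. ?\<psi> s') \<and> (\<forall>s'\<in>elems s. ?\<psi> s')"
        and y: "matches (partial_sum h (est_code s)) X y"
      have "P (est_code s') y = Q X" if "s' \<in> elems s" for s'
        using s that matches_mono[OF y le_partial_sum[OF that]] by blast
      then have "has_code (est_code s) m \<Longrightarrow> P m y = Q X" for m
        by (auto simp: has_code_est_code)
      moreover from s obtain s' where "has_code (est_code s) (est_code s')"
        using has_code_est_code by blast
      ultimately show "(\<exists>m<est_code s. has_code (est_code s) m \<and> P m y) = Q X"
        using has_code_less by blast
    qed
  qed
qed

lemma limit_computable_mono: "limit_computable k Q \<Longrightarrow> k \<le> l \<Longrightarrow> limit_computable l Q"
  by (induction l) (auto simp: le_Suc_eq intro: limit_computable_Suc)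

abbreviation agree_off :: "nat set \<Rightarrow> pred \<Rightarrow> pred \<Rightarrow> bool" where
  "agree_off D X Y \<equiv> \<forall>i. i \<notin> D \<longrightarrow> Y i = X i"

text \<open>The quantified bits live inside \<open>X\<close>, at the positions in \<open>D\<close>,
  so that the environment of a formula remains a single bit sequence under quantifiers.\<close>

lemma limit_computable_ex:
  assumes Q: "limit_computable k Q" and D: "\<And>p. prp p 1 (\<lambda>Xs v. v ! 0 \<in> D)"
  shows "limit_computable (k + 2) (\<lambda>X. \<exists>Y. agree_off D X Y \<and> Q Y)"
proof -
  from Q obtain P h where P: "\<forall>p. prp p 2 (\<lambda>Xs v. P (v ! 0) (v ! 1))" "\<forall>p. pr p 1 (\<lambda>Xs v. h (v ! 0))"
    "\<And>X. approximates k P h Q X"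
    unfolding limit_computable_def by blast
  let ?H = "partial_sum h"
  \<comment> \<open>A candidate enters only through its first \<open>?H n\<close> bits
    \<open>z\<close>, hence the bound on the search; off \<open>D\<close> these bits are copied from
    \<open>y\<close>.\<close>
  define P' where "P' n y \<longleftrightarrow> (\<exists>z<2 ^ ?H n. (\<forall>i<?H n. i \<in> D \<or> (i \<in> set_decode z) = (i \<in> set_decode y)) \<and>
      (\<forall>m<n. has_code n m \<longrightarrow> (\<exists>l<m. has_code m l \<and> P l z)))" for n y
  have P'_code: "P' (est_code s) y \<longleftrightarrow>
      (\<exists>z<2 ^ ?H (est_code s). (\<forall>i<?H (est_code s). i \<in> D \<or> (i \<in> set_decode z) = (i \<in> set_decode y)) \<and>
        (\<forall>s'\<in>elems s. \<exists>s''\<in>elems s'. P (est_code s'') z))" for s y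
  proof -
    have 1: "(\<forall>m<est_code s. has_code (est_code s) m \<longrightarrow> A m) \<longleftrightarrow> (\<forall>s'\<in>elems s. A (est_code s'))" for A s
      by (metis est_code_less has_code_est_code)
    have 2: "(\<exists>m<est_code s. has_code (est_code s) m \<and> A m) \<longleftrightarrow> (\<exists>s'\<in>elems s. A (est_code s'))" for A s
      by (metis est_code_less has_code_est_code)
    show ?thesis by (simp only: P'_def 1 2)
  qed
  show ?thesis unfolding limit_computable_def
  proof (rule exI[of _ P'], rule exI[of _ ?H], intro conjI allI)
    fix p
    have PP: "prp p n (\<lambda>Xs v. P (f Xs v) (g Xs v))" if "pr p n f" "pr p n g" for n f g
      using pr_apply2[of p "\<lambda>Xs a b. of_bool (P a b)"] P(1) that by blast
    have DD: "prp p n (\<lambda>Xs v. f Xs v \<in> D)" if "pr p n f" for n f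
      using pr_apply1[of p "\<lambda>Xs a. of_bool (a \<in> D)"] D that by blast
    have HH: "pr p n (\<lambda>Xs v. ?H (f Xs v))" if "pr p n f" for n f
      using P(2) that by (intro pr_partial_sum) auto
    show "prp p 2 (\<lambda>Xs v. P' (v ! 0) (v ! 1))" unfolding P'_def
      by (intro prp_bex prp_ball prp_conj prp_imp prp_disj prp_iff prp_set_decode prp_has_code PP DD HH
          pr_power2 pr_nth pr_nth_tl) simp_all
    show "pr p 1 (\<lambda>Xs v. ?H (v ! 0))" by (intro HH pr_intros) simp
  next
    fix X
    let ?\<psi> = "\<lambda>Y s. \<forall>y. matches (h (est_code s)) Y y \<longrightarrow> P (est_code s) y = Q Y"
    let ?\<phi> = "\<lambda>s. \<forall>y. matches (?H (est_code s)) X y \<longrightarrow>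
       P' (est_code s) y = (\<exists>Y. agree_off D X Y \<and> Q Y)"
    show "for_every_estimator (k + 2) ?\<phi>"
    proof (cases "\<exists>Y. agree_off D X Y \<and> Q Y")
      case True
      then obtain Y where Y: "\<And>i. i \<notin> D \<Longrightarrow> Y i = X i" "Q Y" by blast
      \<comment> \<open>The witness \<open>Y\<close> is fixed, so each element of \<open>s\<close>
        may be assumed to contain an estimator that is right about \<open>Y\<close>.\<close>
      have "for_every_estimator (k + 2) (\<lambda>s. \<forall>s'\<in>elems s. \<exists>s''\<in>elems s'. ?\<psi> Y s'')"
        using for_every_all_elems[OF for_every_ex_elem[OF P(3)[of Y]]] by simp
      then show ?thesis
      proof (rule for_every_mono, intro allI impI)
        fix s y
        assume s: "\<forall>s'\<in>elems s. \<exists>s''\<in>elems s'. ?\<psi> Y s''" and y: "matches (?H (est_code s)) X y"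
        obtain z where z: "z < 2 ^ ?H (est_code s)" "matches (?H (est_code s)) Y z"
          using ex_matches by blast
        have "\<exists>s''\<in>elems s'. P (est_code s'') z" if s': "s' \<in> elems s" for s'
        proof -
          from s s' obtain s'' where s'': "s'' \<in> elems s'" "?\<psi> Y s''" by blast
          with matches_mono[OF z(2) le_partial_sum2[OF s' s''(1)]] Y(2) show ?thesis by blast
        qed
        moreover have "\<forall>i<?H (est_code s). i \<in> D \<or> (i \<in> set_decode z) = (i \<in> set_decode y)"
          using y z(2) Y(1) unfolding matches_def by auto
        ultimately have "P' (est_code s) y" unfolding P'_code using z(1) by blast
        with True show "P' (est_code s) y = (\<exists>Y. agree_off D X Y \<and> Q Y)" by blast
      qed
    next
      case False
      \<comment> \<open>\<open>s'\<close> rejects \<open>Y\<close> if all its elements do. The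
        premise makes this vacuous for inadmissible \<open>Y\<close>, so compactness applies to all
        of Cantor space.\<close>
      let ?W = "\<lambda>Y s'. agree_off D X Y \<longrightarrow>
        (\<forall>s''\<in>elems s'. \<forall>z. matches (h (est_code s'')) Y z \<longrightarrow> \<not> P (est_code s'') z)"
      have "for_every_estimator (Suc (Suc k)) (\<lambda>s. \<forall>Y. \<exists>s'\<in>elems s. ?W Y s')"
      proof (rule for_every_Suc_upward_finite[where \<psi> = "\<lambda>A. \<forall>Y. \<exists>s'\<in>A. ?W Y s'"])
        fix S assume S: "valid_notion (Suc k) S"
        show "\<exists>F. finite F \<and> F \<subseteq> S \<and> (\<forall>Y. \<exists>s'\<in>F. ?W Y s')"
        proof (rule cantor_space_compact)
          fix Y :: pred
          show "\<exists>s'\<in>S. \<exists>E. finite E \<and> (\<forall>Y'. (\<forall>d\<in>E. Y' d = Y d) \<longrightarrow> ?W Y' s')"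
          proof (cases "agree_off D X Y")
            case True
            with False have nQ: "\<not> Q Y" by blast
            from P(3)[of Y] obtain R where R: "valid_notion k R" "\<forall>s\<in>R. ?\<psi> Y s"
              unfolding for_every_estimator_def by blast
            from S R(1) obtain s' where s': "s' \<in> S" "elems s' \<subseteq> R"
              unfolding valid_notion.simps(2) by blast
            have "?W Y' s'" if Y': "\<forall>d\<in>{..<?H (est_code s')}. Y' d = Y d" for Y'
            proof (intro impI ballI allI)
              fix s'' z assume s'': "s'' \<in> elems s'" and z: "matches (h (est_code s'')) Y' z"
              have "matches (h (est_code s'')) Y z"
                using z Y' le_partial_sum[OF s'', of h] unfolding matches_def by auto
              then show "\<not> P (est_code s'') z" using nQ R(2) s'(2) s'' by blast
            qed
            then show ?thesis using s'(1)
              by (intro bexI[of _ s'] exI[of _ "{..<?H (est_code s')}"] conjI allI impI) simp_all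
          next
            case False
            then obtain i where i: "i \<notin> D" "Y i \<noteq> X i" by blast
            obtain s' where "s' \<in> S" using valid_notion_Int[OF S S] by blast
            with i show ?thesis by (intro bexI[of _ s'] exI[of _ "{i}"] conjI allI impI) auto
          qed
        qed
      qed blast
      then show ?thesis unfolding add_2_eq_Suc'
      proof (rule for_every_mono, intro allI impI)
        fix s y
        assume s: "\<forall>Y. \<exists>s'\<in>elems s. ?W Y s'" and y: "matches (?H (est_code s)) X y"
        have "\<not> P' (est_code s) y"
        proof
          assume "P' (est_code s) y"
          then obtain z where
            z: "\<forall>i<?H (est_code s). i \<in> D \<or> (i \<in> set_decode z) = (i \<in> set_decode y)"
              "\<forall>s'\<in>elems s. \<exists>s''\<in>elems s'. P (est_code s'') z"
            unfolding P'_code by blast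
          \<comment> \<open>Continuing \<open>z\<close> by \<open>X\<close> beyond the inspected
            bits keeps \<open>Y\<close> admissible, so some \<open>s'\<close> in \<open>s\<close>
            rejects it.\<close>
          define Y where "Y i = (if i < ?H (est_code s) then i \<in> set_decode z else X i)" for i
          have "agree_off D X Y" using z(1) y unfolding Y_def matches_def by auto
          moreover have "matches (?H (est_code s)) Y z" by (simp add: matches_def Y_def)
          moreover from s obtain s' where "s' \<in> elems s" "?W Y s'" by blast
          ultimately show False using z(2) matches_mono[OF _ le_partial_sum2] by metis
        qed
        with False show "P' (est_code s) y = (\<exists>Y. agree_off D X Y \<and> Q Y)" by blast
      qed
    qed
  qed
qed

section \<open>Truth of formulas as a limit along a table of bits\<close>

definition bit_index :: "nat \<Rightarrow> nat \<Rightarrow> nat \<Rightarrow> nat" where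
  "bit_index c i j = prod_encode (c, prod_encode (i, j))"

lemma bit_index_eq [simp]: "bit_index c i j = bit_index c' i' j' \<longleftrightarrow> c = c' \<and> i = i' \<and> j = j'"
  by (simp add: bit_index_def)

lemma bit_index_ge: "i \<le> bit_index c i j" "j \<le> bit_index c i j"
  using le_prod_encode_1[of i j] le_prod_encode_2[of j i] le_prod_encode_2[of "prod_encode (i, j)" c]
  by (auto simp: bit_index_def)

lemma pr_bit_index [pr_intros]:
  "pr p n f \<Longrightarrow> pr p n g \<Longrightarrow> pr p n h \<Longrightarrow> pr p n (\<lambda>Xs v. bit_index (f Xs v) (g Xs v) (h Xs v))"
  unfolding bit_index_def by (intro pr_intros)

text \<open>Every table of bits codes a total function: the value is 0 if the table has no entry.\<close>

definition read :: "pred \<Rightarrow> nat \<Rightarrow> nat \<Rightarrow> nat" where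
  "read X c i = (if \<exists>j. X (bit_index c i j) then LEAST j. X (bit_index c i j) else 0)"

lemma read_single: "(\<And>j. X (bit_index c i j) \<longleftrightarrow> j = a) \<Longrightarrow> read X c i = a"
  unfolding read_def by (simp add: Least_equality[of "\<lambda>j. j = a" a])

lemma read_cong: "(\<And>j. X (bit_index c i j) = Y (bit_index c i j)) \<Longrightarrow> read X c i = read Y c i"
  unfolding read_def by simp

text \<open>The value of \<open>read\<close> as far as bits below \<open>n\<close> show it. At most
  one summand is nonzero, the least visible entry, so the sum is a primitive recursive
  search.\<close>

definition look :: "nat \<Rightarrow> nat \<Rightarrow> nat \<Rightarrow> nat \<Rightarrow> nat" where
  "look y n c i = (\<Sum>j<n. of_bool ((bit_index c i j < n \<and> bit_index c i j \<in> set_decode y) \<and>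
     (\<forall>l<j. \<not> (bit_index c i l < n \<and> bit_index c i l \<in> set_decode y))) * j)"

lemma look_converges: "\<exists>N. \<forall>n\<ge>N. \<forall>y. matches n X y \<longrightarrow> look y n c i = read X c i"
proof (cases "\<exists>j. X (bit_index c i j)")
  case False
  have "look y n c i = 0" if y: "matches n X y" for n y
    unfolding look_def
  proof (intro sum.neutral ballI)
    fix j
    have "\<not> (bit_index c i j < n \<and> bit_index c i j \<in> set_decode y)"
      using y False unfolding matches_def by blast
    then show "of_bool ((bit_index c i j < n \<and> bit_index c i j \<in> set_decode y) \<and>
     (\<forall>l<j. \<not> (bit_index c i l < n \<and> bit_index c i l \<in> set_decode y))) * j = 0"
      by (simp only: simp_thms of_bool_eq mult_zero_left)
  qed
  moreover have "read X c i = 0" using False unfolding read_def by simp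
  ultimately show ?thesis by simp
next
  case True
  define j0 where "j0 = (LEAST j. X (bit_index c i j))"
  have j0: "X (bit_index c i j0)" unfolding j0_def using True by (rule LeastI_ex)
  have least: "j0 \<le> j" if "X (bit_index c i j)" for j
    unfolding j0_def using that by (rule Least_le)
  have rd: "read X c i = j0" using True unfolding read_def j0_def by simp
  \<comment> \<open>Only true entries of the table are ever visible, so \<open>j0\<close> stays the
    least one as soon as it is seen.\<close>
  have "look y n c i = j0" if n: "bit_index c i j0 < n" and y: "matches n X y" for n y
  proof -
    let ?R = "\<lambda>j. bit_index c i j < n \<and> bit_index c i j \<in> set_decode y"
    have R: "?R j \<longleftrightarrow> bit_index c i j < n \<and> X (bit_index c i j)" for j
      using y unfolding matches_def by blast
    have "?R j \<and> (\<forall>l<j. \<not> ?R l) \<longleftrightarrow> j = j0" for j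
      unfolding R using j0 n least by (metis leD le_neq_implies_less)
    then have "look y n c i = (\<Sum>j<n. of_bool (j = j0) * j)" unfolding look_def by simp
    also have "\<dots> = (\<Sum>j<n. if j = j0 then j0 else 0)" by (rule sum.cong) auto
    also have "\<dots> = j0" using n bit_index_ge(2)[of j0 c i] by simp
    finally show ?thesis .
  qed
  with rd show ?thesis by (intro exI[of _ "Suc (bit_index c i j0)"]) auto
qed

lemma pr_look [pr_intros]:
  "pr p n f \<Longrightarrow> pr p n g \<Longrightarrow> pr p n h \<Longrightarrow> pr p n k \<Longrightarrow>
    pr p n (\<lambda>Xs v. look (f Xs v) (g Xs v) (h Xs v) (k Xs v))"
proof (rule pr_apply4[of p "\<lambda>Xs. look"])
  show "pr p 4 (\<lambda>Xs v. look (v ! 0) (v ! 1) (v ! 2) (v ! 3))" unfolding look_def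
    by (intro pr_sum pr_mult prp_ball prp_conj prp_not prp_less prp_set_decode pr_bit_index pr_nth pr_nth_tl)
      simp_all
qed

text \<open>Column 0 of the table holds the number variables, column \<open>Suc j\<close> the
  function variable \<open>j\<close>.\<close>

primrec approx_val :: "nat \<Rightarrow> nat \<Rightarrow> soa_term \<Rightarrow> nat" where
  "approx_val y n (Var i) = look y n 0 i"
| "approx_val y n Zero = 0"
| "approx_val y n (Succ t) = Suc (approx_val y n t)"
| "approx_val y n (Plus t u) = approx_val y n t + approx_val y n u"
| "approx_val y n (Times t u) = approx_val y n t * approx_val y n u"
| "approx_val y n (App j t) = look y n (Suc j) (approx_val y n t)"

lemma pr_approx_val [pr_intros]:
  "pr p n f \<Longrightarrow> pr p n g \<Longrightarrow> pr p n (\<lambda>Xs v. approx_val (f Xs v) (g Xs v) t)"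
  by (induction t) (auto intro!: pr_look pr_const pr_add pr_mult pr_Suc)

abbreviation env_val :: "pred \<Rightarrow> soa_term \<Rightarrow> nat" where
  "env_val X \<equiv> soa_val (read X 0) (\<lambda>j. read X (Suc j))"

abbreviation env_sat :: "pred \<Rightarrow> soa_formula \<Rightarrow> bool" where
  "env_sat X \<equiv> soa_sat (read X 0) (\<lambda>j. read X (Suc j))"

lemma approx_val_converges:
  "\<exists>N. \<forall>n\<ge>N. \<forall>y. matches n X y \<longrightarrow> approx_val y n t = env_val X t"
proof (induction t)
  case (Var i)
  show ?case using look_converges[of X 0 i] by simp
next
  case (Plus t u)
  then obtain N M where "\<forall>n\<ge>N. \<forall>y. matches n X y \<longrightarrow> approx_val y n t = env_val X t"
    "\<forall>n\<ge>M. \<forall>y. matches n X y \<longrightarrow> approx_val y n u = env_val X u" by blast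
  then show ?case by (intro exI[of _ "max N M"]) simp
next
  case (Times t u)
  then obtain N M where "\<forall>n\<ge>N. \<forall>y. matches n X y \<longrightarrow> approx_val y n t = env_val X t"
    "\<forall>n\<ge>M. \<forall>y. matches n X y \<longrightarrow> approx_val y n u = env_val X u" by blast
  then show ?case by (intro exI[of _ "max N M"]) simp
next
  case (App j t)
  then obtain N where N: "\<forall>n\<ge>N. \<forall>y. matches n X y \<longrightarrow> approx_val y n t = env_val X t" by blast
  obtain M where M: "\<forall>n\<ge>M. \<forall>y. matches n X y \<longrightarrow>
      look y n (Suc j) (env_val X t) = read X (Suc j) (env_val X t)"
    using look_converges by blast
  from N M show ?case by (intro exI[of _ "max N M"]) simp
qed auto

lemma limit_computable_atomic:
  assumes "\<And>p. prp p 2 (\<lambda>Xs v. R (approx_val (v ! 1) (v ! 0) t) (approx_val (v ! 1) (v ! 0) u))"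
  shows "limit_computable 0 (\<lambda>X. R (env_val X t) (env_val X u))"
proof (rule limit_computable_0[where P = "\<lambda>n y. R (approx_val y n t) (approx_val y n u)" and h = "\<lambda>n. n", OF assms])
  show "pr p 1 (\<lambda>Xs v. v ! 0)" for p by (rule pr_nth) simp
  fix X
  obtain N M where "\<forall>n\<ge>N. \<forall>y. matches n X y \<longrightarrow> approx_val y n t = env_val X t"
    "\<forall>n\<ge>M. \<forall>y. matches n X y \<longrightarrow> approx_val y n u = env_val X u"
    using approx_val_converges by blast
  then show "\<exists>N. \<forall>n\<ge>N. \<forall>y. matches n X y \<longrightarrow>
      R (approx_val y n t) (approx_val y n u) = R (env_val X t) (env_val X u)"
    by (intro exI[of _ "max N M"]) simp
qed

lemma limit_computable_soa: "\<exists>k. limit_computable k (\<lambda>X. env_sat X \<phi>)"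
proof (induction \<phi>)
  case (Equal t u)
  have "limit_computable 0 (\<lambda>X. env_val X t = env_val X u)"
    by (rule limit_computable_atomic[where R = "(=)"]) (intro pr_intros; simp)
  then show ?case by auto
next
  case (Less t u)
  have "limit_computable 0 (\<lambda>X. env_val X t < env_val X u)"
    by (rule limit_computable_atomic[where R = "(<)"]) (intro pr_intros; simp)
  then show ?case by auto
next
  case (Neg \<phi>)
  then show ?case using limit_computable_not by auto
next
  case (Conj \<phi> \<theta>)
  then obtain k l where "limit_computable k (\<lambda>X. env_sat X \<phi>)" "limit_computable l (\<lambda>X. env_sat X \<theta>)" by blast
  then have "limit_computable (max k l) (\<lambda>X. env_sat X \<phi>)" "limit_computable (max k l) (\<lambda>X. env_sat X \<theta>)"
    by (auto elim: limit_computable_mono)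
  from limit_computable_conj[OF this] show ?case by auto
next
  case (ExNum i \<phi>)
  then obtain k where k: "limit_computable k (\<lambda>X. env_sat X \<phi>)" by blast
  \<comment> \<open>The bits of number variable \<open>i\<close>. Every table reads as some number
    there, so a quantifier over these bits is a quantifier over the number. The bound on
    \<open>j\<close> makes \<open>D\<close> visibly primitive recursive.\<close>
  define D where "D = {m. \<exists>j<Suc m. m = bit_index 0 i j}"
  have D: "bit_index c i' j \<in> D \<longleftrightarrow> c = 0 \<and> i' = i" for c i' j
    using bit_index_ge(2)[of j 0 i] by (auto simp: D_def le_imp_less_Suc)
  have prD: "prp p 1 (\<lambda>Xs v. v ! 0 \<in> D)" for p
    unfolding D_def mem_Collect_eq by (intro pr_intros) simp_all
  have "env_sat X (ExNum i \<phi>) = (\<exists>Y. agree_off D X Y \<and> env_sat Y \<phi>)" for X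
  proof
    assume "env_sat X (ExNum i \<phi>)"
    then obtain a where a: "soa_sat ((read X 0)(i := a)) (\<lambda>j. read X (Suc j)) \<phi>" by auto
    define Y where "Y m = (if m \<in> D then m = bit_index 0 i a else X m)" for m
    have "read Y 0 = (read X 0)(i := a)"
    proof
      fix l
      show "read Y 0 l = ((read X 0)(i := a)) l"
        by (cases "l = i") (auto simp: Y_def D intro: read_single read_cong)
    qed
    moreover have "read Y (Suc j) = read X (Suc j)" for j
      by (rule ext, rule read_cong) (simp add: Y_def D)
    ultimately show "\<exists>Y. agree_off D X Y \<and> env_sat Y \<phi>"
      using a by (intro exI[of _ Y]) (simp add: Y_def)
  next
    assume "\<exists>Y. agree_off D X Y \<and> env_sat Y \<phi>"
    then obtain Y where Y: "\<And>m. m \<notin> D \<Longrightarrow> Y m = X m" "env_sat Y \<phi>" by blast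
    have "read Y 0 = (read X 0)(i := read Y 0 i)"
    proof
      fix l
      show "read Y 0 l = ((read X 0)(i := read Y 0 i)) l"
        by (cases "l = i") (auto simp: Y(1) D intro: read_cong)
    qed
    moreover have "(\<lambda>j. read Y (Suc j)) = (\<lambda>j. read X (Suc j))"
      by (intro ext read_cong) (simp add: Y(1) D)
    ultimately show "env_sat X (ExNum i \<phi>)" using Y(2) by (metis soa_sat.simps(5))
  qed
  with limit_computable_ex[OF k prD] show ?case by auto
next
  case (ExFun c \<phi>)
  then obtain k where k: "limit_computable k (\<lambda>X. env_sat X \<phi>)" by blast
  define D where "D = {m. \<exists>i<Suc m. \<exists>j<Suc m. m = bit_index (Suc c) i j}"
  have D: "bit_index c' i j \<in> D \<longleftrightarrow> c' = Suc c" for c' i j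
    using bit_index_ge(1)[of i "Suc c" j] bit_index_ge(2)[of j "Suc c" i] by (auto simp: D_def le_imp_less_Suc)
  have prD: "prp p 1 (\<lambda>Xs v. v ! 0 \<in> D)" for p
    unfolding D_def mem_Collect_eq by (intro pr_intros) simp_all
  have "env_sat X (ExFun c \<phi>) = (\<exists>Y. agree_off D X Y \<and> env_sat Y \<phi>)" for X
  proof
    assume "env_sat X (ExFun c \<phi>)"
    then obtain x where a: "soa_sat (read X 0) ((\<lambda>j. read X (Suc j))(c := x)) \<phi>" by auto
    define Y where "Y m = (if m \<in> D then \<exists>i. m = bit_index (Suc c) i (x i) else X m)" for m
    have "(\<lambda>j. read Y (Suc j)) = (\<lambda>j. read X (Suc j))(c := x)"
    proof (intro ext)
      fix j l
      show "read Y (Suc j) l = ((\<lambda>j. read X (Suc j))(c := x)) j l"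
        by (cases "j = c") (auto simp: Y_def D intro: read_single read_cong)
    qed
    moreover have "read Y 0 = read X 0"
      by (rule ext, rule read_cong) (simp add: Y_def D)
    ultimately show "\<exists>Y. agree_off D X Y \<and> env_sat Y \<phi>"
      using a by (intro exI[of _ Y]) (simp add: Y_def)
  next
    assume "\<exists>Y. agree_off D X Y \<and> env_sat Y \<phi>"
    then obtain Y where Y: "\<And>m. m \<notin> D \<Longrightarrow> Y m = X m" "env_sat Y \<phi>" by blast
    have "(\<lambda>j. read Y (Suc j)) = (\<lambda>j. read X (Suc j))(c := read Y (Suc c))"
    proof (intro ext)
      fix j l
      show "read Y (Suc j) l = ((\<lambda>j. read X (Suc j))(c := read Y (Suc c))) j l"
        by (cases "j = c") (auto simp: Y(1) D intro: read_cong)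
    qed
    moreover have "read Y 0 = read X 0"
      by (rule ext, rule read_cong) (simp add: Y(1) D)
    ultimately show "env_sat X (ExFun c \<phi>)" using Y(2) by (metis soa_sat.simps(6))
  qed
  with limit_computable_ex[OF k prD] show ?case by auto
qed

section \<open>Definability in second order arithmetic\<close>

text \<open>Variables are de Bruijn levels: a quantifier binds a new last variable, so that terms need no
  renaming under it and are applied to \<^const>\<open>butlast\<close> of the environment.\<close>

definition dfn :: "nat \<Rightarrow> nat \<Rightarrow> (nat list \<Rightarrow> (nat \<Rightarrow> nat) list \<Rightarrow> bool) \<Rightarrow> bool" where
  "dfn n m Q \<longleftrightarrow> (\<exists>\<phi>. \<forall>e E. soa_sat e E \<phi> \<longleftrightarrow> Q (map e [0..<n]) (map E [0..<m]))"

definition dft :: "nat \<Rightarrow> nat \<Rightarrow> (nat list \<Rightarrow> (nat \<Rightarrow> nat) list \<Rightarrow> nat) \<Rightarrow> bool" where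
  "dft n m f \<longleftrightarrow> (\<exists>t. \<forall>e E. soa_val e E t = f (map e [0..<n]) (map E [0..<m]))"

named_theorems df_intros

lemma dfn_cong:
  assumes "dfn n m Q" "\<And>v F. length v = n \<Longrightarrow> length F = m \<Longrightarrow> Q' v F = Q v F"
  shows "dfn n m Q'"
  using assms unfolding dfn_def by simp

lemma dft_cong:
  assumes "dft n m f" "\<And>v F. length v = n \<Longrightarrow> length F = m \<Longrightarrow> f' v F = f v F"
  shows "dft n m f'"
  using assms unfolding dft_def by simp

lemma dft_nth [df_intros]: "i < n \<Longrightarrow> dft n m (\<lambda>v F. v ! i)"
  unfolding dft_def by (intro exI[of _ "Var i"]) simp

lemma dft_app [df_intros]: "j < m \<Longrightarrow> dft n m f \<Longrightarrow> dft n m (\<lambda>v F. (F ! j) (f v F))"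
  unfolding dft_def
proof (elim exE)
  fix t assume "j < m" "\<forall>e E. soa_val e E t = f (map e [0..<n]) (map E [0..<m])"
  then show "\<exists>t. \<forall>e E. soa_val e E t = (map E [0..<m] ! j) (f (map e [0..<n]) (map E [0..<m]))"
    by (intro exI[of _ "App j t"]) simp
qed

lemma dft_0 [df_intros]: "dft n m (\<lambda>v F. 0)"
  unfolding dft_def by (intro exI[of _ Zero]) simp

lemma dft_Suc [df_intros]: "dft n m f \<Longrightarrow> dft n m (\<lambda>v F. Suc (f v F))"
  unfolding dft_def by (metis soa_val.simps(3))

lemma dft_const [df_intros]: "dft n m (\<lambda>v F. c)"
  by (induction c) (intro df_intros)+

lemma dft_plus [df_intros]: "dft n m f \<Longrightarrow> dft n m g \<Longrightarrow> dft n m (\<lambda>v F. f v F + g v F)"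
  unfolding dft_def by (metis soa_val.simps(4))

lemma dft_weak1: "dft n m f \<Longrightarrow> dft (Suc n) m (\<lambda>v F. f (butlast v) F)"
  unfolding dft_def by (simp add: butlast_append)

lemma dft_weak2: "dft n m f \<Longrightarrow> dft n (Suc m) (\<lambda>v F. f v (butlast F))"
  unfolding dft_def by (simp add: butlast_append)

lemma dft_weak12: "dft n m f \<Longrightarrow> dft (Suc n) (Suc m) (\<lambda>v F. f (butlast v) (butlast F))"
  by (rule dft_weak2[OF dft_weak1])

text \<open>An outer variable is seen through one \<open>butlast\<close> for each intervening
  quantifier of its kind.\<close>

lemma dft_nth_butlast [df_intros]:
  "Suc i < n \<Longrightarrow> dft n m (\<lambda>v F. butlast v ! i)"
  "Suc (Suc i) < n \<Longrightarrow> dft n m (\<lambda>v F. butlast (butlast v) ! i)"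
  "Suc (Suc (Suc i)) < n \<Longrightarrow> dft n m (\<lambda>v F. butlast (butlast (butlast v)) ! i)"
  by (rule dft_cong, rule dft_nth[of i], simp_all add: nth_butlast)+

lemma dft_app_butlast [df_intros]:
  "Suc j < m \<Longrightarrow> dft n m f \<Longrightarrow> dft n m (\<lambda>v F. (butlast F ! j) (f v F))"
  "Suc (Suc j) < m \<Longrightarrow> dft n m f \<Longrightarrow> dft n m (\<lambda>v F. (butlast (butlast F) ! j) (f v F))"
  "Suc (Suc (Suc j)) < m \<Longrightarrow> dft n m f \<Longrightarrow> dft n m (\<lambda>v F. (butlast (butlast (butlast F)) ! j) (f v F))"
  "Suc (Suc (Suc (Suc j))) < m \<Longrightarrow> dft n m f \<Longrightarrow> dft n m (\<lambda>v F. (butlast (butlast (butlast (butlast F))) ! j) (f v F))"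
  by (rule dft_cong, rule dft_app[of j], simp_all add: nth_butlast)+

lemma dfn_eq [df_intros]: "dft n m f \<Longrightarrow> dft n m g \<Longrightarrow> dfn n m (\<lambda>v F. f v F = g v F)"
  unfolding dft_def dfn_def by (metis soa_sat.simps(1))

lemma dfn_less [df_intros]: "dft n m f \<Longrightarrow> dft n m g \<Longrightarrow> dfn n m (\<lambda>v F. f v F < g v F)"
  unfolding dft_def dfn_def by (metis soa_sat.simps(2))

lemma dfn_not [df_intros]: "dfn n m Q \<Longrightarrow> dfn n m (\<lambda>v F. \<not> Q v F)"
  unfolding dfn_def by (metis soa_sat.simps(3))

lemma dfn_conj [df_intros]: "dfn n m Q \<Longrightarrow> dfn n m R \<Longrightarrow> dfn n m (\<lambda>v F. Q v F \<and> R v F)"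
  unfolding dfn_def by (metis soa_sat.simps(4))

lemma dfn_disj [df_intros]: "dfn n m Q \<Longrightarrow> dfn n m R \<Longrightarrow> dfn n m (\<lambda>v F. Q v F \<or> R v F)"
proof -
  assume "dfn n m Q" "dfn n m R"
  then have "dfn n m (\<lambda>v F. \<not> (\<not> Q v F \<and> \<not> R v F))" by (intro dfn_not dfn_conj)
  then show ?thesis by (rule dfn_cong) blast
qed

lemma dfn_imp [df_intros]: "dfn n m Q \<Longrightarrow> dfn n m R \<Longrightarrow> dfn n m (\<lambda>v F. Q v F \<longrightarrow> R v F)"
proof -
  assume "dfn n m Q" "dfn n m R"
  then have "dfn n m (\<lambda>v F. \<not> Q v F \<or> R v F)" by (intro dfn_not dfn_disj)
  then show ?thesis by (rule dfn_cong) blast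
qed

lemma dfn_iff [df_intros]: "dfn n m Q \<Longrightarrow> dfn n m R \<Longrightarrow> dfn n m (\<lambda>v F. Q v F = R v F)"
proof -
  assume "dfn n m Q" "dfn n m R"
  then have "dfn n m (\<lambda>v F. (Q v F \<longrightarrow> R v F) \<and> (R v F \<longrightarrow> Q v F))" by (intro dfn_imp dfn_conj)
  then show ?thesis by (rule dfn_cong) blast
qed

lemma dfn_le [df_intros]: "dft n m f \<Longrightarrow> dft n m g \<Longrightarrow> dfn n m (\<lambda>v F. f v F \<le> g v F)"
proof -
  assume "dft n m f" "dft n m g"
  then have "dfn n m (\<lambda>v F. \<not> g v F < f v F)" by (intro dfn_not dfn_less)
  then show ?thesis by (rule dfn_cong) auto
qed

lemma dfn_True [df_intros]: "dfn n m (\<lambda>v F. True)"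
proof -
  have "dfn n m (\<lambda>v F. 0 = (0 :: nat))" by (intro df_intros)
  then show ?thesis by simp
qed

lemma dfn_ex [df_intros]:
  assumes "dfn (Suc n) m (\<lambda>v F. Q (butlast v) F (v ! n))"
  shows "dfn n m (\<lambda>v F. \<exists>a. Q v F a)"
proof -
  from assms obtain \<phi> where \<phi>: "\<And>e E. soa_sat e E \<phi> \<longleftrightarrow>
      Q (butlast (map e [0..<Suc n])) (map E [0..<m]) (map e [0..<Suc n] ! n)"
    unfolding dfn_def by blast
  have "map (e(n := a)) [0..<Suc n] = map e [0..<n] @ [a]" for e :: "nat \<Rightarrow> nat" and a
    by simp
  then show ?thesis unfolding dfn_def
    by (intro exI[of _ "ExNum n \<phi>"]) (simp add: \<phi> nth_append del: upt_Suc)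
qed

lemma dfn_exf [df_intros]:
  assumes "dfn n (Suc m) (\<lambda>v F. Q v (butlast F) (F ! m))"
  shows "dfn n m (\<lambda>v F. \<exists>a :: nat \<Rightarrow> nat. Q v F a)"
proof -
  from assms obtain \<phi> where \<phi>: "\<And>e E. soa_sat e E \<phi> \<longleftrightarrow>
      Q (map e [0..<n]) (butlast (map E [0..<Suc m])) (map E [0..<Suc m] ! m)"
    unfolding dfn_def by blast
  have "map (E(m := a)) [0..<Suc m] = map E [0..<m] @ [a]" for E :: "nat \<Rightarrow> nat \<Rightarrow> nat" and a
    by simp
  then show ?thesis unfolding dfn_def
    by (intro exI[of _ "ExFun m \<phi>"]) (simp add: \<phi> nth_append del: upt_Suc)
qed

lemma dfn_all [df_intros]:
  assumes "dfn (Suc n) m (\<lambda>v F. Q (butlast v) F (v ! n))"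
  shows "dfn n m (\<lambda>v F. \<forall>a. Q v F a)"
proof -
  have "dfn n m (\<lambda>v F. \<not> (\<exists>a. \<not> Q v F a))" by (intro dfn_not dfn_ex assms)
  then show ?thesis by simp
qed

lemma dfn_allf [df_intros]:
  assumes "dfn n (Suc m) (\<lambda>v F. Q v (butlast F) (F ! m))"
  shows "dfn n m (\<lambda>v F. \<forall>a :: nat \<Rightarrow> nat. Q v F a)"
proof -
  have "dfn n m (\<lambda>v F. \<not> (\<exists>a. \<not> Q v F a))" by (intro dfn_not dfn_exf assms)
  then show ?thesis by simp
qed

text \<open>\<open>r\<close> is fixed outside the formula, so this is a finite conjunction and not a
  bounded quantifier.\<close>

lemma dfn_ball_less:
  fixes r :: nat
  assumes "\<And>l. l < r \<Longrightarrow> dfn n m (Q l)"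
  shows "dfn n m (\<lambda>v F. \<forall>l<r. Q l v F)"
  using assms
proof (induction r)
  case 0
  show ?case using dfn_True by simp
next
  case (Suc r)
  then have "dfn n m (\<lambda>v F. (\<forall>l<r. Q l v F) \<and> Q r v F)" by (intro dfn_conj) auto
  then show ?case by (rule dfn_cong) (auto simp: less_Suc_eq)
qed

abbreviation bits :: "(nat \<Rightarrow> nat) \<Rightarrow> pred" where
  "bits x \<equiv> \<lambda>i. x i \<noteq> 0"

text \<open>Inside a formula an oracle has to be a function variable; \<open>js\<close> lists the
  indices that serve as oracles.\<close>

definition oracles :: "nat list \<Rightarrow> (nat \<Rightarrow> nat) list \<Rightarrow> pred list" where
  "oracles js F = map (\<lambda>j. bits (F ! j)) js"

lemma oracles_simps [simp]:
  "oracles [] F = []"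
  "oracles (j # js) F = (\<lambda>x. (F ! j) x \<noteq> 0) # oracles js F"
  "length (oracles js F) = length js"
  "i < length js \<Longrightarrow> oracles js F ! i = (\<lambda>x. (F ! (js ! i)) x \<noteq> 0)"
  by (simp_all add: oracles_def)

lemma oracles_butlast:
  assumes "\<forall>j\<in>set js. j < m" "length F = Suc m"
  shows "oracles js (butlast F) = oracles js F"
  using assms by (auto simp: oracles_def nth_butlast)

text \<open>Function quantifiers replace the coding of finite sequences: the intermediate results of
  a composition are the first values of a function \<open>w\<close>, and the course of a recursion
  is a function \<open>h\<close>. Argument terms \<open>ts\<close> and value term \<open>u\<close>
  are arbitrary because the induction feeds values of \<open>w\<close> and \<open>h\<close> back
  in.\<close>

lemma dfn_prim_rec:
  assumes "prim_rec p k G" and "length js = p"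
  shows "\<lbrakk>length ts = k; \<forall>t\<in>set ts. dft n m t; \<forall>j\<in>set js. j < m; dft n m u\<rbrakk> \<Longrightarrow>
    dfn n m (\<lambda>v F. G (oracles js F) (map (\<lambda>t. t v F) ts) = u v F)"
  using assms(1)
proof (induction arbitrary: ts n m u)
  case (zero k)
  then show ?case by (intro df_intros)
next
  case succ
  then obtain t where t: "ts = [t]" by (auto simp: length_Suc_conv)
  then have "dfn n m (\<lambda>v F. Suc (t v F) = u v F)" using succ by (intro df_intros) auto
  then show ?case by (simp add: t)
next
  case (proj i k)
  then have "dfn n m (\<lambda>v F. (ts ! i) v F = u v F)" by (intro df_intros) auto
  then show ?case using proj by simp
next
  case (query i)
  then obtain t where t: "ts = [t]" by (auto simp: length_Suc_conv)
  have j: "js ! i < m" using query assms(2) by simp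
  have "dfn n m (\<lambda>v F. ((F ! (js ! i)) (t v F) = 0 \<and> u v F = 0) \<or> (\<not> (F ! (js ! i)) (t v F) = 0 \<and> u v F = Suc 0))"
    using query t j by (intro df_intros) auto
  then show ?case by (rule dfn_cong) (use query(1) assms(2) in \<open>auto simp: t\<close>)
next
  case (comp gs f k)
  let ?r = "length gs"
  have 1: "dfn n (Suc m) (\<lambda>v F. (gs ! l) (oracles js F) (map (\<lambda>t. t v F) (map (\<lambda>t v F. t v (butlast F)) ts)) = (F ! m) l)"
    if l: "l < ?r" for l
  proof -
    have "gs ! l \<in> set gs" using l by simp
    with comp.IH(2) have IH: "\<And>ts n m u. \<lbrakk>length ts = k; \<forall>t\<in>set ts. dft n m t; \<forall>j\<in>set js. j < m; dft n m u\<rbrakk> \<Longrightarrow>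
       dfn n m (\<lambda>v F. (gs ! l) (oracles js F) (map (\<lambda>t. t v F) ts) = u v F)" by blast
    show ?thesis by (rule IH) (use comp.prems in \<open>auto intro!: dft_weak2 df_intros\<close>)
  qed
  have 2: "dfn n (Suc m) (\<lambda>v F. f (oracles js F) (map (\<lambda>t. t v F) (map (\<lambda>l v F. (F ! m) l) [0..<?r])) = u v (butlast F))"
    by (rule comp.IH(1)) (use comp.prems in \<open>auto intro!: dft_weak2 df_intros\<close>)
  have "dfn n m (\<lambda>v F. \<exists>w. (\<forall>l<?r. (gs ! l) (oracles js F) (map (\<lambda>t. t v F) ts) = w l) \<and>
      f (oracles js F) (map w [0..<?r]) = u v F)"
  proof (rule dfn_exf)
    show "dfn n (Suc m) (\<lambda>v F. (\<forall>l<?r. (gs ! l) (oracles js (butlast F)) (map (\<lambda>t. t v (butlast F)) ts) = (F ! m) l) \<and>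
      f (oracles js (butlast F)) (map (F ! m) [0..<?r]) = u v (butlast F))"
      using dfn_conj[OF dfn_ball_less[OF 1] 2]
      by (rule dfn_cong) (simp_all add: oracles_butlast[OF comp.prems(3)] comp_def)
  qed
  then show ?case
  proof (rule dfn_cong)
    fix v F
    let ?w = "\<lambda>l. (gs ! l) (oracles js F) (map (\<lambda>t. t v F) ts)"
    have "map (\<lambda>g. g (oracles js F) (map (\<lambda>t. t v F) ts)) gs = map w [0..<?r]" if "\<forall>l<?r. ?w l = w l" for w
      using that by (intro nth_equalityI) auto
    from this[of ?w] this show "(f (oracles js F) (map (\<lambda>g. g (oracles js F) (map (\<lambda>t. t v F) ts)) gs) = u v F) =
      (\<exists>w. (\<forall>l<?r. ?w l = w l) \<and> f (oracles js F) (map w [0..<?r]) = u v F)" by metis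
  qed
next
  case (prec k f g)
  then obtain t0 ts0 where ts: "ts = t0 # ts0" "length ts0 = k" by (auto simp: length_Suc_conv)
  note t0 = prec.prems(2)[unfolded ts(1)]
  have 1: "dfn n (Suc m) (\<lambda>v F. f (oracles js F) (map (\<lambda>t. t v F) (map (\<lambda>t v F. t v (butlast F)) ts0)) = (F ! m) 0)"
    by (rule prec.IH(1)) (use prec.prems ts t0 in \<open>auto intro!: dft_weak2 df_intros\<close>)
  have 2: "dfn (Suc n) (Suc m) (\<lambda>v F. g (oracles js F) (map (\<lambda>t. t v F)
      ((\<lambda>v F. v ! n) # (\<lambda>v F. (F ! m) (v ! n)) # map (\<lambda>t v F. t (butlast v) (butlast F)) ts0)) = (F ! m) (Suc (v ! n)))"
    by (rule prec.IH(2)) (use prec.prems ts t0 in \<open>auto intro!: dft_weak12 df_intros\<close>)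
  have 3: "dfn n (Suc m) (\<lambda>v F. (F ! m) (t0 v (butlast F)) = u v (butlast F))"
    using t0 prec.prems by (intro df_intros dft_weak2[of _ _ t0] dft_weak2[of _ _ u]) auto
  have "dfn n m (\<lambda>v F. \<exists>h. f (oracles js F) (map (\<lambda>t. t v F) ts0) = h 0 \<and>
      (\<forall>i. g (oracles js F) (i # h i # map (\<lambda>t. t v F) ts0) = h (Suc i)) \<and> h (t0 v F) = u v F)"
  proof (rule dfn_exf)
    have "dfn n (Suc m) (\<lambda>v F. \<forall>i. g (oracles js (butlast F)) (i # (F ! m) i # map (\<lambda>t. t v (butlast F)) ts0) = (F ! m) (Suc i))"
      by (rule dfn_all, rule dfn_cong[OF 2]) (simp add: oracles_butlast[OF prec.prems(3)] comp_def)
    from dfn_conj[OF 1 dfn_conj[OF this 3]]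
    show "dfn n (Suc m) (\<lambda>v F. f (oracles js (butlast F)) (map (\<lambda>t. t v (butlast F)) ts0) = (F ! m) 0 \<and>
      (\<forall>i. g (oracles js (butlast F)) (i # (F ! m) i # map (\<lambda>t. t v (butlast F)) ts0) = (F ! m) (Suc i)) \<and>
      (F ! m) (t0 v (butlast F)) = u v (butlast F))"
      by (rule dfn_cong) (simp add: oracles_butlast[OF prec.prems(3)] comp_def)
  qed
  then show ?case
  proof (rule dfn_cong)
    fix v F
    let ?X = "oracles js F" and ?v = "map (\<lambda>t. t v F) ts0"
    let ?h = "rec_nat (f ?X ?v) (\<lambda>i r. g ?X (i # r # ?v))"
    \<comment> \<open>The recursion equations determine \<open>h\<close>, so quantifying over it
      leaves no freedom.\<close>
    have "h = ?h" if "f ?X ?v = h 0" "\<forall>i. g ?X (i # h i # ?v) = h (Suc i)" for h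
    proof
      show "h i = ?h i" for i
      proof (induction i)
        case 0
        show ?case using that(1) by simp
      next
        case (Suc i)
        have "?h (Suc i) = g ?X (i # ?h i # ?v)" by simp
        then show ?case unfolding Suc[symmetric] using that(2) by simp
      qed
    qed
    note uniq = this
    have "(\<exists>h. f ?X ?v = h 0 \<and> (\<forall>i. g ?X (i # h i # ?v) = h (Suc i)) \<and> h (t0 v F) = u v F) \<longleftrightarrow> ?h (t0 v F) = u v F"
      (is "(\<exists>h. ?A h) \<longleftrightarrow> _")
    proof
      assume "\<exists>h. ?A h"
      then obtain h where h: "?A h" by (rule exE)
      then have "h = ?h" by (intro uniq) simp_all
      then have "h (t0 v F) = ?h (t0 v F)" by (rule arg_cong)
      then show "?h (t0 v F) = u v F" using h by simp
    next
      assume "?h (t0 v F) = u v F"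
      then show "\<exists>h. ?A h" by (intro exI[of _ ?h]) simp
    qed
    then show "(rec_nat (f ?X (tl (map (\<lambda>t. t v F) ts))) (\<lambda>i r. g ?X (i # r # tl (map (\<lambda>t. t v F) ts))) (hd (map (\<lambda>t. t v F) ts)) = u v F) =
       (\<exists>h. f ?X ?v = h 0 \<and> (\<forall>i. g ?X (i # h i # ?v) = h (Suc i)) \<and> h (t0 v F) = u v F)"
      by (simp add: ts)
  qed
qed

lemma dfn_pr:
  assumes "pr 0 k H" "length ts = k" "\<forall>t\<in>set ts. dft n m t"
  shows "dfn n m (\<lambda>v F. H [] (map (\<lambda>t. t v F) ts) = 1)"
proof -
  from assms(1) obtain G where G: "prim_rec 0 k G"
      "\<And>Xs v. length Xs = 0 \<Longrightarrow> length v = k \<Longrightarrow> H Xs v = G Xs v"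
    unfolding pr_def by blast
  have "dfn n m (\<lambda>v F. G (oracles [] F) (map (\<lambda>t. t v F) ts) = 1)"
    using assms by (intro dfn_prim_rec[OF G(1)] df_intros) auto
  then show ?thesis using assms(2) by (simp add: G(2))
qed

lemma dfn_pr1:
  assumes "prp 0 1 (\<lambda>Xs v. R (v ! 0))" "dft n m f"
  shows "dfn n m (\<lambda>v F. R (f v F))"
  using dfn_pr[OF assms(1), of "[f]"] assms(2) by (simp del: One_nat_def)

lemma dfn_pr2:
  assumes "prp 0 2 (\<lambda>Xs v. R (v ! 0) (v ! 1))" "dft n m f" "dft n m g"
  shows "dfn n m (\<lambda>v F. R (f v F) (g v F))"
  using dfn_pr[OF assms(1), of "[f, g]"] assms(2,3) by (simp add: nth_Cons' del: One_nat_def)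

lemma dfn_odd [df_intros]: "dft n m f \<Longrightarrow> dfn n m (\<lambda>v F. odd (f v F))"
  by (rule dfn_pr1) (intro pr_intros, simp)

lemma dfn_has_code [df_intros]: "dft n m f \<Longrightarrow> dft n m g \<Longrightarrow> dfn n m (\<lambda>v F. has_code (f v F) (g v F))"
  by (rule dfn_pr2) (intro pr_intros; simp)

lemma dfn_prod_encode [df_intros]:
  assumes "dft n m f" "dft n m g" "dft n m h"
  shows "dfn n m (\<lambda>v F. h v F = prod_encode (f v F, g v F))"
proof -
  have "prp 0 3 (\<lambda>Xs v. v ! 2 = prod_encode (v ! 0, v ! 1))" by (intro pr_intros) simp_all
  from dfn_pr[OF this, of "[f, g, h]"] assms show ?thesis by (simp add: nth_Cons' del: One_nat_def)
qed

section \<open>Valid notions in second order arithmetic\<close>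

lemma est_code_surj: "\<exists>s. est_code s = n"
proof (induction n rule: less_induct)
  case (less n)
  show ?case
  proof (cases "even n")
    case True
    then obtain c where "n = 2 * c" by blast
    moreover obtain a b where "c = prod_encode (a, b)" by (metis prod_decode_inverse surj_pair)
    ultimately have "est_code (EPair a b) = n" by (simp add: sum_encode_def)
    then show ?thesis by blast
  next
    case False
    have "\<exists>s. est_code s = m" if "m \<in> set_decode (n div 2)" for m
      using that False has_code_less[of n m] less by (simp add: has_code_def)
    then have "\<forall>m\<in>set_decode (n div 2). \<exists>s. est_code s = m" by blast
    then obtain d where d: "\<And>m. m \<in> set_decode (n div 2) \<Longrightarrow> est_code (d m) = m" by metis
    have "est_code ` d ` set_decode (n div 2) = set_decode (n div 2)"
      using d by (force simp: image_image)
    then have "est_code (ESet (Abs_fset (d ` set_decode (n div 2)))) = n"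
      using False by (simp add: sum_encode_def Abs_fset_inverse finite_set_decode)
    then show ?thesis by blast
  qed
qed

text \<open>\<open>valid_notion\<close> rewritten on codes, with \<open>r\<close> as characteristic
  function, so that quantifiers over notions become function quantifiers. \<open>z + z\<close> is
  the code of a pair. The union gets a name \<open>u\<close> because validity is expressed for
  function variables only.\<close>

primrec vcode :: "nat \<Rightarrow> (nat \<Rightarrow> nat) \<Rightarrow> bool" where
  "vcode 0 r \<longleftrightarrow> (\<forall>x. r x \<noteq> 0 \<longrightarrow> \<not> odd x) \<and>
     (\<exists>c. \<exists>f :: nat \<Rightarrow> nat. \<forall>a b z. z = prod_encode (a, b) \<longrightarrow> (r (z + z) \<noteq> 0 \<longleftrightarrow> c \<le> a \<and> f a \<le> b))"
| "vcode (Suc m) r \<longleftrightarrow> (\<forall>x. r x \<noteq> 0 \<longrightarrow> odd x) \<and>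
     (\<exists>u :: nat \<Rightarrow> nat. (\<forall>y. u y \<noteq> 0 \<longleftrightarrow> (\<exists>x. r x \<noteq> 0 \<and> has_code x y)) \<and> vcode m u \<and>
        (\<forall>x y z. r x \<noteq> 0 \<longrightarrow> u y \<noteq> 0 \<longrightarrow> odd z \<longrightarrow> (\<forall>w. has_code z w \<longleftrightarrow> w = y \<or> has_code x w) \<longrightarrow> r z \<noteq> 0)) \<and>
     (\<forall>s :: nat \<Rightarrow> nat. vcode m s \<longrightarrow> (\<exists>x. r x \<noteq> 0 \<and> (\<forall>y. has_code x y \<longrightarrow> s y \<noteq> 0)))"

lemma dfn_vcode: "j < m \<Longrightarrow> dfn n m (\<lambda>v F. vcode k (F ! j))"
proof (induction k arbitrary: n m j)
  case 0
  show ?case unfolding vcode.simps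
    by (intro dfn_conj dfn_all dfn_ex dfn_exf dfn_imp dfn_iff dfn_not dfn_odd dfn_prod_encode dfn_le
        dfn_eq[OF _ dft_0] dft_app dft_app_butlast dft_plus dft_nth dft_nth_butlast) (use 0 in simp_all)
next
  case (Suc k)
  show ?case unfolding vcode.simps
    by (intro dfn_conj dfn_all dfn_ex dfn_exf dfn_allf dfn_imp dfn_iff dfn_disj dfn_not dfn_odd dfn_has_code Suc.IH
        dfn_eq dft_0 dft_app dft_app_butlast dft_nth dft_nth_butlast) (use Suc.prems in simp_all)
qed

definition coded :: "(nat \<Rightarrow> nat) \<Rightarrow> est set" where
  "coded r = {s. r (est_code s) \<noteq> 0}"

lemma coded_surj: "\<exists>r. coded r = R"
proof
  show "coded (\<lambda>x. of_bool (\<exists>s\<in>R. est_code s = x)) = R"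
    by (auto simp: coded_def est_code_eq_iff)
qed

lemma all_est_code: "(\<forall>x. Q x) \<longleftrightarrow> (\<forall>s. Q (est_code s))"
  using est_code_surj by metis

lemma ex_est_code: "(\<exists>x. Q x) \<longleftrightarrow> (\<exists>s. Q (est_code s))"
  using est_code_surj by metis

lemma has_code_est_code': "has_code (est_code s) (est_code s') \<longleftrightarrow> s' \<in> elems s"
  by (auto simp: has_code_est_code est_code_eq_iff)

lemma odd_est_code: "odd (est_code s) \<longleftrightarrow> (\<exists>F. s = ESet F)"
  by (cases s) (auto simp: sum_encode_def)

lemma not_odd_est_code: "\<not> odd (est_code s) \<longleftrightarrow> (\<exists>a b. s = EPair a b)"
  by (cases s) (auto simp: sum_encode_def)

lemma has_code_subset: "(\<forall>y. has_code (est_code x) y \<longrightarrow> r y \<noteq> 0) \<longleftrightarrow> elems x \<subseteq> coded r"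
  by (auto simp: has_code_est_code coded_def)

text \<open>A set is determined by its members, and every number codes an estimator, so describing
  the members of \<open>z\<close> pins it down as the code of the enlarged set.\<close>

lemma vcode_insert_iff:
  assumes ESets: "\<forall>s\<in>coded r. \<exists>F. s = ESet F"
  shows "(\<forall>x y z. r x \<noteq> 0 \<longrightarrow> u y \<noteq> 0 \<longrightarrow> odd z \<longrightarrow> (\<forall>w. has_code z w \<longleftrightarrow> w = y \<or> has_code x w) \<longrightarrow> r z \<noteq> 0) \<longleftrightarrow>
      (\<forall>F y. ESet F \<in> coded r \<longrightarrow> y \<in> coded u \<longrightarrow> ESet (finsert y F) \<in> coded r)" (is "?L \<longleftrightarrow> ?R")
proof
  assume L: ?L
  show ?R
  proof (intro allI impI)
    fix F y assume a: "ESet F \<in> coded r" "y \<in> coded u"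
    have "odd (est_code (ESet (finsert y F)))" unfolding odd_est_code by blast
    moreover have "\<forall>w. has_code (est_code (ESet (finsert y F))) w \<longleftrightarrow> w = est_code y \<or> has_code (est_code (ESet F)) w"
      unfolding has_code_est_code by auto
    ultimately show "ESet (finsert y F) \<in> coded r"
      using L a unfolding coded_def mem_Collect_eq by blast
  qed
next
  assume R: ?R
  show ?L
  proof (intro allI impI)
    fix x y z assume a: "r x \<noteq> 0" "u y \<noteq> 0" "odd z" "\<forall>w. has_code z w \<longleftrightarrow> w = y \<or> has_code x w"
    obtain s where s: "x = est_code s" using est_code_surj[of x] by blast
    obtain t where t: "y = est_code t" using est_code_surj[of y] by blast
    obtain q where q: "z = est_code q" using est_code_surj[of z] by blast
    have st: "s \<in> coded r" "t \<in> coded u" using a s t by (auto simp: coded_def)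
    obtain F where F: "s = ESet F" using ESets st(1) by blast
    obtain G where G: "q = ESet G" using a(3) unfolding q odd_est_code by blast
    have "w \<in> elems q \<longleftrightarrow> w = t \<or> w \<in> elems s" for w
      using a(4)[rule_format, of "est_code w"] unfolding s t q has_code_est_code' est_code_eq_iff .
    then have "fset G = fset (finsert t F)" by (auto simp: F G)
    then have "G = finsert t F" by (simp only: fset_inject)
    then have "q \<in> coded r" using R st F G by blast
    then show "r z \<noteq> 0" by (simp add: q coded_def)
  qed
qed

lemma vcode_iff: "vcode k r \<longleftrightarrow> valid_notion k (coded r)"
proof (induction k arbitrary: r)
  case 0
  have "(\<forall>x. r x \<noteq> 0 \<longrightarrow> \<not> odd x) \<longleftrightarrow> (\<forall>s. r (est_code s) \<noteq> 0 \<longrightarrow> \<not> odd (est_code s))"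
    by (rule all_est_code)
  also have "\<dots> \<longleftrightarrow> (\<forall>s\<in>coded r. \<exists>a b. s = EPair a b)"
    unfolding not_odd_est_code coded_def by simp
  finally have 1: "(\<forall>x. r x \<noteq> 0 \<longrightarrow> \<not> odd x) \<longleftrightarrow> (\<forall>s\<in>coded r. \<exists>a b. s = EPair a b)" .
  have 2: "r (prod_encode (a, b) + prod_encode (a, b)) \<noteq> 0 \<longleftrightarrow> EPair a b \<in> coded r" for a b
    by (simp add: coded_def sum_encode_def mult_2)
  have "vcode 0 r \<longleftrightarrow> (\<forall>x. r x \<noteq> 0 \<longrightarrow> \<not> odd x) \<and> (\<exists>c. \<exists>f :: nat \<Rightarrow> nat. \<forall>a b.
      (r (prod_encode (a, b) + prod_encode (a, b)) \<noteq> 0 \<longleftrightarrow> c \<le> a \<and> f a \<le> b))"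
    by simp
  then show ?case unfolding 1 2 valid_notion.simps(1) .
next
  case (Suc k)
  have "(\<forall>x. r x \<noteq> 0 \<longrightarrow> odd x) \<longleftrightarrow> (\<forall>s. r (est_code s) \<noteq> 0 \<longrightarrow> odd (est_code s))"
    by (rule all_est_code)
  also have "\<dots> \<longleftrightarrow> (\<forall>s\<in>coded r. \<exists>F. s = ESet F)"
    unfolding odd_est_code coded_def by simp
  finally have 1: "(\<forall>x. r x \<noteq> 0 \<longrightarrow> odd x) \<longleftrightarrow> (\<forall>s\<in>coded r. \<exists>F. s = ESet F)" .
  have 2: "(\<forall>y. u y \<noteq> 0 \<longleftrightarrow> (\<exists>x. r x \<noteq> 0 \<and> has_code x y)) \<longleftrightarrow> coded u = \<Union>(elems ` coded r)" for u
  proof -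
    have x: "(\<exists>x. r x \<noteq> 0 \<and> has_code x y) \<longleftrightarrow> (\<exists>s. r (est_code s) \<noteq> 0 \<and> has_code (est_code s) y)" for y
      by (rule ex_est_code)
    have "(\<forall>y. u y \<noteq> 0 \<longleftrightarrow> (\<exists>s. r (est_code s) \<noteq> 0 \<and> has_code (est_code s) y)) \<longleftrightarrow>
      (\<forall>t. u (est_code t) \<noteq> 0 \<longleftrightarrow> (\<exists>s. r (est_code s) \<noteq> 0 \<and> has_code (est_code s) (est_code t)))"
      by (rule all_est_code)
    also have "\<dots> \<longleftrightarrow> coded u = \<Union>(elems ` coded r)"
      unfolding has_code_est_code' coded_def set_eq_iff UN_iff Bex_def mem_Collect_eq ..
    finally show ?thesis unfolding x .
  qed
  have 4: "(\<exists>x. r x \<noteq> 0 \<and> (\<forall>y. has_code x y \<longrightarrow> s y \<noteq> 0)) \<longleftrightarrow> (\<exists>t\<in>coded r. elems t \<subseteq> coded s)" for s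
  proof -
    have "(\<exists>x. r x \<noteq> 0 \<and> (\<forall>y. has_code x y \<longrightarrow> s y \<noteq> 0)) \<longleftrightarrow>
      (\<exists>t. r (est_code t) \<noteq> 0 \<and> (\<forall>y. has_code (est_code t) y \<longrightarrow> s y \<noteq> 0))"
      by (rule ex_est_code)
    also have "\<dots> \<longleftrightarrow> (\<exists>t\<in>coded r. elems t \<subseteq> coded s)"
      unfolding has_code_subset Bex_def by (simp add: coded_def[of r])
    finally show ?thesis .
  qed
  have ex: "(\<exists>u. coded u = V \<and> A (coded u)) \<longleftrightarrow> A V" for V A
  proof
    assume "A V"
    moreover obtain u where "coded u = V" using coded_surj by blast
    ultimately show "\<exists>u. coded u = V \<and> A (coded u)" by blast
  qed blast
  have all: "(\<forall>s. A (coded s)) \<longleftrightarrow> (\<forall>S. A S)" for A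
  proof
    assume A: "\<forall>s. A (coded s)"
    show "\<forall>S. A S"
    proof
      fix S obtain s where "coded s = S" using coded_surj by blast
      then show "A S" using A by blast
    qed
  qed blast
  have 5: "(\<forall>s. valid_notion k (coded s) \<longrightarrow> (\<exists>t\<in>coded r. elems t \<subseteq> coded s)) \<longleftrightarrow>
      (\<forall>S. valid_notion k S \<longrightarrow> (\<exists>t\<in>coded r. elems t \<subseteq> S))"
    by (rule all)
  show ?case
  \<comment> \<open>\<open>vcode_insert_iff\<close> presupposes that all members are sets; otherwise
    both sides fail at their first clause.\<close>
  proof (cases "\<forall>s\<in>coded r. \<exists>F. s = ESet F")
    case False
    then show ?thesis unfolding vcode.simps(2) valid_notion.simps(2) 1 by blast
  next
    case True
    have 6: "(\<exists>u. coded u = \<Union>(elems ` coded r) \<and> (valid_notion k (coded u) \<and>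
        (\<forall>F y. ESet F \<in> coded r \<longrightarrow> y \<in> coded u \<longrightarrow> ESet (finsert y F) \<in> coded r))) \<longleftrightarrow>
      (valid_notion k (\<Union>(elems ` coded r)) \<and>
        (\<forall>F y. ESet F \<in> coded r \<longrightarrow> y \<in> \<Union>(elems ` coded r) \<longrightarrow> ESet (finsert y F) \<in> coded r))"
      by (rule ex)
    show ?thesis unfolding vcode.simps(2) valid_notion.simps(2) 1 2 4 Suc.IH vcode_insert_iff[OF True] 5 6
      by (simp only: conj_assoc)
  qed
qed

lemma for_some_iff_vcode:
  "for_some_estimator k (\<lambda>s. Q (est_code s)) \<longleftrightarrow> (\<forall>r. vcode k r \<longrightarrow> (\<exists>x. r x \<noteq> 0 \<and> Q x))"
proof -
  have "(\<exists>s\<in>coded r. Q (est_code s)) \<longleftrightarrow> (\<exists>x. r x \<noteq> 0 \<and> Q x)" for r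
    using ex_est_code[of "\<lambda>x. r x \<noteq> 0 \<and> Q x"] by (simp add: coded_def)
  moreover have "(\<forall>r. valid_notion k (coded r) \<longrightarrow> (\<exists>s\<in>coded r. Q (est_code s))) \<longleftrightarrow>
      for_some_estimator k (\<lambda>s. Q (est_code s))"
    unfolding for_some_estimator_def
  proof (intro iffI allI impI)
    fix R assume *: "\<forall>r. valid_notion k (coded r) \<longrightarrow> (\<exists>s\<in>coded r. Q (est_code s))" "valid_notion k R"
    obtain r where "coded r = R" using coded_surj by blast
    then show "\<exists>s\<in>R. Q (est_code s)" using * by blast
  qed blast
  ultimately show ?thesis unfolding vcode_iff by simp
qed

lemma dfn_for_some:
  assumes G: "prim_rec p 1 G" "length js = p" "\<forall>j\<in>set js. j < m"
  shows "dfn n m (\<lambda>v F. for_some_estimator k (\<lambda>s. G (oracles js F) [est_code s] = 1))"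
proof -
  have "dfn n m (\<lambda>v F. \<forall>r. vcode k r \<longrightarrow> (\<exists>x. r x \<noteq> 0 \<and> G (oracles js F) [x] = 1))"
  proof -
    have "dfn (Suc n) (Suc m) (\<lambda>v F. G (oracles js F) (map (\<lambda>t. t v F) [\<lambda>v F. v ! n]) = 1)"
      using G by (intro dfn_prim_rec[OF G(1,2)] df_intros) (auto intro!: df_intros)
    then have g: "dfn (Suc n) (Suc m) (\<lambda>v F. G (oracles js (butlast F)) [v ! n] = 1)"
      by (rule dfn_cong) (simp add: oracles_butlast[OF G(3)])
    show ?thesis
      by (intro dfn_allf dfn_imp dfn_ex dfn_conj[OF _ g] dfn_vcode dfn_not dfn_eq[OF dft_app dft_0] dft_nth) simp_all
  qed
  then show ?thesis unfolding for_some_iff_vcode[where Q = "\<lambda>x. G _ [x] = 1"] .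
qed

abbreviation play_oracles :: "pred \<Rightarrow> pred list \<Rightarrow> pred list" where
  "play_oracles p Zs \<equiv> moves_I p # moves_II p # Zs"

text \<open>Oracles must be variables, so the moves of the two players are introduced as new
  functions \<open>x\<close> and \<open>y\<close>, fixed by defining equations.\<close>

lemma dfn_game:
  assumes G: "prim_rec (Suc (Suc p)) 1 G" "length js = p" "\<forall>j\<in>set js. j < m" and m: "0 < m"
  shows "dfn 0 m (\<lambda>v F. for_some_estimator k (\<lambda>s. G (play_oracles (bits (F ! 0)) (oracles js F)) [est_code s] = 1))"
proof -
  have 1: "dfn 0 (Suc (Suc m)) (\<lambda>v F. for_some_estimator k (\<lambda>s. G (oracles (m # Suc m # js) F) [est_code s] = 1))"
    using G by (intro dfn_for_some[OF G(1)]) auto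
  have 2: "dfn 0 m (\<lambda>v F. \<exists>x y :: nat \<Rightarrow> nat. (\<forall>i. x i = (F ! 0) (i + i)) \<and> (\<forall>i. y i = (F ! 0) (Suc (i + i))) \<and>
      for_some_estimator k (\<lambda>s. G ((bits x) # (bits y) # oracles js F) [est_code s] = 1))"
  proof (intro dfn_exf dfn_conj)
    show "dfn 0 (Suc (Suc m)) (\<lambda>v F. \<forall>i. (butlast F ! m) i = (butlast (butlast F) ! 0) (i + i))"
      using m by (intro df_intros) simp_all
    show "dfn 0 (Suc (Suc m)) (\<lambda>v F. \<forall>i. (F ! Suc m) i = (butlast (butlast F) ! 0) (Suc (i + i)))"
      using m by (intro df_intros) simp_all
    show "dfn 0 (Suc (Suc m)) (\<lambda>v F. for_some_estimator k (\<lambda>s. G ((bits (butlast F ! m)) #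
        (bits (F ! Suc m)) # oracles js (butlast (butlast F))) [est_code s] = 1))"
    proof (rule dfn_cong[OF 1])
      fix v :: "nat list" and F :: "(nat \<Rightarrow> nat) list" assume F: "length F = Suc (Suc m)"
      have "oracles js (butlast (butlast F)) = oracles js F"
        using F G(3) by (auto simp: oracles_def nth_butlast)
      moreover have "butlast F ! m = F ! m" using F by (simp add: nth_butlast)
      ultimately show "for_some_estimator k (\<lambda>s. G ((bits (butlast F ! m)) #
        (bits (F ! Suc m)) # oracles js (butlast (butlast F))) [est_code s] = 1) =
        for_some_estimator k (\<lambda>s. G (oracles (m # Suc m # js) F) [est_code s] = 1)" by simp
    qed
  qed
  show ?thesis
  proof (rule dfn_cong[OF 2])
    fix v :: "nat list" and F :: "(nat \<Rightarrow> nat) list"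
    let ?Q = "\<lambda>x y. for_some_estimator k (\<lambda>s. G ((bits x) # (bits y) # oracles js F) [est_code s] = 1)"
    let ?x = "\<lambda>i. (F ! 0) (i + i)" and ?y = "\<lambda>i. (F ! 0) (Suc (i + i))"
    have "(\<exists>x y. (\<forall>i. x i = ?x i) \<and> (\<forall>i. y i = ?y i) \<and> ?Q x y) \<longleftrightarrow> ?Q ?x ?y"
      unfolding fun_eq_iff[symmetric] by simp
    moreover have "moves_I (bits (F ! 0)) = (\<lambda>i. ?x i \<noteq> 0)" "moves_II (bits (F ! 0)) = (\<lambda>i. ?y i \<noteq> 0)"
      by (simp_all add: moves_I_def moves_II_def fun_eq_iff mult_2)
    ultimately show "for_some_estimator k (\<lambda>s. G (play_oracles (bits (F ! 0)) (oracles js F)) [est_code s] = 1) =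
      (\<exists>x y. (\<forall>i. x i = ?x i) \<and> (\<forall>i. y i = ?y i) \<and> ?Q x y)" by simp
  qed
qed

section \<open>Reducing games on numbers to games on bits\<close>

text \<open>In a state \<open>(l, c)\<close>, \<open>l\<close> numbers are complete and
  \<open>c\<close> is the count so far of number \<open>l\<close>, owned by I iff \<open>l\<close>
  is even. The bit at time \<open>t\<close> counts only if its player owns that number, that is if
  \<open>t + l\<close> is even: true adds one, false completes the number. The bits of the other
  player are ignored meanwhile.\<close>

primrec unary_state :: "(nat \<Rightarrow> bool) \<Rightarrow> nat \<Rightarrow> nat \<times> nat" where
  "unary_state p 0 = (0, 0)"
| "unary_state p (Suc t) = (case unary_state p t of (l, c) \<Rightarrow>
     if even (t + l) then if p t then (l, Suc c) else (Suc l, 0) else (l, c))"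

definition completed :: "(nat \<Rightarrow> bool) \<Rightarrow> nat \<Rightarrow> nat" where
  "completed p t = fst (unary_state p t)"

definition counter :: "(nat \<Rightarrow> bool) \<Rightarrow> nat \<Rightarrow> nat" where
  "counter p t = snd (unary_state p t)"

lemma completed_0 [simp]: "completed p 0 = 0" and counter_0 [simp]: "counter p 0 = 0"
  by (simp_all add: completed_def counter_def)

lemma completed_Suc: "completed p (Suc t) =
    (if even (t + completed p t) \<and> \<not> p t then Suc (completed p t) else completed p t)"
  by (simp add: completed_def split: prod.split)

lemma counter_Suc: "counter p (Suc t) =
    (if even (t + completed p t) then if p t then Suc (counter p t) else 0 else counter p t)"
  by (simp add: completed_def counter_def split: prod.split)

lemma unary_cong:
  "(\<And>i. i < t \<Longrightarrow> p i = q i) \<Longrightarrow> completed p t = completed q t \<and> counter p t = counter q t"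
  by (induction t) (simp_all add: completed_Suc counter_Suc)

lemma completed_mono: "s \<le> t \<Longrightarrow> completed p s \<le> completed p t"
  by (rule lift_Suc_mono_le[of "completed p"]) (simp_all add: completed_Suc)

text \<open>The counter at this time, just before it is reset, is the value of number
  \<open>n\<close>.\<close>

definition finished :: "(nat \<Rightarrow> bool) \<Rightarrow> nat \<Rightarrow> nat \<Rightarrow> bool" where
  "finished p n t \<longleftrightarrow> completed p t = n \<and> even (t + n) \<and> \<not> p t"

lemma finished_unique: "finished p n t \<Longrightarrow> finished p n s \<Longrightarrow> s = t"
proof -
  have *: "\<not> t < s" if "finished p n t" "finished p n s" for s t
  proof
    assume "t < s"
    then have "completed p (Suc t) \<le> completed p s" by (intro completed_mono) simp
    then show False using that by (simp add: finished_def completed_Suc)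
  qed
  assume "finished p n t" "finished p n s"
  with * show ?thesis by (meson nat_neq_iff)
qed

definition decode :: "(nat \<Rightarrow> bool) \<Rightarrow> nat \<Rightarrow> nat" where
  "decode p n = counter p (SOME t. finished p n t)"

lemma decode_finished: "finished p n t \<Longrightarrow> decode p n = counter p t"
  unfolding decode_def by (metis finished_unique someI)

definition unbounded :: "(nat \<Rightarrow> bool) \<Rightarrow> bool" where
  "unbounded p \<longleftrightarrow> (\<forall>n. \<exists>t. n < completed p t)"

lemma unbounded_finished:
  assumes "unbounded p"
  shows "\<exists>t. finished p n t"
proof -
  from assms obtain t where "n < completed p t" unfolding unbounded_def by blast
  then show ?thesis
  proof (induction t)
    case (Suc t)
    show ?case
    proof (cases "n < completed p t")
      case False
      with Suc.prems have "even (t + completed p t) \<and> \<not> p t \<and> completed p t = n"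
        by (auto simp: completed_Suc split: if_splits)
      then have "finished p n t" by (simp add: finished_def)
      then show ?thesis ..
    qed (rule Suc.IH)
  qed simp
qed

lemma not_unbounded_constant:
  assumes "\<not> unbounded p"
  shows "\<exists>l T. \<forall>t\<ge>T. completed p t = l"
proof -
  from assms obtain n where n: "\<forall>t. completed p t \<le> n" unfolding unbounded_def not_all not_ex not_less ..
  let ?l = "Max (range (completed p))"
  have fin: "finite (range (completed p))" 
    by (rule finite_subset[OF _ finite_atMost[of n]]) (simp add: image_subset_iff n)
  then have "?l \<in> range (completed p)" by (rule Max_in) simp
  then obtain T where T: "completed p T = ?l" by (metis imageE)
  have "completed p t = ?l" if "t \<ge> T" for t
  proof (rule antisym)
    show "completed p t \<le> ?l" by (intro Max_ge fin rangeI)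
    show "?l \<le> completed p t" using completed_mono[OF that, of p] T by simp
  qed
  then show ?thesis by (intro exI allI impI)
qed

text \<open>A player who never completes a move loses.\<close>

definition unary_payoff :: "(nat \<Rightarrow> nat) set \<Rightarrow> (nat \<Rightarrow> bool) set" where
  "unary_payoff A = {p. if unbounded p then decode p \<in> A else \<exists>T. \<forall>t\<ge>T. odd (completed p t)}"

text \<open>Player \<open>b\<close> uses \<open>\<sigma>\<close>, the opponent enters its entries of
  \<open>x\<close> in unary and plays false whenever its bit is ignored.\<close>

definition simulates :: "bool \<Rightarrow> (bool list \<Rightarrow> bool) \<Rightarrow> (nat \<Rightarrow> nat) \<Rightarrow> (nat \<Rightarrow> bool) \<Rightarrow> bool" where
  "simulates b \<sigma> x p \<longleftrightarrow> (\<forall>t. p t = (if even t = b then \<sigma> (map p [0..<t])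
     else even (t + completed p t) \<and> counter p t < x (completed p t)))"

lemma ex_simulates: "\<exists>p. simulates b \<sigma> x p"
proof -
  let ?F = "\<lambda>t l. if even t = b then \<sigma> l else even (t + completed (\<lambda>i. l ! i) t) \<and>
    counter (\<lambda>i. l ! i) t < x (completed (\<lambda>i. l ! i) t)"
  obtain p where p: "\<And>t. p t = ?F t (map p [0..<t])"
    using ex_sequence_course_of_values[of ?F] by blast
  have c: "completed (\<lambda>i. map p [0..<t] ! i) t = completed p t"
    "counter (\<lambda>i. map p [0..<t] ! i) t = counter p t" for t
    using unary_cong[of t "\<lambda>i. map p [0..<t] ! i" p] by simp_all
  have "simulates b \<sigma> x p" unfolding simulates_def
  proof
    fix t show "p t = (if even t = b then \<sigma> (map p [0..<t])
     else even (t + completed p t) \<and> counter p t < x (completed p t))"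
      using p[of t] unfolding c .
  qed
  then show ?thesis by (rule exI[of _ p])
qed

lemma simulates_follows: "simulates b \<sigma> x p \<Longrightarrow> follows b \<sigma> p"
  unfolding simulates_def follows_def by metis

lemma simulates_opponent:
  assumes "simulates b \<sigma> x p" "even t \<noteq> b"
  shows "p t \<longleftrightarrow> even (t + completed p t) \<and> counter p t < x (completed p t)"
  using assms unfolding simulates_def by metis

lemma simulates_counter_le:
  assumes "simulates b \<sigma> x p" "even (completed p t) \<noteq> b"
  shows "counter p t \<le> x (completed p t)"
  using assms(2)
proof (induction t)
  case (Suc t)
  show ?case
  proof (cases "even (t + completed p t)")
    case True
    show ?thesis
    proof (cases "p t")
      case pt: True
      then have "even (completed p t) \<noteq> b" using Suc.prems by (simp add: completed_Suc)
      then have "even t \<noteq> b" using True by auto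
      then have "counter p t < x (completed p t)" using simulates_opponent[OF assms(1)] pt by blast
      then show ?thesis using True pt by (simp add: completed_Suc counter_Suc)
    next
      case False
      then show ?thesis using True by (simp add: counter_Suc)
    qed
  next
    case False
    with Suc show ?thesis by (simp add: completed_Suc counter_Suc)
  qed
qed simp

lemma simulates_decode_opponent:
  assumes "simulates b \<sigma> x p" "unbounded p" "even n \<noteq> b"
  shows "decode p n = x n"
proof -
  from unbounded_finished[OF assms(2)] obtain t where t: "finished p n t" by blast
  then have t': "completed p t = n" "even (t + n)" "\<not> p t" by (auto simp: finished_def)
  then have "even t \<noteq> b" using assms(3) by auto
  from simulates_opponent[OF assms(1) this] t' have "\<not> counter p t < x n" by simp
  moreover have "counter p t \<le> x n" using simulates_counter_le[OF assms(1), of t] assms(3) t' by simp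
  ultimately show ?thesis using decode_finished[OF t] by simp
qed

text \<open>The opponent completes all its numbers, so a play can stall only at a number of player
  \<open>b\<close>: otherwise the counter would rise in every two steps and pass
  \<open>x l\<close>.\<close>

lemma simulates_stuck:
  assumes sim: "simulates b \<sigma> x p" and const: "\<And>t. t \<ge> T \<Longrightarrow> completed p t = l"
  shows "even l = b"
proof (rule ccontr)
  assume l: "even l \<noteq> b"
  have active: "p t" if "t \<ge> T" "even (t + l)" for t
    using const[of t] const[of "Suc t"] that by (auto simp: completed_Suc split: if_splits)
  have "k \<le> counter p (T + 2 * k)" for k
  proof (induction k)
    case (Suc k)
    let ?t = "T + 2 * k"
    have c: "completed p ?t = l" "completed p (Suc ?t) = l" using const by simp_all
    have "Suc (counter p ?t) = counter p (Suc (Suc ?t))"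
    proof (cases "even (?t + l)")
      case True
      moreover have "p ?t" using active[of ?t] True by simp
      moreover have "odd (Suc ?t + l)" using True by simp
      ultimately show ?thesis using c by (simp add: counter_Suc)
    next
      case False
      moreover have e: "even (Suc ?t + l)" using False by simp
      moreover have "p (Suc ?t)" using active[of "Suc ?t"] e by simp
      ultimately show ?thesis using c by (simp add: counter_Suc)
    qed
    with Suc show ?case by simp
  qed simp
  from this[of "Suc (x l)"] obtain t where t: "t \<ge> T" "x l < counter p t"
    by (metis le_add1 less_eq_Suc_le)
  have "counter p t \<le> x (completed p t)"
    using simulates_counter_le[OF sim, of t] const[OF t(1)] l by simp
  with t const[OF t(1)] show False by simp
qed

text \<open>While number \<open>n\<close> of player \<open>b\<close> is being entered the opponent's
  bits are constantly false, so up to its completion the play depends only on \<open>x\<close> below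
  \<open>n\<close>. This lets a strategy compute its next number from the position alone.\<close>

lemma simulates_local:
  assumes p: "simulates b \<sigma> x p" and q: "simulates b \<sigma> y q"
    and xy: "\<And>i. i < n \<Longrightarrow> x i = y i" and n: "even n = b"
  shows "completed p t \<le> n \<Longrightarrow> i \<le> t \<Longrightarrow> p i = q i"
proof (induction i arbitrary: t rule: less_induct)
  case (less i)
  have le: "completed p i \<le> n" using completed_mono[OF less.prems(2), of p] less.prems(1) by simp
  have eq: "p j = q j" if "j < i" for j using less.IH[OF that le] that by simp
  then have c: "completed q i = completed p i" "counter q i = counter p i"
    using unary_cong[of i q p] by auto
  show ?case
  proof (cases "even i = b")
    case True
    moreover have "map q [0..<i] = map p [0..<i]" using eq by simp
    ultimately show ?thesis using p q unfolding simulates_def by metis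
  next
    case False
    have "completed p i = n \<Longrightarrow> odd (i + completed p i)" using False n by auto
    moreover have "completed p i \<noteq> n \<Longrightarrow> x (completed p i) = y (completed p i)" using xy le by simp
    ultimately show ?thesis
      unfolding simulates_opponent[OF p False] simulates_opponent[OF q False] c by metis
  qed
qed

lemma simulates_decode_local:
  assumes p: "simulates b \<sigma> x p" and q: "simulates b \<sigma> y q" and "unbounded p"
    and xy: "\<And>i. i < n \<Longrightarrow> x i = y i" and n: "even n = b"
  shows "decode q n = decode p n"
proof -
  from unbounded_finished[OF assms(3)] obtain t where t: "finished p n t" by blast
  then have "completed p t \<le> n" by (simp add: finished_def)
  from simulates_local[OF p q xy n this] have eq: "p i = q i" if "i \<le> t" for i using that by blast
  then have c: "completed p t = completed q t" "counter p t = counter q t"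
    using unary_cong[of t p q] by auto
  then have "finished q n t" using t eq[of t] by (simp add: finished_def)
  then show ?thesis using decode_finished t c by metis
qed

text \<open>Membership being equivalent to \<open>b\<close> says that player \<open>b\<close> wins.
  The strategy on numbers answers with the number that \<open>\<sigma>\<close> enters when the
  opponent's numbers are fed to it in unary.\<close>

lemma unary_strategy:
  assumes win: "\<And>p. follows b \<sigma> p \<Longrightarrow> p \<in> unary_payoff A \<longleftrightarrow> b"
  shows "\<exists>\<sigma>'. \<forall>x. follows b \<sigma>' x \<longrightarrow> (x \<in> A \<longleftrightarrow> b)"
proof -
  from ex_simulates obtain sim where sim: "\<And>x. simulates b \<sigma> x (sim x)" by metis
  \<comment> \<open>A winning strategy does not stall: by \<open>simulates_stuck\<close> it would
    stall at its own number, and then \<open>unary_payoff\<close> declares it the loser.\<close>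
  have unb: "unbounded (sim x)" for x
  proof (rule ccontr)
    assume nu: "\<not> unbounded (sim x)"
    from not_unbounded_constant[OF this] obtain l T where T: "\<And>t. t \<ge> T \<Longrightarrow> completed (sim x) t = l" by blast
    from simulates_stuck[OF sim T] have l: "even l = b" by blast
    have "(\<exists>T. \<forall>t\<ge>T. odd (completed (sim x) t)) \<longleftrightarrow> odd l"
    proof
      assume "\<exists>T. \<forall>t\<ge>T. odd (completed (sim x) t)"
      then obtain T' where T': "\<forall>t\<ge>T'. odd (completed (sim x) t)" by blast
      from T'[rule_format, of "max T T'"] T[of "max T T'"] show "odd l" by simp
    qed (use T in auto)
    with nu have "sim x \<in> unary_payoff A \<longleftrightarrow> odd l" by (simp add: unary_payoff_def)
    with win[OF simulates_follows[OF sim]] l show False by blast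
  qed
  \<comment> \<open>The padding by 0 is harmless by \<open>simulates_decode_local\<close>.\<close>
  define \<sigma>' where "\<sigma>' q = decode (sim (\<lambda>i. if i < length q then q ! i else 0)) (length q)" for q
  have "x \<in> A \<longleftrightarrow> b" if x: "follows b \<sigma>' x" for x
  proof -
    have "decode (sim x) n = x n" for n
    proof (cases "even n = b")
      case False
      then show ?thesis using simulates_decode_opponent[OF sim unb] by blast
    next
      case True
      let ?y = "\<lambda>i. if i < length (map x [0..<n]) then map x [0..<n] ! i else 0"
      have "x n = decode (sim ?y) n" using x True unfolding follows_def \<sigma>'_def by simp
      also have "\<dots> = decode (sim x) n"
        by (rule simulates_decode_local[OF sim sim unb _ True]) simp
      finally show ?thesis ..
    qed
    then have "decode (sim x) = x" ..
    with unb[of x] have "sim x \<in> unary_payoff A \<longleftrightarrow> x \<in> A" by (simp add: unary_payoff_def)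
    with win[OF simulates_follows[OF sim]] show ?thesis by blast
  qed
  then show ?thesis by blast
qed

lemma not_determined_unary:
  assumes "\<not> determined A"
  shows "\<exists>p. follows b \<sigma> p \<and> (p \<in> unary_payoff A \<longleftrightarrow> \<not> b)"
proof (rule ccontr)
  assume "\<not> ?thesis"
  then have "p \<in> unary_payoff A \<longleftrightarrow> b" if "follows b \<sigma> p" for p using that by blast
  from unary_strategy[OF this] obtain \<sigma>' where "\<forall>x. follows b \<sigma>' x \<longrightarrow> (x \<in> A \<longleftrightarrow> b)" by blast
  then have "determined A"
    unfolding determined_def one_player_wins_def winning_strategy_I_follows winning_strategy_II_follows
    by (cases b) auto
  with assms show False ..
qed

section \<open>Second order definition of the unary payoff\<close>

lemma dfn_subst:
  assumes "dfn 0 2 (\<lambda>v F. A (F ! 0) (F ! 1))" "2 \<le> i" "2 \<le> j" "i < m" "j < m"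
  shows "dfn n m (\<lambda>v F. A (F ! i) (F ! j))"
proof -
  from assms(1) obtain \<phi> where \<phi>: "\<And>e E. soa_sat e E \<phi> \<longleftrightarrow> A (E 0) (E 1)"
    unfolding dfn_def by (auto simp: upt_rec)
  define eqf where "eqf a b = Neg (ExNum 0 (Neg (Equal (App a (Var 0)) (App b (Var 0)))))" for a b
  have eqf: "soa_sat e E (eqf a b) \<longleftrightarrow> E a = E b" for e E a b
    by (auto simp: eqf_def)
  \<comment> \<open>Variables 0 and 1 are rebound and equated with \<open>i\<close> and
    \<open>j\<close>; indices from 2 on escape the capture.\<close>
  have "soa_sat e E (ExFun 0 (ExFun 1 (Conj \<phi> (Conj (eqf 0 i) (eqf 1 j))))) \<longleftrightarrow> A (E i) (E j)" for e E
    using assms(2,3) by (simp add: \<phi> eqf)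
  then show ?thesis using assms(4,5) unfolding dfn_def by (metis (no_types, lifting) add_cancel_right_left
      diff_zero length_upt nth_map_upt)
qed

text \<open>The recursion equations of the unary run, with \<open>L\<close> the completed numbers
  and \<open>C\<close> the counter. The function \<open>x\<close> is constrained only at numbers
  that get completed, so it is determined exactly when all of them are.\<close>

definition unary_spec ::
  "(nat \<Rightarrow> nat) \<Rightarrow> (nat \<Rightarrow> nat) \<Rightarrow> (nat \<Rightarrow> nat) \<Rightarrow> (nat \<Rightarrow> nat) \<Rightarrow> bool" where
  "unary_spec p L C x \<longleftrightarrow> L 0 = 0 \<and> C 0 = 0 \<and>
     (\<forall>t. (\<not> odd (t + L t) \<and> p t = 0 \<longrightarrow> L (Suc t) = Suc (L t) \<and> C (Suc t) = 0 \<and> x (L t) = C t) \<and>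
       (\<not> odd (t + L t) \<and> \<not> p t = 0 \<longrightarrow> L (Suc t) = L t \<and> C (Suc t) = Suc (C t)) \<and>
       (odd (t + L t) \<longrightarrow> L (Suc t) = L t \<and> C (Suc t) = C t))"

lemma unary_specD:
  assumes "unary_spec p L C x"
  shows "L t = completed (bits p) t \<and> C t = counter (bits p) t"
proof (induction t)
  case 0
  then show ?case using assms by (simp add: unary_spec_def)
next
  case (Suc t)
  let ?p = "\<lambda>i. p i \<noteq> 0"
  have spec: "(\<not> odd (t + L t) \<and> p t = 0 \<longrightarrow> L (Suc t) = Suc (L t) \<and> C (Suc t) = 0 \<and> x (L t) = C t) \<and>
       (\<not> odd (t + L t) \<and> \<not> p t = 0 \<longrightarrow> L (Suc t) = L t \<and> C (Suc t) = Suc (C t)) \<and>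
       (odd (t + L t) \<longrightarrow> L (Suc t) = L t \<and> C (Suc t) = C t)"
    using assms unfolding unary_spec_def by blast
  from Suc have "L t = completed ?p t" "C t = counter ?p t" by simp_all
  with spec show ?case unfolding completed_Suc counter_Suc by (cases "odd (t + L t)"; cases "p t = 0") auto
qed

lemma unary_spec_exists:
  "unary_spec p (completed (bits p)) (counter (bits p)) (decode (bits p))"
proof -
  let ?p = "\<lambda>i. p i \<noteq> 0"
  have "decode ?p (completed ?p t) = counter ?p t" if "\<not> odd (t + completed ?p t)" "p t = 0" for t
    using that by (intro decode_finished) (simp add: finished_def)
  then show ?thesis unfolding unary_spec_def by (simp add: completed_Suc counter_Suc)
qed

lemma unary_spec_decode:
  assumes "unary_spec p L C x" "unbounded (bits p)"
  shows "x = decode (bits p)"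
proof
  fix n
  let ?p = "\<lambda>i. p i \<noteq> 0"
  from unbounded_finished[OF assms(2)] obtain t where t: "finished ?p n t" by blast
  have "L t = completed ?p t" "C t = counter ?p t" using unary_specD[OF assms(1)] by simp_all
  moreover have "\<not> odd (t + L t) \<and> p t = 0 \<longrightarrow> x (L t) = C t"
    using assms(1) unfolding unary_spec_def by blast
  ultimately show "x n = decode ?p n" using t decode_finished[OF t] by (simp add: finished_def)
qed

text \<open>\<open>z'\<close> is a copy of the parameter, bound late enough to have an index that
  \<open>dfn_subst\<close> admits. The clause for stalled plays does not mention \<open>x\<close>,
  which is then not determined.\<close>

lemma unary_payoff_iff:
  "(bits p) \<in> unary_payoff {x. A x z} \<longleftrightarrow>
    (\<exists>L C x z'. (\<forall>i. z' i = z i) \<and> unary_spec p L C x \<and>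
      (((\<forall>n. \<exists>t. n < L t) \<and> A x z') \<or> (\<not> (\<forall>n. \<exists>t. n < L t) \<and> (\<exists>T. \<forall>t. T \<le> t \<longrightarrow> odd (L t)))))"
  (is "?l \<longleftrightarrow> (\<exists>L C x z'. ?R L C x z')")
proof
  let ?p = "\<lambda>i. p i \<noteq> 0"
  assume ?l
  then have "?R (completed ?p) (counter ?p) (decode ?p) z"
    using unary_spec_exists[of p] by (auto simp: unary_payoff_def unbounded_def split: if_splits)
  then show "\<exists>L C x z'. ?R L C x z'" by blast
next
  let ?p = "\<lambda>i. p i \<noteq> 0"
  assume "\<exists>L C x z'. ?R L C x z'"
  then obtain L C x z' where R: "?R L C x z'" by blast
  then have z: "z' = z" and spec: "unary_spec p L C x" by auto
  have L: "L = completed ?p" using unary_specD[OF spec] by blast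
  show ?l
  proof (cases "unbounded ?p")
    case True
    then show ?thesis using R unary_spec_decode[OF spec True] z unfolding L
      by (auto simp: unary_payoff_def unbounded_def)
  next
    case False
    then show ?thesis using R unfolding L by (auto simp: unary_payoff_def unbounded_def)
  qed
qed

lemma dfn_unary_payoff:
  assumes A: "dfn 0 2 (\<lambda>v F. A (F ! 0) (F ! 1))"
  shows "dfn 0 2 (\<lambda>v F. (bits (F ! 0)) \<in> unary_payoff {x. A x (F ! 1)})"
proof -
  have A': "dfn n (Suc (Suc (Suc (Suc 2)))) (\<lambda>v F. A (butlast F ! Suc (Suc 2)) (F ! Suc (Suc (Suc 2))))" for n
    by (rule dfn_cong[OF dfn_subst[OF A, of "Suc (Suc 2)" "Suc (Suc (Suc 2))"]]) (simp_all add: nth_butlast)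
  show ?thesis unfolding unary_payoff_iff unary_spec_def
    by (intro dfn_exf dfn_conj dfn_disj[OF dfn_conj[OF _ A']] dfn_all dfn_ex dfn_imp dfn_not dfn_odd
        dfn_less dfn_le dfn_eq
        dft_app dft_app_butlast dft_nth dft_nth_butlast dft_plus dft_Suc dft_0)
      (simp_all add: numeral_2_eq_2)
qed

section \<open>Uniform continuity of primitive recursive functionals in their oracles\<close>

definition agree :: "nat \<Rightarrow> nat \<Rightarrow> pred list \<Rightarrow> pred list \<Rightarrow> bool" where
  "agree p N Xs Ys \<longleftrightarrow> (\<forall>c<p. \<forall>i<N. (Ys ! c) i = (Xs ! c) i)"

lemma agree_mono: "agree p N Xs Ys \<Longrightarrow> M \<le> N \<Longrightarrow> agree p M Xs Ys"
  unfolding agree_def by simp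

text \<open>The bound \<open>B\<close> on the values is proved together with the modulus
  \<open>N\<close>: compositions and recursions need the moduli at all possible intermediate values,
  and boundedness leaves finitely many, of which a maximum is taken.\<close>

lemma prim_rec_agree:
  "prim_rec p n F \<Longrightarrow> \<exists>N B. \<forall>Xs. F Xs v \<le> B \<and> (\<forall>Ys. agree p N Xs Ys \<longrightarrow> F Ys v = F Xs v)"
proof (induction arbitrary: v rule: prim_rec.induct)
  case (query i)
  then show ?case by (intro exI[of _ "Suc (hd v)"] exI[of _ 1]) (simp add: agree_def)
next
  case (comp gs f n)
  have "\<forall>g\<in>set gs. \<exists>N B. \<forall>Xs. g Xs v \<le> B \<and> (\<forall>Ys. agree p N Xs Ys \<longrightarrow> g Ys v = g Xs v)"
    using comp.IH(2) by simp
  from bchoice[OF this] obtain M where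
    "\<forall>g\<in>set gs. \<exists>B. \<forall>Xs. g Xs v \<le> B \<and> (\<forall>Ys. agree p (M g) Xs Ys \<longrightarrow> g Ys v = g Xs v)" ..
  from bchoice[OF this] obtain C where
    g: "\<forall>g\<in>set gs. \<forall>Xs. g Xs v \<le> C g \<and> (\<forall>Ys. agree p (M g) Xs Ys \<longrightarrow> g Ys v = g Xs v)" ..
  have "\<forall>w. \<exists>N B. \<forall>Xs. f Xs w \<le> B \<and> (\<forall>Ys. agree p N Xs Ys \<longrightarrow> f Ys w = f Xs w)"
    using comp.IH(1) by simp
  from choice[OF this] obtain M' where
    "\<forall>w. \<exists>B. \<forall>Xs. f Xs w \<le> B \<and> (\<forall>Ys. agree p (M' w) Xs Ys \<longrightarrow> f Ys w = f Xs w)" ..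
  from choice[OF this] obtain C' where
    f: "\<forall>w Xs. f Xs w \<le> C' w \<and> (\<forall>Ys. agree p (M' w) Xs Ys \<longrightarrow> f Ys w = f Xs w)" ..
  let ?V = "{w. set w \<subseteq> {..Max (insert 0 (C ` set gs))} \<and> length w = length gs}"
  let ?w = "\<lambda>Xs. map (\<lambda>g. g Xs v) gs"
  let ?N = "Max (insert 0 (M ` set gs \<union> M' ` ?V))" and ?B = "Max (insert 0 (C' ` ?V))"
  have fin: "finite ?V" by (rule finite_lists_length_eq) simp
  have V: "?w Xs \<in> ?V" for Xs
  proof -
    have "g Xs v \<le> Max (insert 0 (C ` set gs))" if "g \<in> set gs" for g
      by (rule order_trans[of _ "C g"], use g that in blast, rule Max_ge) (use that in auto)
    then show ?thesis by auto
  qed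
  have "f Xs (?w Xs) \<le> ?B" for Xs
    by (rule order_trans[of _ "C' (?w Xs)"], use f in blast, rule Max_ge) (use fin V[of Xs] in blast)+
  moreover have "f Ys (?w Ys) = f Xs (?w Xs)" if a: "agree p ?N Xs Ys" for Xs Ys
  proof -
    have "g Ys v = g Xs v" if "g \<in> set gs" for g
    proof -
      have "M g \<le> ?N" by (rule Max_ge) (use fin that in auto)
      from agree_mono[OF a this] g that show ?thesis by blast
    qed
    then have "?w Ys = ?w Xs" by simp
    moreover have "M' (?w Xs) \<le> ?N" by (rule Max_ge) (use fin V[of Xs] in blast)+
    from agree_mono[OF a this] f have "f Ys (?w Xs) = f Xs (?w Xs)" by blast
    ultimately show ?thesis by (simp only:)
  qed
  ultimately show ?case by (intro exI[of _ ?N] exI[of _ ?B] allI conjI impI)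
next
  case (prec n f g)
  let ?r = "\<lambda>Xs k. rec_nat (f Xs (tl v)) (\<lambda>i r. g Xs (i # r # tl v)) k"
  have "\<exists>N B. \<forall>Xs. ?r Xs k \<le> B \<and> (\<forall>Ys. agree p N Xs Ys \<longrightarrow> ?r Ys k = ?r Xs k)" for k
  proof (induction k)
    case 0
    show ?case using prec.IH(1)[of "tl v"] by simp
  next
    case (Suc k)
    then obtain N B where r: "\<forall>Xs. ?r Xs k \<le> B \<and> (\<forall>Ys. agree p N Xs Ys \<longrightarrow> ?r Ys k = ?r Xs k)"
      by (elim exE)
    have "\<forall>a. \<exists>N B. \<forall>Xs. g Xs (k # a # tl v) \<le> B \<and>
        (\<forall>Ys. agree p N Xs Ys \<longrightarrow> g Ys (k # a # tl v) = g Xs (k # a # tl v))"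
      using prec.IH(2) by simp
    from choice[OF this] obtain M where "\<forall>a. \<exists>B. \<forall>Xs. g Xs (k # a # tl v) \<le> B \<and>
        (\<forall>Ys. agree p (M a) Xs Ys \<longrightarrow> g Ys (k # a # tl v) = g Xs (k # a # tl v))" ..
    from choice[OF this] obtain C where g: "\<forall>a Xs. g Xs (k # a # tl v) \<le> C a \<and>
        (\<forall>Ys. agree p (M a) Xs Ys \<longrightarrow> g Ys (k # a # tl v) = g Xs (k # a # tl v))" ..
    let ?N = "Max (insert N (M ` {..B}))" and ?B = "Max (C ` {..B})"
    have "?r Xs (Suc k) \<le> ?B" for Xs
    proof -
      have "?r Xs (Suc k) \<le> C (?r Xs k)" using g by simp
      also have "\<dots> \<le> ?B" by (rule Max_ge) (use r in auto)
      finally show ?thesis .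
    qed
    moreover have "?r Ys (Suc k) = ?r Xs (Suc k)" if a: "agree p ?N Xs Ys" for Xs Ys
    proof -
      have "N \<le> ?N" by (rule Max_ge) auto
      from agree_mono[OF a this] r have "?r Ys k = ?r Xs k" by blast
      moreover have "M (?r Xs k) \<le> ?N" by (rule Max_ge) (use r in auto)
      from agree_mono[OF a this] g have "g Ys (k # ?r Xs k # tl v) = g Xs (k # ?r Xs k # tl v)" by blast
      ultimately show ?thesis by simp
    qed
    ultimately show ?case by (intro exI[of _ ?N] exI[of _ ?B] allI conjI impI)
  qed
  then show ?case .
qed auto

section \<open>Projective sets\<close>

abbreviation cont :: "((nat \<Rightarrow> nat) \<Rightarrow> 'b :: topological_space) \<Rightarrow> bool" where
  "cont \<equiv> continuous_on UNIV"

definition join :: "(nat \<Rightarrow> nat) \<Rightarrow> (nat \<Rightarrow> nat) \<Rightarrow> nat \<Rightarrow> nat" where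
  "join x y n = (if even n then x (n div 2) else y (n div 2))"

definition left_half :: "(nat \<Rightarrow> nat) \<Rightarrow> nat \<Rightarrow> nat" where
  "left_half w n = w (n + n)"

definition right_half :: "(nat \<Rightarrow> nat) \<Rightarrow> nat \<Rightarrow> nat" where
  "right_half w n = w (Suc (n + n))"

lemma halves_join [simp]: "left_half (join x y) = x" "right_half (join x y) = y"
  by (auto simp: join_def left_half_def right_half_def fun_eq_iff simp flip: mult_2)

lemma join_halves [simp]: "join (left_half w) (right_half w) = w"
proof
  fix n show "join (left_half w) (right_half w) n = w n"
    by (cases "even n") (auto simp: join_def left_half_def right_half_def elim!: evenE oddE simp flip: mult_2)
qed

lemma cont_coordinatewise: "(\<And>i. cont (\<lambda>x. f x i)) \<Longrightarrow> cont f"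
  for f :: "(nat \<Rightarrow> nat) \<Rightarrow> nat \<Rightarrow> nat"
  by (rule continuous_on_coordinatewise_then_product)

lemma cont_coordinate: "cont (\<lambda>x. x i)"
  by (rule continuous_on_product_coordinates)

lemma cont_apply: "cont f \<Longrightarrow> cont (\<lambda>x. f x i)" for f :: "(nat \<Rightarrow> nat) \<Rightarrow> nat \<Rightarrow> nat"
  using continuous_on_compose2[OF cont_coordinate[of i], of UNIV f] by simp

lemma cont_comp: "cont g \<Longrightarrow> cont f \<Longrightarrow> cont (\<lambda>x. g (f x))" for f :: "(nat \<Rightarrow> nat) \<Rightarrow> nat \<Rightarrow> nat"
  using continuous_on_compose2[of UNIV g UNIV f] by simp

lemma cont_join: "cont f \<Longrightarrow> cont g \<Longrightarrow> cont (\<lambda>x. join (f x) (g x))"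
proof (rule cont_coordinatewise)
  fix i assume "cont f" "cont g"
  then show "cont (\<lambda>x. join (f x) (g x) i)"
    by (cases "even i") (simp_all add: join_def cont_apply)
qed

lemma cont_left_half: "cont left_half" and cont_right_half: "cont right_half"
  by (rule cont_coordinatewise; simp add: left_half_def right_half_def cont_coordinate)+

lemma cont_nat_iff: "cont f \<longleftrightarrow> (\<forall>a. open {x. f x = a})" for f :: "(nat \<Rightarrow> nat) \<Rightarrow> nat"
proof
  assume f: "cont f"
  have "open (f -` {a})" for a using f by (intro open_vimage) (auto simp: open_discrete)
  then show "\<forall>a. open {x. f x = a}" by (simp add: vimage_def)
next
  assume a: "\<forall>a. open {x. f x = a}"
  have "open (f -` B)" for B
  proof -
    have "f -` B = (\<Union>a\<in>B. {x. f x = a})" by auto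
    then show ?thesis using a by auto
  qed
  then show "cont f" by (simp add: continuous_on_open_vimage)
qed

text \<open>\<open>f\<close> is locally constant, and continuity is local.\<close>

lemma cont_combine:
  fixes f :: "(nat \<Rightarrow> nat) \<Rightarrow> nat" and g :: "nat \<Rightarrow> (nat \<Rightarrow> nat) \<Rightarrow> nat"
  assumes "cont f" "\<And>a. cont (g a)"
  shows "cont (\<lambda>x. g (f x) x)"
  unfolding cont_nat_iff
proof
  fix b
  have "{x. g (f x) x = b} = (\<Union>a. {x. f x = a} \<inter> {x. g a x = b})" by auto
  moreover have "open (\<Union>a. {x. f x = a} \<inter> {x. g a x = b})"
    using assms unfolding cont_nat_iff by (intro open_UN open_Int ballI) auto
  ultimately show "open {x. g (f x) x = b}" by simp
qed

lemma cont_const: "cont (\<lambda>x. c)"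
  by (rule continuous_on_const)

lemma cont_op:
  fixes f g :: "(nat \<Rightarrow> nat) \<Rightarrow> nat" and h :: "nat \<Rightarrow> nat \<Rightarrow> nat"
  assumes "cont f" "cont g"
  shows "cont (\<lambda>x. h (f x) (g x))"
  using cont_combine[OF assms(1), of "\<lambda>a x. h a (g x)"] cont_combine[OF assms(2), of "\<lambda>b x. h _ b"] cont_const
  by blast

lemma open_Collect_rel:
  fixes f g :: "(nat \<Rightarrow> nat) \<Rightarrow> nat"
  assumes "cont f" "cont g"
  shows "open {x. R (f x) (g x)}"
proof -
  have "open {x. of_bool (R (f x) (g x)) = (1 :: nat)}"
    using cont_op[OF assms, of "\<lambda>a b. of_bool (R a b)"] unfolding cont_nat_iff by blast
  then show ?thesis by (simp only: of_bool_eq_1_iff)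
qed

lemma closed_Collect_rel:
  fixes f g :: "(nat \<Rightarrow> nat) \<Rightarrow> nat"
  assumes "cont f" "cont g"
  shows "closed {x. R (f x) (g x)}"
  using open_Collect_rel[OF assms, of "\<lambda>a b. \<not> R a b"] unfolding closed_def
  by (simp add: Collect_neg_eq[symmetric] Compl_eq)

text \<open>The projective hierarchy over the Borel sets, each level being the projections of
  complements from the level before. From this normal form \<open>projective\<close> gets its
  closure under intersections and continuous preimages, which its inductive definition does not
  show.\<close>

primrec sigma_level :: "nat \<Rightarrow> (nat \<Rightarrow> nat) set \<Rightarrow> bool" where
  "sigma_level 0 A \<longleftrightarrow> A \<in> sets borel"
| "sigma_level (Suc n) A \<longleftrightarrow> (\<exists>B. sigma_level n B \<and> A = {x. \<exists>y. join x y \<notin> B})"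

lemma sigma_level_vimage: "sigma_level n A \<Longrightarrow> cont g \<Longrightarrow> sigma_level n (g -` A)"
proof (induction n arbitrary: A g)
  case 0
  have "g \<in> borel_measurable borel" using 0(2) by (rule borel_measurable_continuous_onI)
  from measurable_sets[OF this, of A] 0(1) show ?case by simp
next
  case (Suc n)
  from Suc.prems obtain B where B: "sigma_level n B" "A = {x. \<exists>y. join x y \<notin> B}"
    unfolding sigma_level.simps by blast
  let ?h = "\<lambda>z. join (g (left_half z)) (right_half z)"
  have "cont ?h" by (rule cont_join[OF cont_comp[OF Suc.prems(2) cont_left_half] cont_right_half])
  from Suc.IH[OF B(1) this] have "sigma_level n (?h -` B)" .
  moreover have "g -` A = {x. \<exists>y. join x y \<notin> ?h -` B}" unfolding B(2) by simp
  ultimately show ?case unfolding sigma_level.simps by blast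
qed

text \<open>A union can share one witness, an intersection joins two witnesses into one. Because of
  the complements, each uses the opposite closure one level down.\<close>

lemma sigma_level_Un_Int:
  "sigma_level n A \<Longrightarrow> sigma_level n B \<Longrightarrow> sigma_level n (A \<union> B) \<and> sigma_level n (A \<inter> B)"
proof (induction n arbitrary: A B)
  case (Suc n)
  from Suc.prems obtain A' B' where A: "sigma_level n A'" "A = {x. \<exists>y. join x y \<notin> A'}"
    and B: "sigma_level n B'" "B = {x. \<exists>y. join x y \<notin> B'}" unfolding sigma_level.simps by blast
  have "A \<union> B = {x. \<exists>y. join x y \<notin> A' \<inter> B'}" unfolding A(2) B(2) by blast
  moreover have "sigma_level n (A' \<inter> B')" using Suc.IH[OF A(1) B(1)] ..
  ultimately have Un: "sigma_level (Suc n) (A \<union> B)" unfolding sigma_level.simps by blast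
  let ?f = "\<lambda>z. join (left_half z) (left_half (right_half z))"
  let ?g = "\<lambda>z. join (left_half z) (right_half (right_half z))"
  have f: "cont ?f" by (rule cont_join[OF cont_left_half cont_comp[OF cont_left_half cont_right_half]])
  have g: "cont ?g" by (rule cont_join[OF cont_left_half cont_comp[OF cont_right_half cont_right_half]])
  have "sigma_level n (?f -` A' \<union> ?g -` B')"
    using Suc.IH[OF sigma_level_vimage[OF A(1) f] sigma_level_vimage[OF B(1) g]] ..
  moreover have "A \<inter> B = {x. \<exists>y. join x y \<notin> ?f -` A' \<union> ?g -` B'}"
  proof (intro equalityI subsetI)
    fix x assume "x \<in> A \<inter> B"
    then obtain y z where "join x y \<notin> A'" "join x z \<notin> B'" unfolding A(2) B(2) by blast
    then have "join x (join y z) \<notin> ?f -` A' \<union> ?g -` B'" by simp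
    then show "x \<in> {x. \<exists>y. join x y \<notin> ?f -` A' \<union> ?g -` B'}" by blast
  next
    fix x assume "x \<in> {x. \<exists>y. join x y \<notin> ?f -` A' \<union> ?g -` B'}"
    then obtain y where "join x y \<notin> ?f -` A' \<union> ?g -` B'" by blast
    then have "join x (left_half y) \<notin> A'" "join x (right_half y) \<notin> B'" by simp_all
    then show "x \<in> A \<inter> B" unfolding A(2) B(2) by blast
  qed
  ultimately have "sigma_level (Suc n) (A \<inter> B)" unfolding sigma_level.simps by blast
  with Un show ?case ..
qed simp

lemma sigma_level_Compl: "sigma_level n A \<Longrightarrow> sigma_level (Suc n) (- A)"
proof -
  assume "sigma_level n A"
  then have "sigma_level n (left_half -` A)" by (rule sigma_level_vimage[OF _ cont_left_half])
  moreover have "- A = {x. \<exists>y. join x y \<notin> left_half -` A}" by auto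
  ultimately show ?thesis unfolding sigma_level.simps by blast
qed

lemma sigma_level_Suc: "sigma_level n A \<Longrightarrow> sigma_level (Suc n) A"
proof (induction n arbitrary: A)
  case 0
  then have "sigma_level 0 (- A)" by simp
  from sigma_level_Compl[OF this] show ?case by simp
next
  case (Suc n)
  from Suc.prems obtain B where "sigma_level n B" "A = {x. \<exists>y. join x y \<notin> B}"
    unfolding sigma_level.simps by blast
  with Suc.IH[of B] show ?case unfolding sigma_level.simps(2)[of "Suc n"] by blast
qed

lemma sigma_level_mono: "sigma_level n A \<Longrightarrow> n \<le> m \<Longrightarrow> sigma_level m A"
  by (induction m) (auto simp: le_Suc_eq simp del: sigma_level.simps intro: sigma_level_Suc)

text \<open>Turns continuous images into projections: the image of \<open>A\<close> is the
  projection of the part of this closed set above \<open>A\<close>.\<close>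

lemma closed_graph: "cont f \<Longrightarrow> closed {w. f (right_half w) = left_half w}"
proof -
  assume f: "cont f"
  have "closed {w. f (right_half w) i = w (i + i)}" for i
    by (rule closed_Collect_rel[where R = "(=)"])
      (intro cont_apply cont_comp[OF f] cont_right_half cont_coordinate)+
  then have "closed (\<Inter>i. {w. f (right_half w) i = w (i + i)})" by (intro closed_INT) blast
  moreover have "{w. f (right_half w) = left_half w} = (\<Inter>i. {w. f (right_half w) i = w (i + i)})"
    by (auto simp: left_half_def fun_eq_iff)
  ultimately show ?thesis by simp
qed

lemma projective_sigma_level: "projective A \<Longrightarrow> \<exists>n. sigma_level n A"
proof (induction rule: projective.induct)
  case (borel A)
  then show ?case by (intro exI[of _ 0]) simp
next
  case (compl A)
  then show ?case using sigma_level_Compl by blast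
next
  case (image A f)
  then obtain n where n: "sigma_level n A" by blast
  let ?G = "{w. f (right_half w) = left_half w}"
  have "sigma_level 0 (- ?G)" using closed_graph[OF image(2)] by (auto intro: borel_closed)
  then have "sigma_level (Suc n) (- ?G)" by (rule sigma_level_mono) simp
  moreover have "sigma_level (Suc n) (right_half -` (- A))"
    using sigma_level_Compl[OF n] by (rule sigma_level_vimage[OF _ cont_right_half])
  ultimately have "sigma_level (Suc n) (- ?G \<union> right_half -` (- A))" using sigma_level_Un_Int by blast
  moreover have "f ` A = {x. \<exists>y. join x y \<notin> - ?G \<union> right_half -` (- A)}" by auto
  ultimately have "sigma_level (Suc (Suc n)) (f ` A)" unfolding sigma_level.simps(2)[of "Suc n"] by blast
  then show ?case ..
qed

lemma sigma_level_projective: "sigma_level n A \<Longrightarrow> projective A"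
proof (induction n arbitrary: A)
  case 0
  then show ?case by (simp add: projective.borel)
next
  case (Suc n)
  from Suc.prems obtain B where B: "sigma_level n B" "A = {x. \<exists>y. join x y \<notin> B}"
    unfolding sigma_level.simps by blast
  have "A = left_half ` (- B)"
  proof (intro equalityI subsetI)
    fix x assume "x \<in> A"
    then obtain y where "join x y \<in> - B" unfolding B(2) by blast
    then have "left_half (join x y) \<in> left_half ` (- B)" by (rule imageI)
    then show "x \<in> left_half ` (- B)" by simp
  next
    fix x assume "x \<in> left_half ` (- B)"
    then obtain w where "x = left_half w" "w \<notin> B" by blast
    then have "join x (right_half w) \<notin> B" by simp
    then show "x \<in> A" unfolding B(2) by blast
  qed
  then show ?case using projective.image[OF projective.compl[OF Suc.IH[OF B(1)]] cont_left_half] by simp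
qed

lemma projective_Int: "projective A \<Longrightarrow> projective B \<Longrightarrow> projective (A \<inter> B)"
proof -
  assume "projective A" "projective B"
  then obtain n m where "sigma_level n A" "sigma_level m B" using projective_sigma_level by meson
  then have "sigma_level (max n m) A" "sigma_level (max n m) B" by (auto elim: sigma_level_mono simp del: sigma_level.simps)
  then have "sigma_level (max n m) (A \<inter> B)" using sigma_level_Un_Int by blast
  then show ?thesis by (rule sigma_level_projective)
qed

lemma projective_vimage: "projective A \<Longrightarrow> cont g \<Longrightarrow> projective (g -` A)"
  using projective_sigma_level sigma_level_vimage sigma_level_projective by meson

lemma projective_ex: "projective A \<Longrightarrow> cont h \<Longrightarrow> projective {x. \<exists>y. h (join x y) \<in> A}"
proof -
  assume "projective A" "cont h"
  then have "projective (left_half ` (h -` A))" by (intro projective.image projective_vimage cont_left_half)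
  moreover have "left_half ` (h -` A) = {x. \<exists>y. h (join x y) \<in> A}"
  proof (intro equalityI subsetI)
    fix x assume "x \<in> left_half ` (h -` A)"
    then obtain w where "x = left_half w" "h w \<in> A" by blast
    then have "h (join x (right_half w)) \<in> A" by simp
    then show "x \<in> {x. \<exists>y. h (join x y) \<in> A}" by blast
  next
    fix x assume "x \<in> {x. \<exists>y. h (join x y) \<in> A}"
    then obtain y where "join x y \<in> h -` A" by blast
    then have "left_half (join x y) \<in> left_half ` (h -` A)" by (rule imageI)
    then show "x \<in> left_half ` (h -` A)" by simp
  qed
  ultimately show ?thesis by simp
qed

section \<open>Sets definable with parameters are projective\<close>

definition column :: "(nat \<Rightarrow> nat) \<Rightarrow> nat \<Rightarrow> nat \<Rightarrow> nat" where
  "column x c i = x (prod_encode (c, i))"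

abbreviation col_val :: "(nat \<Rightarrow> nat) \<Rightarrow> soa_term \<Rightarrow> nat" where
  "col_val x \<equiv> soa_val (column x 0) (\<lambda>j. column x (Suc j))"

abbreviation col_sat :: "(nat \<Rightarrow> nat) \<Rightarrow> soa_formula \<Rightarrow> bool" where
  "col_sat x \<equiv> soa_sat (column x 0) (\<lambda>j. column x (Suc j))"

text \<open>Unlike \<open>read\<close>, a column gives its values directly, without a search, so
  terms are continuous and atomic formulas define open sets.\<close>

lemma cont_col_val: "cont (\<lambda>x. col_val x t)"
proof (induction t)
  case (Var i)
  then show ?case by (simp add: column_def cont_coordinate)
next
  case (Succ t)
  then show ?case using cont_combine[OF Succ, of "\<lambda>a x. Suc a"] cont_const by simp
next
  case (Plus t u)
  then show ?case using cont_op[of _ _ "(+)"] by simp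
next
  case (Times t u)
  then show ?case using cont_op[of _ _ "(*)"] by simp
next
  case (App j t)
  then show ?case using cont_combine[OF App, of "\<lambda>a x. column x (Suc j) a"]
    by (simp add: column_def cont_coordinate)
qed (simp add: cont_const)

lemma projective_col_rel: "projective {x. R (col_val x t) (col_val x u)}"
  by (intro projective.borel borel_open open_Collect_rel cont_col_val)

lemma projective_col_sat: "projective {x. col_sat x \<phi>}"
proof (induction \<phi>)
  case (Equal t u)
  show ?case using projective_col_rel[of "(=)"] by simp
next
  case (Less t u)
  show ?case using projective_col_rel[of "(<)"] by simp
next
  case (Neg \<phi>)
  from projective.compl[OF this] show ?case by (simp add: Collect_neg_eq)
next
  case (Conj \<phi> \<theta>)
  from projective_Int[OF this] show ?case by (simp add: Collect_conj_eq)
next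
  case (ExNum i \<phi>)
  \<comment> \<open>Overwrites the quantified number variable by the first entry of the
    witness.\<close>
  define h where "h w = (left_half w)(prod_encode (0, i) := right_half w 0)" for w
  have "cont h"
  proof (rule cont_coordinatewise)
    fix m show "cont (\<lambda>w. h w m)"
      unfolding h_def by (cases "m = prod_encode (0, i)") (simp_all add: left_half_def right_half_def cont_coordinate)
  qed
  from projective_ex[OF ExNum this] have "projective {x. \<exists>y. col_sat (h (join x y)) \<phi>}" by simp
  moreover have "(\<exists>y. col_sat (h (join x y)) \<phi>) \<longleftrightarrow> col_sat x (ExNum i \<phi>)" for x
  proof -
    have "column (h (join x y)) 0 = (column x 0)(i := y 0)" "column (h (join x y)) (Suc j) = column x (Suc j)" for y j
      by (auto simp: column_def h_def fun_eq_iff)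
    then have "(\<exists>y. col_sat (h (join x y)) \<phi>) \<longleftrightarrow>
        (\<exists>y :: nat \<Rightarrow> nat. soa_sat ((column x 0)(i := y 0)) (\<lambda>j. column x (Suc j)) \<phi>)" by simp
    also have "\<dots> \<longleftrightarrow> (\<exists>a. soa_sat ((column x 0)(i := a)) (\<lambda>j. column x (Suc j)) \<phi>)"
    proof
      assume "\<exists>a. soa_sat ((column x 0)(i := a)) (\<lambda>j. column x (Suc j)) \<phi>"
      then obtain a where "soa_sat ((column x 0)(i := a)) (\<lambda>j. column x (Suc j)) \<phi>" by blast
      then show "\<exists>y :: nat \<Rightarrow> nat. soa_sat ((column x 0)(i := y 0)) (\<lambda>j. column x (Suc j)) \<phi>"
        by (intro exI[of _ "\<lambda>_. a"])
    qed blast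
    finally show ?thesis by simp
  qed
  ultimately show ?case by simp
next
  case (ExFun c \<phi>)
  define h where "h w m = (if fst (prod_decode m) = Suc c then right_half w (snd (prod_decode m)) else left_half w m)" for w m
  have "cont h"
  proof (rule cont_coordinatewise)
    fix m show "cont (\<lambda>w. h w m)"
      unfolding h_def by (cases "fst (prod_decode m) = Suc c") (simp_all add: left_half_def right_half_def cont_coordinate)
  qed
  from projective_ex[OF ExFun this] have "projective {x. \<exists>y. col_sat (h (join x y)) \<phi>}" by simp
  moreover have "(\<exists>y. col_sat (h (join x y)) \<phi>) \<longleftrightarrow> col_sat x (ExFun c \<phi>)" for x
  proof -
    have "column (h (join x y)) 0 = column x 0"
      "(\<lambda>j. column (h (join x y)) (Suc j)) = (\<lambda>j. column x (Suc j))(c := y)" for y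
      by (auto simp: column_def h_def fun_eq_iff)
    then show ?thesis by simp
  qed
  ultimately show ?case by simp
qed

lemma projective_soa: "projective {p. soa_sat e (E(0 := p)) \<phi>}"
proof -
  \<comment> \<open>Lays out all variables in one point: \<open>p\<close> as function variable 0,
    all the others as constants.\<close>
  define g where "g p m = (case prod_decode m of (c, i) \<Rightarrow>
    if c = 0 then e i else if c = 1 then p i else E (c - 1) i)" for p m
  have "cont g"
  proof (rule cont_coordinatewise)
    fix m
    obtain c i where m: "prod_decode m = (c, i)" by fastforce
    show "cont (\<lambda>p. g p m)"
      unfolding g_def m by (cases "c = 0"; cases "c = 1") (simp_all add: cont_coordinate cont_const)
  qed
  from projective_vimage[OF projective_col_sat this] have "projective (g -` {x. col_sat x \<phi>})" .
  moreover have "column (g p) 0 = e" "(\<lambda>j. column (g p) (Suc j)) = E(0 := p)" for p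
    by (auto simp: column_def g_def fun_eq_iff)
  ultimately show ?thesis by (simp add: vimage_def)
qed

lemma open_iff_prefix:
  "open S \<longleftrightarrow> (\<forall>x\<in>S. \<exists>n. \<forall>y. (\<forall>i<n. y i = x i) \<longrightarrow> y \<in> S)" for S :: "(nat \<Rightarrow> nat) set"
proof
  assume "open S"
  then have op: "openin (product_topology (\<lambda>i. euclidean) UNIV) S" by (simp add: open_fun_def)
  show "\<forall>x\<in>S. \<exists>n. \<forall>y. (\<forall>i<n. y i = x i) \<longrightarrow> y \<in> S"
  proof
    fix x assume "x \<in> S"
    from product_topology_open_contains_basis[OF op this] obtain X where
      X: "x \<in> PiE UNIV X" "finite {i. X i \<noteq> (UNIV :: nat set)}" "PiE UNIV X \<subseteq> S" by auto
    from X(2) obtain n where n: "\<forall>i\<in>{i. X i \<noteq> UNIV}. i < n" using finite_nat_set_iff_bounded by blast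
    have "y \<in> S" if "\<forall>i<n. y i = x i" for y
    proof -
      have "y i \<in> X i" for i
        using n that X(1) by (cases "X i = UNIV") (auto simp: PiE_UNIV_domain)
      then show ?thesis using X(3) by (auto simp: PiE_UNIV_domain)
    qed
    then show "\<exists>n. \<forall>y. (\<forall>i<n. y i = x i) \<longrightarrow> y \<in> S" by blast
  qed
next
  assume S: "\<forall>x\<in>S. \<exists>n. \<forall>y. (\<forall>i<n. y i = x i) \<longrightarrow> y \<in> S"
  have op: "open {y. \<forall>i<n. y i = x i}" for x :: "nat \<Rightarrow> nat" and n
  proof -
    have "open {y. y i = x i}" for i
      by (rule open_Collect_rel[where R = "(=)"]) (rule cont_coordinate cont_const)+
    then have "open (\<Inter>i\<in>{..<n}. {y. y i = x i})" by (intro open_INT) auto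
    moreover have "(\<Inter>i\<in>{..<n}. {y. y i = x i}) = {y. \<forall>i<n. y i = x i}" by auto
    ultimately show ?thesis by simp
  qed
  show "open S"
    unfolding open_subopen[of S]
  proof
    fix x assume "x \<in> S"
    then obtain n where "\<forall>y. (\<forall>i<n. y i = x i) \<longrightarrow> y \<in> S" using S by blast
    then show "\<exists>T. open T \<and> x \<in> T \<and> T \<subseteq> S"
      by (intro exI[of _ "{y. \<forall>i<n. y i = x i}"] conjI op) auto
  qed
qed

section \<open>Borel sets are projections of closed sets\<close>

definition analytic :: "(nat \<Rightarrow> nat) set \<Rightarrow> bool" where
  "analytic A \<longleftrightarrow> (\<exists>C. closed C \<and> A = {x. \<exists>y. join x y \<in> C})"

lemma analytic_closed: "closed A \<Longrightarrow> analytic A"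
  unfolding analytic_def
  by (intro exI[of _ "left_half -` A"]) (auto intro: closed_vimage cont_left_half)

lemma analytic_open:
  assumes A: "open A"
  shows "analytic A"
proof -
  \<comment> \<open>Entry 1 of a join is the first entry of the witness; here it is the length of an
    initial segment that forces membership in \<open>A\<close>.\<close>
  let ?C = "{w. \<forall>y. (\<forall>i<w 1. y i = left_half w i) \<longrightarrow> y \<in> A}"
  have "open (- ?C)"
    unfolding open_iff_prefix
  proof
    fix w assume w: "w \<in> - ?C"
    \<comment> \<open>These entries include \<open>w 1\<close> and the even entries that make up the
      first \<open>w 1\<close> values of \<open>left_half w\<close>.\<close>
    have "w' \<in> - ?C" if w': "\<forall>i<2 * w 1 + 2. w' i = w i" for w'
    proof -
      have "w' 1 = w 1" "\<forall>i<w 1. left_half w' i = left_half w i" using w' by (auto simp: left_half_def)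
      then show ?thesis using w by simp
    qed
    then show "\<exists>n. \<forall>w'. (\<forall>i<n. w' i = w i) \<longrightarrow> w' \<in> - ?C" by blast
  qed
  then have "closed ?C" by (simp add: closed_def)
  moreover have "A = {x. \<exists>y. join x y \<in> ?C}"
  proof (intro equalityI subsetI)
    fix x assume "x \<in> A"
    then obtain n where "\<forall>y. (\<forall>i<n. y i = x i) \<longrightarrow> y \<in> A" using A unfolding open_iff_prefix by blast
    moreover have "join x (\<lambda>_. n) 1 = n" by (simp add: join_def)
    ultimately have "join x (\<lambda>_. n) \<in> ?C" by simp
    then show "x \<in> {x. \<exists>y. join x y \<in> ?C}" by blast
  qed auto
  ultimately show ?thesis unfolding analytic_def by blast
qed

text \<open>The first entry of the witness selects the set, the rest is a witness for it.\<close>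

lemma analytic_UN:
  fixes A :: "nat \<Rightarrow> (nat \<Rightarrow> nat) set"
  assumes "\<And>i. analytic (A i)"
  shows "analytic (\<Union>i. A i)"
proof -
  have "\<forall>i. \<exists>C. closed C \<and> A i = {x. \<exists>y. join x y \<in> C}"
    using assms unfolding analytic_def by (rule allI)
  from choice[OF this] obtain C where "\<forall>i. closed (C i) \<and> A i = {x. \<exists>y. join x y \<in> C i}" ..
  then have C: "closed (C i)" "A i = {x. \<exists>y. join x y \<in> C i}" for i by simp_all
  let ?g = "\<lambda>w. join (left_half w) (\<lambda>n. right_half w (Suc n))"
  have g: "cont ?g"
    by (rule cont_join[OF cont_left_half cont_coordinatewise]) (simp add: right_half_def cont_coordinate)
  let ?C = "{w. ?g w \<in> C (w 1)}"
  have "closed {w :: nat \<Rightarrow> nat. \<not> w 1 = i}" for i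
    by (rule closed_Collect_rel[OF cont_coordinate[of 1] cont_const[of i], of "\<lambda>a b. \<not> a = b"])
  moreover have "closed (?g -` C i)" for i by (rule closed_vimage[OF C(1) g])
  ultimately have "closed (\<Inter>i. {w. \<not> w 1 = i} \<union> ?g -` C i)"
    by (intro closed_INT closed_Un ballI)
  moreover have "(\<Inter>i. {w. \<not> w 1 = i} \<union> ?g -` C i) = ?C" by auto
  ultimately have "closed ?C" by simp
  moreover have "(\<Union>i. A i) = {x. \<exists>y. join x y \<in> ?C}"
  proof (intro equalityI subsetI)
    fix x assume "x \<in> (\<Union>i. A i)"
    then obtain i y where i: "join x y \<in> C i" unfolding C(2) by blast
    let ?y = "case_nat i y"
    have "join x ?y 1 = i" by (simp add: join_def)
    moreover have "(\<lambda>n. right_half (join x ?y) (Suc n)) = y" by simp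
    ultimately have "join x ?y \<in> ?C" using i by simp
    then show "x \<in> {x. \<exists>y. join x y \<in> ?C}" by blast
  next
    fix x assume "x \<in> {x. \<exists>y. join x y \<in> ?C}"
    then obtain y where "?g (join x y) \<in> C (join x y 1)" by blast
    then have "x \<in> A (join x y 1)" unfolding C(2) by auto
    then show "x \<in> (\<Union>i. A i)" by blast
  qed
  ultimately show ?thesis unfolding analytic_def by blast
qed

text \<open>The columns of one witness are witnesses for all the sets.\<close>

lemma analytic_INT:
  fixes A :: "nat \<Rightarrow> (nat \<Rightarrow> nat) set"
  assumes "\<And>i. analytic (A i)"
  shows "analytic (\<Inter>i. A i)"
proof -
  have "\<forall>i. \<exists>C. closed C \<and> A i = {x. \<exists>y. join x y \<in> C}"
    using assms unfolding analytic_def by (rule allI)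
  from choice[OF this] obtain C where "\<forall>i. closed (C i) \<and> A i = {x. \<exists>y. join x y \<in> C i}" ..
  then have C: "closed (C i)" "A i = {x. \<exists>y. join x y \<in> C i}" for i by simp_all
  let ?g = "\<lambda>i w. join (left_half w) (column (right_half w) i)"
  have g: "cont (?g i)" for i
    by (rule cont_join[OF cont_left_half cont_coordinatewise])
      (simp add: column_def right_half_def cont_coordinate)
  have "closed (?g i -` C i)" for i by (rule closed_vimage[OF C(1) g])
  then have "closed (\<Inter>i. ?g i -` C i)" by (intro closed_INT ballI)
  moreover have "(\<Inter>i. A i) = {x. \<exists>y. join x y \<in> (\<Inter>i. ?g i -` C i)}"
  proof (intro equalityI subsetI)
    fix x assume "x \<in> (\<Inter>i. A i)"
    then have "\<forall>i. \<exists>y. join x y \<in> C i" unfolding C(2) by blast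
    from choice[OF this] obtain y where y: "\<forall>i. join x (y i) \<in> C i" by blast
    let ?y = "\<lambda>m. y (fst (prod_decode m)) (snd (prod_decode m))"
    have "column ?y i = y i" for i by (simp add: column_def fun_eq_iff)
    then have "join x ?y \<in> (\<Inter>i. ?g i -` C i)" using y by simp
    then show "x \<in> {x. \<exists>y. join x y \<in> (\<Inter>i. ?g i -` C i)}" by blast
  qed (auto simp: C(2))
  ultimately show ?thesis unfolding analytic_def by blast
qed

lemma borel_analytic:
  assumes "A \<in> sets borel"
  shows "analytic A"
proof -
  have "A \<in> sigma_sets UNIV {S. open S}" using assms by (simp add: borel_def)
  \<comment> \<open>Complements are carried along, because analyticity of a set says nothing about
    its complement; unions become intersections there.\<close>
  then have "analytic A \<and> analytic (- A)"
  proof (induction rule: sigma_sets.induct)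
    case (Basic a)
    then show ?case by (auto intro: analytic_open analytic_closed simp: closed_def)
  next
    case Empty
    show ?case by (auto intro: analytic_closed)
  next
    case (Compl a)
    then show ?case by (simp add: Compl_eq_Diff_UNIV[symmetric])
  next
    case (Union a)
    then have "analytic (\<Union>i. a i)" "analytic (\<Inter>i. - a i)"
      by (auto intro!: analytic_UN analytic_INT)
    then show ?case by (simp add: Compl_UN)
  qed
  then show ?thesis ..
qed

section \<open>Projective sets are definable with a real parameter\<close>

primrec prefix_code :: "(nat \<Rightarrow> nat) \<Rightarrow> nat \<Rightarrow> nat" where
  "prefix_code w 0 = 0"
| "prefix_code w (Suc n) = prod_encode (prefix_code w n, w n)"

lemma prefix_code_eq: "prefix_code x n = prefix_code y n \<longleftrightarrow> (\<forall>i<n. x i = y i)"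
  by (induction n) (auto simp: less_Suc_eq)

text \<open>The zeros of \<open>z\<close> are read as a set of finite sequences, tagged with their
  lengths, and \<open>x\<close> must have all its initial segments there; \<open>c\<close> lists
  their codes. Every closed set arises in this way from some real \<open>z\<close>.\<close>

definition in_closed :: "(nat \<Rightarrow> nat) \<Rightarrow> (nat \<Rightarrow> nat) \<Rightarrow> bool" where
  "in_closed x z \<longleftrightarrow> (\<exists>c :: nat \<Rightarrow> nat. c 0 = 0 \<and> (\<forall>n. c (Suc n) = prod_encode (c n, x n)) \<and>
     (\<forall>n k. k = prod_encode (n, c n) \<longrightarrow> z k = 0))"

lemma in_closed_iff: "in_closed x z \<longleftrightarrow> (\<forall>n. z (prod_encode (n, prefix_code x n)) = 0)"
proof
  assume "in_closed x z"
  then obtain c where c: "c 0 = 0" "\<forall>n. c (Suc n) = prod_encode (c n, x n)"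
    "\<forall>n k. k = prod_encode (n, c n) \<longrightarrow> z k = 0" unfolding in_closed_def by blast
  have "c n = prefix_code x n" for n using c(1,2) by (induction n) simp_all
  with c(3) show "\<forall>n. z (prod_encode (n, prefix_code x n)) = 0" by simp
next
  assume "\<forall>n. z (prod_encode (n, prefix_code x n)) = 0"
  then show "in_closed x z" unfolding in_closed_def by (intro exI[of _ "prefix_code x"]) simp
qed

lemma dfn_in_closed: "dfn 0 2 (\<lambda>v F. in_closed (F ! 0) (F ! 1))"
  unfolding in_closed_def
  by (intro dfn_exf dfn_conj dfn_all dfn_imp dfn_prod_encode dfn_eq[OF _ dft_0] dft_app dft_app_butlast
      dft_nth dft_nth_butlast dft_Suc dft_0) simp_all

lemma closed_in_closed:
  assumes "closed C"
  shows "\<exists>z. C = {x. in_closed x z}"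
proof
  let ?z = "\<lambda>k. of_bool (\<not> (\<exists>y\<in>C. \<exists>n. k = prod_encode (n, prefix_code y n))) :: nat"
  have z: "?z (prod_encode (n, prefix_code x n)) = 0 \<longleftrightarrow> (\<exists>y\<in>C. \<forall>i<n. x i = y i)" for x n
    by (auto simp: prefix_code_eq)
  show "C = {x. in_closed x ?z}"
  proof (intro equalityI subsetI CollectI)
    fix x assume "x \<in> C"
    then show "in_closed x ?z" unfolding in_closed_iff z by blast
  next
    fix x assume "x \<in> {x. in_closed x ?z}"
    then have x: "\<exists>y\<in>C. \<forall>i<n. x i = y i" for n unfolding mem_Collect_eq in_closed_iff z by blast
    show "x \<in> C"
    proof (rule ccontr)
      assume "x \<notin> C"
      moreover have "open (- C)" using assms by (simp add: closed_def)
      ultimately obtain n where n: "\<forall>y. (\<forall>i<n. y i = x i) \<longrightarrow> y \<in> - C"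
        unfolding open_iff_prefix by blast
      from x[of n] obtain y where "y \<in> C" "\<forall>i<n. x i = y i" by blast
      with n show False by force
    qed
  qed
qed

text \<open>The two conditions have separate parameters, packed as the halves of one real. They are
  unpacked into new variables since substitution is available for variables only.\<close>

lemma dfn_ex_join:
  assumes T: "dfn 0 2 (\<lambda>v F. T (F ! 0) (F ! 1))" and B: "dfn 0 2 (\<lambda>v F. B (F ! 0) (F ! 1))"
  shows "dfn 0 2 (\<lambda>v F. \<exists>y. T (join (F ! 0) y) (right_half (F ! 1)) \<and> B y (left_half (F ! 1)))"
proof -
  let ?m = "Suc (Suc (Suc (Suc 2)))"
  have T': "dfn 0 ?m (\<lambda>v F. T (butlast (butlast F) ! Suc 2) (F ! Suc (Suc (Suc 2))))"
    by (rule dfn_cong[OF dfn_subst[OF T, of "Suc 2" "Suc (Suc (Suc 2))"]]) (simp_all add: nth_butlast)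
  have B': "dfn 0 ?m (\<lambda>v F. B (butlast (butlast (butlast F)) ! 2) (butlast F ! Suc (Suc 2)))"
    by (rule dfn_cong[OF dfn_subst[OF B, of "2" "Suc (Suc 2)"]]) (simp_all add: nth_butlast)
  have "dfn 0 2 (\<lambda>v F. \<exists>y w a b. (\<forall>i. w (i + i) = (F ! 0) i) \<and> (\<forall>i. w (Suc (i + i)) = y i) \<and>
      (\<forall>i. a i = (F ! 1) (i + i)) \<and> (\<forall>i. b i = (F ! 1) (Suc (i + i))) \<and> T w b \<and> B y a)"
    by (intro dfn_exf dfn_conj[OF _ dfn_conj[OF _ dfn_conj[OF _ dfn_conj[OF _ dfn_conj[OF T' B']]]]]
        dfn_all dfn_eq dft_app dft_app_butlast dft_nth dft_nth_butlast dft_Suc dft_plus) simp_all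
  moreover have "(\<exists>y w a b. (\<forall>i. w (i + i) = x i) \<and> (\<forall>i. w (Suc (i + i)) = y i) \<and>
      (\<forall>i. a i = z (i + i)) \<and> (\<forall>i. b i = z (Suc (i + i))) \<and> T w b \<and> B y a) \<longleftrightarrow>
      (\<exists>y. T (join x y) (right_half z) \<and> B y (left_half z))" for x z
  proof -
    have 1: "(\<forall>i. w (i + i) = x i) \<and> (\<forall>i. w (Suc (i + i)) = y i) \<longleftrightarrow> w = join x y" for w y
    proof
      assume "(\<forall>i. w (i + i) = x i) \<and> (\<forall>i. w (Suc (i + i)) = y i)"
      then have "left_half w = x" "right_half w = y" by (auto simp: left_half_def right_half_def)
      then show "w = join x y" by (metis join_halves)
    next
      assume "w = join x y"
      then have "left_half w = x" "right_half w = y" by simp_all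
      then show "(\<forall>i. w (i + i) = x i) \<and> (\<forall>i. w (Suc (i + i)) = y i)"
        by (auto simp: left_half_def right_half_def)
    qed
    have 2: "(\<forall>i. a i = z (i + i)) \<longleftrightarrow> a = left_half z" for a by (auto simp: left_half_def)
    have 3: "(\<forall>i. b i = z (Suc (i + i))) \<longleftrightarrow> b = right_half z" for b by (auto simp: right_half_def)
    show ?thesis unfolding conj_assoc[symmetric] 1 unfolding 2 3 by blast
  qed
  ultimately show ?thesis by simp
qed

definition param_definable :: "(nat \<Rightarrow> nat) set \<Rightarrow> bool" where
  "param_definable A \<longleftrightarrow> (\<exists>B z. dfn 0 2 (\<lambda>v F. B (F ! 0) (F ! 1)) \<and> A = {x. B x z})"

lemma param_definable_ex_join:
  assumes "closed C" "param_definable A"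
  shows "param_definable {x. \<exists>y\<in>A. join x y \<in> C}"
proof -
  from closed_in_closed[OF assms(1)] obtain z2 where C: "C = {x. in_closed x z2}" ..
  from assms(2) obtain B z1 where B: "dfn 0 2 (\<lambda>v F. B (F ! 0) (F ! 1))" "A = {x. B x z1}"
    unfolding param_definable_def by blast
  have "{x. \<exists>y\<in>A. join x y \<in> C} =
    {x. (\<lambda>x z. \<exists>y. in_closed (join x y) (right_half z) \<and> B y (left_half z)) x (join z1 z2)}"
    unfolding B(2) C by auto
  with dfn_ex_join[OF dfn_in_closed B(1)] show ?thesis unfolding param_definable_def
    by (intro exI[of _ "\<lambda>x z. \<exists>y. in_closed (join x y) (right_half z) \<and> B y (left_half z)"]
        exI[of _ "join z1 z2"] conjI) simp_all
qed

text \<open>Borel sets are projections of closed sets and continuous images are projections along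
  closed graphs, so \<open>param_definable_ex_join\<close> handles both and only closed sets have to
  be coded by reals.\<close>

lemma projective_param_definable: "projective A \<Longrightarrow> param_definable A"
proof (induction rule: projective.induct)
  case (borel A)
  from borel_analytic[OF this] obtain C where C: "closed C" "A = {x. \<exists>y. join x y \<in> C}"
    unfolding analytic_def by blast
  have "param_definable UNIV" unfolding param_definable_def
    using dfn_True by (intro exI[of _ "\<lambda>x z. True"]) simp
  from param_definable_ex_join[OF C(1) this] show ?case using C(2) by simp
next
  case (compl A)
  then obtain B z where B: "dfn 0 2 (\<lambda>v F. B (F ! 0) (F ! 1))" "A = {x. B x z}"
    unfolding param_definable_def by blast
  have "dfn 0 2 (\<lambda>v F. \<not> B (F ! 0) (F ! 1))" using B(1) by (rule dfn_not)
  moreover have "- A = {x. \<not> B x z}" using B(2) by auto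
  ultimately show ?case unfolding param_definable_def
    by (intro exI[of _ "\<lambda>x z. \<not> B x z"] exI[of _ z]) simp
next
  case (image A f)
  have "f ` A = {x. \<exists>y\<in>A. join x y \<in> {w. f (right_half w) = left_half w}}" by auto
  with param_definable_ex_join[OF closed_graph[OF image(2)] image(3)] show ?case by simp
qed

section \<open>From a definable payoff to a converging primitive recursive predicate\<close>

abbreviation with_param ::
  "(nat \<Rightarrow> pred \<Rightarrow> pred \<Rightarrow> pred \<Rightarrow> bool) \<Rightarrow> pred \<Rightarrow> nat \<Rightarrow> pred \<Rightarrow> pred \<Rightarrow> bool" where
  "with_param P Z \<equiv> \<lambda>n X Y. P n X Y Z"

abbreviation at_play :: "(nat \<Rightarrow> pred \<Rightarrow> pred \<Rightarrow> bool) \<Rightarrow> (nat \<Rightarrow> bool) \<Rightarrow> est \<Rightarrow> bool" where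
  "at_play P p s \<equiv> P (est_code s) (moves_I p) (moves_II p)"

text \<open>The table on which formulas are evaluated. Column 1, function variable 0, holds the
  play: an entry 1 for a true bit, no entry, hence value 0, for a false one. Column 2, function
  variable 1, copies the graph \<open>Z\<close>. The bounded quantifiers make it primitive recursive
  in its oracles.\<close>

definition wire :: "pred \<Rightarrow> pred \<Rightarrow> pred \<Rightarrow> pred" where
  "wire X Y Z m \<longleftrightarrow>
     (\<exists>i<Suc m. m = bit_index 1 i 1 \<and> ((\<exists>l<Suc i. i = l + l \<and> X l) \<or> (\<exists>l<Suc i. i = Suc (l + l) \<and> Y l))) \<or>
     (\<exists>i<Suc m. \<exists>j<Suc m. m = bit_index 2 i j \<and> Z (prod_encode (i, j)))"

text \<open>Games take bit sequences as parameters, so a real parameter is passed as its graph;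
  least value and default 0 make every \<open>Z\<close> denote a total function.\<close>

definition graph_value :: "pred \<Rightarrow> nat \<Rightarrow> nat" where
  "graph_value Z i = (if \<exists>j. Z (prod_encode (i, j)) then LEAST j. Z (prod_encode (i, j)) else 0)"

lemma ex_graph: "\<exists>Z. graph_value Z = z"
proof
  let ?Z = "\<lambda>k. case prod_decode k of (i, j) \<Rightarrow> j = z i"
  show "graph_value ?Z = z"
    by (rule ext) (simp add: graph_value_def Least_equality[of "\<lambda>j. j = z _" "z _"])
qed

lemma read_wire_play: "read (wire (moves_I p) (moves_II p) Z) 1 i = of_bool (p i)"
proof -
  have "(\<exists>l<Suc i. i = l + l \<and> moves_I p l) \<or> (\<exists>l<Suc i. i = Suc (l + l) \<and> moves_II p l) \<longleftrightarrow> p i"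
  proof (cases "even i")
    case True
    then obtain l where "i = l + l" by (metis evenE mult_2)
    then show ?thesis by (auto simp: moves_I_def mult_2 dest: arg_cong[of _ _ even])
  next
    case False
    then obtain l where "i = Suc (l + l)" by (metis oddE mult_2 Suc_eq_plus1)
    then show ?thesis by (auto simp: moves_II_def mult_2 dest: arg_cong[of _ _ even])
  qed
  then have w: "wire (moves_I p) (moves_II p) Z (bit_index 1 i j) \<longleftrightarrow> j = 1 \<and> p i" for j
    using bit_index_ge(1)[of i 1 j] by (auto simp: wire_def)
  show ?thesis
  proof (cases "p i")
    case True
    then have "read (wire (moves_I p) (moves_II p) Z) 1 i = 1" by (intro read_single) (simp add: w del: One_nat_def)
    then show ?thesis using True by simp
  next
    case False
    then show ?thesis by (simp only: read_def w simp_thms of_bool_eq if_False ex_simps)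
  qed
qed

lemma read_wire_param: "read (wire X Y Z) 2 = graph_value Z"
proof
  fix i
  have "wire X Y Z (bit_index 2 i j) \<longleftrightarrow> Z (prod_encode (i, j))" for j
    using bit_index_ge(1)[of i 2 j] bit_index_ge(2)[of j 2 i] by (auto simp: wire_def le_imp_less_Suc)
  then show "read (wire X Y Z) 2 i = graph_value Z i" by (simp only: read_def graph_value_def)
qed

definition truncation :: "pred \<Rightarrow> nat \<Rightarrow> nat" where
  "truncation X N = (\<Sum>i<N. of_bool (X i) * 2 ^ i)"

lemma matches_truncation: "matches N X (truncation X N)"
proof -
  have "set_encode {i \<in> {..<N}. X i} = (\<Sum>i<N. if X i then 2 ^ i else 0)"
    unfolding set_encode_def by (rule sum.inter_filter) simp
  also have "\<dots> = truncation X N" unfolding truncation_def by (rule sum.cong) auto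
  finally have eq: "truncation X N = set_encode {i \<in> {..<N}. X i}" by (rule sym)
  have "set_decode (truncation X N) = {i \<in> {..<N}. X i}"
    unfolding eq by (rule set_encode_inverse) simp
  then show ?thesis by (simp add: matches_def)
qed

text \<open>\<open>Z\<close> is allowed to be a functional of the oracles, to cover both a third
  oracle and a constant parameter.\<close>

lemma prp_wire:
  assumes p: "1 < p" and Z: "\<And>n f. pr p n f \<Longrightarrow> prp p n (\<lambda>Xs v. Z Xs (f Xs v))" and "pr p n f"
  shows "prp p n (\<lambda>Xs v. wire (Xs ! 0) (Xs ! 1) (Z Xs) (f Xs v))"
proof (rule pr_apply1[of p "\<lambda>Xs a. of_bool (wire (Xs ! 0) (Xs ! 1) (Z Xs) a)", OF _ assms(3)])
  show "prp p 1 (\<lambda>Xs v. wire (Xs ! 0) (Xs ! 1) (Z Xs) (v ! 0))"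
    unfolding wire_def
    by (intro prp_disj prp_bex prp_conj prp_eq pr_query Z pr_bit_index pr_prod_encode pr_add pr_Suc
        pr_nth pr_nth_tl pr_const) (use p in simp_all)
qed

lemma prp_wire_truncation:
  assumes p: "1 < p" and Z: "\<And>n f. pr p n f \<Longrightarrow> prp p n (\<lambda>Xs v. Z Xs (f Xs v))"
    and P: "prp p 2 (\<lambda>Xs v. P (v ! 0) (v ! 1))" and h: "pr p 1 (\<lambda>Xs v. h (v ! 0))"
  shows "prp p 1 (\<lambda>Xs v. P (v ! 0) (truncation (wire (Xs ! 0) (Xs ! 1) (Z Xs)) (h (v ! 0))))"
proof (rule pr_apply2[of p "\<lambda>Xs a b. of_bool (P a b)", OF P])
  show "pr p 1 (\<lambda>Xs v. truncation (wire (Xs ! 0) (Xs ! 1) (Z Xs)) (h (v ! 0)))"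
    unfolding truncation_def
    by (intro pr_sum pr_mult prp_wire[OF p Z] pr_power2 pr_nth h) simp_all
qed (simp add: pr_nth)

text \<open>A single \<open>P\<close> serves both parts: with the third oracle fixed to be
  constantly false it becomes a predicate of two oracles.\<close>

lemma prim_rec_payoff:
  assumes A: "dfn 0 2 (\<lambda>v F. A (F ! 0) (F ! 1))"
  shows "\<exists>k>0. \<exists>P. prim_rec_pred3 P \<and> prim_rec_pred2 (with_param P (\<lambda>_. False)) \<and>
    (\<forall>p Z. for_every_estimator k (\<lambda>s. at_play (with_param P Z) p s =
      (p \<in> unary_payoff {x. A x (graph_value Z)})))"
proof -
  from dfn_unary_payoff[OF A] obtain \<phi> where
    \<phi>: "\<And>e E. soa_sat e E \<phi> \<longleftrightarrow> (bits (E 0)) \<in> unary_payoff {x. A x (E 1)}"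
    unfolding dfn_def by (auto simp: upt_rec)
  obtain k0 where "limit_computable k0 (\<lambda>X. env_sat X \<phi>)" using limit_computable_soa by blast
  \<comment> \<open>One level more, to have \<open>k > 0\<close>.\<close>
  then have "limit_computable (Suc k0) (\<lambda>X. env_sat X \<phi>)" by (rule limit_computable_Suc)
  then obtain P h where P: "\<forall>p. prp p 2 (\<lambda>Xs v. P (v ! 0) (v ! 1))" "\<forall>p. pr p 1 (\<lambda>Xs v. h (v ! 0))"
    and lim: "\<And>X. for_every_estimator (Suc k0)
      (\<lambda>s. \<forall>y. matches (h (est_code s)) X y \<longrightarrow> P (est_code s) y = env_sat X \<phi>)"
    unfolding limit_computable_def by blast
  define Q where "Q n X Y Z = P n (truncation (wire X Y Z) (h n))" for n X Y Z
  have "prim_rec_pred3 Q"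
  proof -
    have "prp 3 1 (\<lambda>Xs v. P (v ! 0) (truncation (wire (Xs ! 0) (Xs ! 1) (Xs ! 2)) (h (v ! 0))))"
      using P by (intro prp_wire_truncation[where Z = "\<lambda>Xs. Xs ! 2"] pr_query) auto
    then obtain G where G: "prim_rec 3 1 G" "\<forall>Xs v. length Xs = 3 \<longrightarrow> length v = 1 \<longrightarrow>
        of_bool (P (v ! 0) (truncation (wire (Xs ! 0) (Xs ! 1) (Xs ! 2)) (h (v ! 0)))) = G Xs v"
      unfolding pr_def by blast
    have "G [X, Y, Z] [n] = of_bool (Q n X Y Z)" for X Y Z n
      using G(2)[rule_format, of "[X, Y, Z]" "[n]"] by (simp add: Q_def)
    with G(1) show ?thesis unfolding prim_rec_pred3_def by blast
  qed
  moreover have "prim_rec_pred2 (\<lambda>n X Y. Q n X Y (\<lambda>_. False))"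
  proof -
    have "prp 2 1 (\<lambda>Xs v. P (v ! 0) (truncation (wire (Xs ! 0) (Xs ! 1) (\<lambda>_. False)) (h (v ! 0))))"
      using P by (intro prp_wire_truncation[where Z = "\<lambda>Xs _. False"] pr_const) auto
    then obtain G where G: "prim_rec 2 1 G" "\<forall>Xs v. length Xs = 2 \<longrightarrow> length v = 1 \<longrightarrow>
        of_bool (P (v ! 0) (truncation (wire (Xs ! 0) (Xs ! 1) (\<lambda>_. False)) (h (v ! 0)))) = G Xs v"
      unfolding pr_def by blast
    have "G [X, Y] [n] = of_bool (Q n X Y (\<lambda>_. False))" for X Y n
      using G(2)[rule_format, of "[X, Y]" "[n]"] by (simp add: Q_def)
    with G(1) show ?thesis unfolding prim_rec_pred2_def by blast
  qed
  moreover have "for_every_estimator (Suc k0) (\<lambda>s. at_play (with_param Q Z) p s =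
      (p \<in> unary_payoff {x. A x (graph_value Z)}))" for p Z
    using lim[of "wire (moves_I p) (moves_II p) Z"]
  proof (rule for_every_mono)
    fix s
    let ?W = "wire (moves_I p) (moves_II p) Z"
    assume "\<forall>y. matches (h (est_code s)) ?W y \<longrightarrow> P (est_code s) y = env_sat ?W \<phi>"
    then have "at_play (with_param Q Z) p s = env_sat ?W \<phi>"
      unfolding Q_def using matches_truncation by blast
    also have "\<dots> \<longleftrightarrow> (\<lambda>i. read ?W 1 i \<noteq> 0) \<in> unary_payoff {x. A x (read ?W 2)}"
      unfolding \<phi> by (simp add: numeral_2_eq_2)
    also have "\<dots> \<longleftrightarrow> p \<in> unary_payoff {x. A x (graph_value Z)}"
      unfolding read_wire_play read_wire_param by simp
    finally show "at_play (with_param Q Z) p s = (p \<in> unary_payoff {x. A x (graph_value Z)})" .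
  qed
  ultimately show ?thesis by (intro exI[of _ "Suc k0"] exI[of _ Q]) blast
qed

lemma prim_rec_locally_decided:
  assumes "prim_rec p 1 F"
  shows "locally_decided (\<lambda>q. F (play_oracles q Zs) [n] = 1)"
  unfolding locally_decided_def
proof
  fix q
  from prim_rec_agree[OF assms, of "[n]"] obtain N where
    N: "\<forall>Ys. agree p N (play_oracles q Zs) Ys \<longrightarrow> F Ys [n] = F (play_oracles q Zs) [n]"
    by blast
  \<comment> \<open>Moves alternate, so this many moves contain the first \<open>N\<close> bits of
    both players.\<close>
  have "agree p N (play_oracles q Zs) (play_oracles r Zs)"
    if r: "\<forall>i<2 * N + 2. r i = q i" for r
    unfolding agree_def using r by (auto simp: nth_Cons' moves_I_def moves_II_def)
  with N show "\<exists>N. \<forall>r. (\<forall>i<N. r i = q i) \<longrightarrow>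
      (F (play_oracles r Zs) [n] = 1) = (F (play_oracles q Zs) [n] = 1)"
    by (intro exI[of _ "2 * N + 2"]) metis
qed

lemma locally_decided_not: "locally_decided Q \<Longrightarrow> locally_decided (\<lambda>p. \<not> Q p)"
  unfolding locally_decided_def by simp

section \<open>Determinacy against decided games\<close>

lemma G_decided_iff:
  "G_decided P s \<longleftrightarrow>
    (\<exists>\<sigma>. \<forall>p. follows True \<sigma> p \<longrightarrow> p \<in> est_payoff (\<lambda>s p. at_play P p s) s) \<or>
    (\<exists>\<sigma>. \<forall>p. follows False \<sigma> p \<longrightarrow> p \<in> est_payoff (\<lambda>s p. \<not> at_play P p s) s)"
  unfolding G_decided_def one_player_wins_def winning_strategy_I_follows winning_strategy_II_follows
    G_wins_I_def G_wins_II_def est_payoff_def ..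

text \<open>At a play lost by player \<open>b\<close>, convergence of \<open>P\<close> gives a valid
  notion on which the predicate of \<open>b\<close> fails;
  \<open>for_every_est_payoff_not_won\<close> then excludes winning strategies, for each
  \<open>b\<close> separately.\<close>

lemma for_every_not_G_decided:
  assumes loc: "\<And>n. locally_decided (\<lambda>p. P n (moves_I p) (moves_II p))"
    and lim: "\<And>p. for_every_estimator k (\<lambda>s. at_play P p s = (p \<in> W))"
    and W: "\<And>b \<sigma>. \<exists>p. follows b \<sigma> p \<and> (p \<in> W \<longleftrightarrow> \<not> b)"
  shows "for_every_estimator (k + 2) (\<lambda>s. \<not> G_decided P s)"
proof -
  let ?B = "\<lambda>s p. at_play P p s"
  have "for_every_estimator (k + 2)
      (\<lambda>s. \<not> (\<exists>\<sigma>. \<forall>p. follows b \<sigma> p \<longrightarrow> p \<in> est_payoff (\<lambda>s p. ?B s p \<longleftrightarrow> b) s))" for b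
  proof (rule for_every_est_payoff_not_won[of "\<lambda>s p. ?B s p \<longleftrightarrow> b" b])
    show "locally_decided (\<lambda>p. ?B s p \<longleftrightarrow> b)" for s
      using loc[of "est_code s"] locally_decided_not[OF loc[of "est_code s"]] by (cases b) simp_all
    fix \<sigma>
    from W[of b \<sigma>] obtain p where p: "follows b \<sigma> p" "p \<in> W \<longleftrightarrow> \<not> b" by blast
    from lim[of p] have "for_every_estimator k (\<lambda>s. \<not> (?B s p \<longleftrightarrow> b))"
      by (rule for_every_mono) (use p in blast)
    with p(1) show "\<exists>p. follows b \<sigma> p \<and> for_every_estimator k (\<lambda>s. \<not> (?B s p \<longleftrightarrow> b))" by blast
  qed
  from for_every_conj[OF this[of True] this[of False]] show ?thesis
    by (rule for_every_mono) (simp add: G_decided_iff)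
qed

text \<open>Determinacy speaks of moves in \<open>nat\<close>, the estimator games of bits. The bit
  strategy keeps a shadow play \<open>N p\<close> in which the opponent's bits appear as 0 and 1 and
  the own moves are those of \<open>\<sigma>\<close>, and plays whether the latter are
  nonzero.\<close>

lemma follows_bits:
  fixes \<sigma> :: "nat list \<Rightarrow> nat"
  assumes \<sigma>: "\<forall>x. follows b \<sigma> x \<longrightarrow> ((bits x) \<in> D \<longleftrightarrow> b)"
  shows "\<exists>\<tau>. \<forall>p. follows b \<tau> p \<longrightarrow> (p \<in> D \<longleftrightarrow> b)"
proof -
  have "\<forall>p. \<exists>x. \<forall>i. x i = (if even i = b then \<sigma> (map x [0..<i]) else (of_bool (p i) :: nat))"
  proof
    fix p
    show "\<exists>x. \<forall>i. x i = (if even i = b then \<sigma> (map x [0..<i]) else (of_bool (p i) :: nat))"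
      by (rule ex_sequence_course_of_values[of "\<lambda>i l. if even i = b then \<sigma> l else of_bool (p i)"])
  qed
  from choice[OF this] obtain N where
    N: "\<forall>p i. N p i = (if even i = b then \<sigma> (map (N p) [0..<i]) else of_bool (p i))" ..
  have local: "\<forall>j<n. p j = q j \<Longrightarrow> i < n \<Longrightarrow> N p i = N q i" for p q n i
  proof (induction i rule: less_induct)
    case (less i)
    then have eq: "map (N p) [0..<i] = map (N q) [0..<i]" by simp
    have "p i = q i" using less.prems by blast
    then show ?case by (simp only: N[rule_format, of p i] N[rule_format, of q i] eq)
  qed
  define \<tau> where "\<tau> l \<longleftrightarrow> \<sigma> (map (N (\<lambda>i. l ! i)) [0..<length l]) \<noteq> 0" for l
  have "p \<in> D \<longleftrightarrow> b" if p: "follows b \<tau> p" for p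
  proof -
    have "(N p i \<noteq> 0) = p i" for i
    proof (cases "even i = b")
      case True
      then have "p i = \<tau> (map p [0..<i])" using p unfolding follows_def by blast
      also have "\<dots> \<longleftrightarrow> \<sigma> (map (N (\<lambda>j. map p [0..<i] ! j)) [0..<i]) \<noteq> 0" by (simp add: \<tau>_def)
      also have "map (N (\<lambda>j. map p [0..<i] ! j)) [0..<i] = map (N p) [0..<i]"
        using local[of i "\<lambda>j. map p [0..<i] ! j" p] by simp
      also have "\<sigma> (map (N p) [0..<i]) = N p i" by (simp only: N[rule_format, of p i] True simp_thms if_True)
      finally show ?thesis by simp
    next
      case False
      then have "N p i = of_bool (p i)" by (simp only: N[rule_format, of p i] simp_thms if_False)
      then show ?thesis by simp
    qed
    then have "(\<lambda>i. N p i \<noteq> 0) = p" by blast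
    moreover have "follows b \<sigma> (N p)" unfolding follows_def
    proof (intro allI impI)
      fix i :: nat assume "even i = b"
      then show "N p i = \<sigma> (map (N p) [0..<i])" by (simp only: N[rule_format, of p i] simp_thms if_True)
    qed
    then have "(\<lambda>i. N p i \<noteq> 0) \<in> D \<longleftrightarrow> b" using \<sigma> by blast
    ultimately show ?thesis by (simp only:)
  qed
  then show ?thesis by blast
qed

lemma for_every_G_decided:
  assumes loc: "\<And>n. locally_decided (\<lambda>p. P n (moves_I p) (moves_II p))"
    and det: "determined {x :: nat \<Rightarrow> nat. for_some_estimator k
      (\<lambda>s. at_play P (bits x) s)}"
  shows "for_every_estimator (k + 2) (\<lambda>s. G_decided P s)"
proof -
  let ?B = "\<lambda>s p. at_play P p s"
  let ?D = "{p. for_some_estimator k (\<lambda>s. ?B s p)}"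
  have "\<exists>b \<sigma>. \<forall>x :: nat \<Rightarrow> nat. follows b \<sigma> x \<longrightarrow> ((bits x) \<in> ?D \<longleftrightarrow> b)"
    using det unfolding determined_def one_player_wins_def winning_strategy_I_follows winning_strategy_II_follows
    by (elim disjE exE) (intro exI[of _ True] exI, simp, intro exI[of _ False] exI, simp)
  then obtain b and \<sigma> :: "nat list \<Rightarrow> nat" where
    "\<forall>x. follows b \<sigma> x \<longrightarrow> ((bits x) \<in> ?D \<longleftrightarrow> b)" by blast
  from follows_bits[OF this] obtain \<tau> where \<tau>: "\<forall>p. follows b \<tau> p \<longrightarrow> (p \<in> ?D \<longleftrightarrow> b)" ..
  have "for_every_estimator (k + 2) (\<lambda>s. \<exists>\<sigma>. \<forall>p. follows b \<sigma> p \<longrightarrow> p \<in> est_payoff (\<lambda>s p. ?B s p \<longleftrightarrow> b) s)"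
  proof (rule for_every_est_payoff_won[of "\<lambda>s p. ?B s p \<longleftrightarrow> b" b \<tau>])
    show "locally_decided (\<lambda>p. ?B s p \<longleftrightarrow> b)" for s
      using loc[of "est_code s"] locally_decided_not[OF loc[of "est_code s"]] by (cases b) simp_all
    fix p assume "follows b \<tau> p"
    with \<tau> have "for_some_estimator k (\<lambda>s. ?B s p) \<longleftrightarrow> b" by simp
    then show "for_some_estimator k (\<lambda>s. ?B s p \<longleftrightarrow> b)"
      using not_for_some[of k "\<lambda>s. ?B s p"] for_every_imp_for_some by (cases b) auto
  qed
  then show ?thesis by (rule for_every_mono) (cases b; simp add: G_decided_iff)
qed

lemma prim_rec_pred2E:
  assumes "prim_rec_pred2 P"
  obtains F where "prim_rec 2 1 F" "\<And>n X Y. F [X, Y] [n] = 1 \<longleftrightarrow> P n X Y"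
  using assms unfolding prim_rec_pred2_def by (metis of_bool_eq_1_iff)

lemma prim_rec_pred3E:
  assumes "prim_rec_pred3 P"
  obtains F where "prim_rec 3 1 F" "\<And>n X Y Z. F [X, Y, Z] [n] = 1 \<longleftrightarrow> P n X Y Z"
  using assms unfolding prim_rec_pred3_def by (metis of_bool_eq_1_iff)

lemma prim_rec_pred2_local:
  assumes "prim_rec_pred2 P"
  shows "locally_decided (\<lambda>p. P n (moves_I p) (moves_II p))"
proof -
  from assms obtain F where "prim_rec 2 1 F" "\<And>n X Y. F [X, Y] [n] = 1 \<longleftrightarrow> P n X Y"
    by (rule prim_rec_pred2E) blast
  with prim_rec_locally_decided[of 2 F "[]" n] show ?thesis by simp
qed

lemma prim_rec_pred3_local:
  assumes "prim_rec_pred3 P"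
  shows "locally_decided (\<lambda>p. P n (moves_I p) (moves_II p) Z)"
proof -
  from assms obtain F where "prim_rec 3 1 F" "\<And>n X Y Z. F [X, Y, Z] [n] = 1 \<longleftrightarrow> P n X Y Z"
    by (rule prim_rec_pred3E) blast
  with prim_rec_locally_decided[of 3 F "[Z]" n] show ?thesis by simp
qed

lemma lightface_for_every:
  assumes LPD: lightface_projective_determinacy and P: "prim_rec_pred2 P"
  shows "for_every_estimator (k + 2) (\<lambda>s. G_decided P s)"
proof (rule for_every_G_decided[OF prim_rec_pred2_local[OF P]])
  from P obtain F where F: "prim_rec 2 1 F" "\<And>n X Y. F [X, Y] [n] = 1 \<longleftrightarrow> P n X Y"
    by (rule prim_rec_pred2E) blast
  let ?A = "{x :: nat \<Rightarrow> nat. for_some_estimator k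
      (\<lambda>s. at_play P (bits x) s)}"
  have "dfn 0 1 (\<lambda>v G. for_some_estimator k (\<lambda>s. F (play_oracles (bits (G ! 0)) (oracles [] G)) [est_code s] = 1))"
    using F(1) by (intro dfn_game[of 0]) (simp_all add: numeral_2_eq_2)
  then have "dfn 0 1 (\<lambda>v G. G ! 0 \<in> ?A)" unfolding oracles_simps F(2) mem_Collect_eq .
  then have "lightface_projective ?A" unfolding dfn_def lightface_projective_def by simp
  with LPD show "determined ?A" unfolding lightface_projective_determinacy_def by blast
qed

lemma boldface_for_every:
  assumes PD: projective_determinacy and P: "prim_rec_pred3 P"
  shows "for_every_estimator (k + 2) (\<lambda>s. G_decided (with_param P Z) s)"
proof (rule for_every_G_decided[OF prim_rec_pred3_local[OF P]])
  from P obtain F where F: "prim_rec 3 1 F" "\<And>n X Y Z. F [X, Y, Z] [n] = 1 \<longleftrightarrow> P n X Y Z"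
    by (rule prim_rec_pred3E) blast
  let ?A = "{x :: nat \<Rightarrow> nat. for_some_estimator k
      (\<lambda>s. at_play (with_param P Z) (bits x) s)}"
  have "dfn 0 2 (\<lambda>v G. for_some_estimator k (\<lambda>s. F (play_oracles (bits (G ! 0)) (oracles [1] G)) [est_code s] = 1))"
    using F(1) by (intro dfn_game[of 1]) (simp_all add: numeral_3_eq_3)
  then have "dfn 0 2 (\<lambda>v G. for_some_estimator k (\<lambda>s. P (est_code s) (moves_I (bits (G ! 0)))
      (moves_II (bits (G ! 0))) (bits (G ! 1))))" unfolding oracles_simps F(2) .
  then obtain \<phi> where \<phi>: "\<And>e E. soa_sat e E \<phi> \<longleftrightarrow> for_some_estimator k (\<lambda>s. P (est_code s)
      (moves_I (bits (E 0))) (moves_II (bits (E 0))) (bits (E 1)))"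
    unfolding dfn_def by (auto simp: upt_rec)
  \<comment> \<open>All function variables except 0 carry the parameter \<open>Z\<close>;
    \<open>\<phi>\<close> reads it at index 1.\<close>
  have "?A = {p. soa_sat (\<lambda>_. 0) ((\<lambda>_ i. of_bool (Z i))(0 := p)) \<phi>}"
    unfolding \<phi> by simp
  then have "projective ?A" using projective_soa by simp
  with PD show "determined ?A" unfolding projective_determinacy_def by blast
qed

text \<open>The modulus in \<open>Z\<close> must not depend on \<open>X\<close> and
  \<open>Y\<close>, since a strategy has to cope with all plays.\<close>

lemma prim_rec_pred3_uniform:
  assumes "prim_rec_pred3 P"
  shows "\<exists>N. \<forall>X Y Z Z'. (\<forall>i<N. Z' i = Z i) \<longrightarrow> P n X Y Z' = P n X Y Z"
proof -
  from assms obtain F where F: "prim_rec 3 1 F" "\<And>n X Y Z. F [X, Y, Z] [n] = 1 \<longleftrightarrow> P n X Y Z"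
    by (rule prim_rec_pred3E) blast
  from prim_rec_agree[OF F(1), of "[n]"] obtain N where
    N: "\<forall>Xs Ys. agree 3 N Xs Ys \<longrightarrow> F Ys [n] = F Xs [n]" by blast
  have "P n X Y Z' = P n X Y Z" if "\<forall>i<N. Z' i = Z i" for X Y Z Z'
  proof -
    have "agree 3 N [X, Y, Z] [X, Y, Z']" using that by (auto simp: agree_def nth_Cons')
    with N have "F [X, Y, Z'] [n] = F [X, Y, Z] [n]" by blast
    then show ?thesis by (simp only: F(2)[symmetric])
  qed
  then show ?thesis by (intro exI[of _ N] allI impI)
qed

text \<open>Only finitely many estimators lie two levels below \<open>s\<close>, so their moduli
  have a maximum.\<close>

lemma G_decided_local:
  assumes "prim_rec_pred3 P"
  shows "\<exists>N. \<forall>Z'. (\<forall>i<N. Z' i = Z i) \<longrightarrow>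
    G_decided (with_param P Z') s = G_decided (with_param P Z) s"
proof -
  have "\<forall>n. \<exists>N. \<forall>X Y Z Z'. (\<forall>i<N. Z' i = Z i) \<longrightarrow> P n X Y Z' = P n X Y Z"
    using prim_rec_pred3_uniform[OF assms] by blast
  from choice[OF this] obtain M where
    M: "\<forall>n X Y Z Z'. (\<forall>i<M n. Z' i = Z i) \<longrightarrow> P n X Y Z' = P n X Y Z" ..
  let ?C = "(\<lambda>s''. M (est_code s'')) ` (\<Union>s'\<in>elems s. elems s')"
  have fin: "finite (elems s)" for s by (cases s) auto
  have "G_decided (with_param P Z') s = G_decided (with_param P Z) s"
    if Z': "\<forall>i<Max (insert 0 ?C). Z' i = Z i" for Z'
  proof -
    have eq: "P (est_code s'') X Y Z' = P (est_code s'') X Y Z"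
      if "s' \<in> elems s" "s'' \<in> elems s'" for s' s'' X Y
    proof -
      have "M (est_code s'') \<le> Max (insert 0 ?C)"
        by (rule Max_ge) (use that fin in auto)
      then have "\<forall>i<M (est_code s''). Z' i = Z i" using Z' by simp
      then show ?thesis using M by blast
    qed
    have "G_wins_I (with_param P Z') s = G_wins_I (with_param P Z) s"
      "G_wins_II (with_param P Z') s = G_wins_II (with_param P Z) s"
      unfolding G_wins_I_def G_wins_II_def by (simp_all add: eq cong: ball_cong bex_cong)
    then show ?thesis by (simp add: G_decided_def)
  qed
  then show ?thesis by blast
qed

text \<open>The good \<open>s\<close> depends on \<open>Z\<close>; a finite subcover of the space of
  parameters exchanges the quantifiers at the cost of one level, whence
  \<open>k + 3\<close>.\<close>

lemma boldface_for_every_uniform: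
  assumes PD: projective_determinacy and P: "prim_rec_pred3 P"
  shows "for_every_estimator (k + 3) (\<lambda>t. \<forall>Z. \<exists>s\<in>elems t. G_decided (with_param P Z) s)"
proof -
  let ?G = "\<lambda>Z s. G_decided (with_param P Z) s"
  have "for_every_estimator (Suc (k + 2)) (\<lambda>t. \<forall>Z. \<exists>s\<in>elems t. ?G Z s)"
  proof (rule for_every_Suc_upward_finite[where \<psi> = "\<lambda>A. \<forall>Z. \<exists>s\<in>A. ?G Z s"])
    fix S assume S: "valid_notion (k + 2) S"
    show "\<exists>K. finite K \<and> K \<subseteq> S \<and> (\<forall>Z. \<exists>s\<in>K. ?G Z s)"
    proof (rule cantor_space_compact)
      fix Z :: pred
      from boldface_for_every[OF PD P, of k Z] have "for_some_estimator (k + 2) (?G Z)"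
        by (rule for_every_imp_for_some)
      with S obtain s where s: "s \<in> S" "?G Z s" unfolding for_some_estimator_def by blast
      from G_decided_local[OF P, of Z s] obtain N where
        N: "\<forall>Z'. (\<forall>i<N. Z' i = Z i) \<longrightarrow> ?G Z' s = ?G Z s" ..
      have "\<forall>Z'. (\<forall>d\<in>{..<N}. Z' d = Z d) \<longrightarrow> ?G Z' s" using N s(2) by (metis lessThan_iff)
      with s(1) show "\<exists>s\<in>S. \<exists>D. finite D \<and> (\<forall>Z'. (\<forall>d\<in>D. Z' d = Z d) \<longrightarrow> ?G Z' s)"
        by (intro bexI[of _ s] exI[of _ "{..<N}"] conjI finite_lessThan)
    qed
  qed blast
  then show ?thesis by (simp add: numeral_3_eq_3)
qed

lemma for_some_lightface:
  assumes some: "\<And>k P. k > 0 \<Longrightarrow> prim_rec_pred2 P \<Longrightarrow> for_some_estimator (k + 2) (\<lambda>s. G_decided P s)"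
  shows lightface_projective_determinacy
  unfolding lightface_projective_determinacy_def
proof (intro allI impI)
  fix A assume "lightface_projective A"
  then obtain \<phi> where "\<forall>e E. soa_sat e E \<phi> \<longleftrightarrow> E 0 \<in> A" unfolding lightface_projective_def by blast
  then have "dfn 0 2 (\<lambda>v F. (\<lambda>x z. x \<in> A) (F ! 0) (F ! 1))"
    unfolding dfn_def by (intro exI[of _ \<phi>]) (simp add: upt_rec)
  from prim_rec_payoff[OF this] obtain k P where k: "k > 0"
    and P: "prim_rec_pred2 (with_param P (\<lambda>_. False))"
    and lim: "\<forall>p Z. for_every_estimator k (\<lambda>s. at_play (with_param P Z) p s =
      (p \<in> unary_payoff {x. x \<in> A}))"
    by blast
  show "determined A"
  proof (rule ccontr)
    assume "\<not> determined A"
    then have W: "\<exists>p. follows b \<sigma> p \<and> (p \<in> unary_payoff A \<longleftrightarrow> \<not> b)" for b \<sigma> by (rule not_determined_unary)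
    have "for_every_estimator (k + 2) (\<lambda>s. \<not> G_decided (with_param P (\<lambda>_. False)) s)"
      using lim by (intro for_every_not_G_decided[OF prim_rec_pred2_local[OF P] _ W]) simp
    with some[OF k P] show False unfolding not_for_some[symmetric] by blast
  qed
qed

lemma for_some_boldface:
  assumes some: "\<And>k P. k > 0 \<Longrightarrow> prim_rec_pred3 P \<Longrightarrow>
    for_some_estimator (k + 3) (\<lambda>t. \<forall>Z. \<exists>s\<in>elems t. G_decided (with_param P Z) s)"
  shows projective_determinacy
  unfolding projective_determinacy_def
proof (intro allI impI)
  fix A :: "(nat \<Rightarrow> nat) set" assume "projective A"
  then have "param_definable A" by (rule projective_param_definable)
  then obtain B z where B: "dfn 0 2 (\<lambda>v F. B (F ! 0) (F ! 1))" "A = {x. B x z}"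
    unfolding param_definable_def by blast
  obtain Z where Z: "graph_value Z = z" using ex_graph by blast
  from prim_rec_payoff[OF B(1)] obtain k P where k: "k > 0" and P: "prim_rec_pred3 P"
    and lim: "\<forall>p Z. for_every_estimator k (\<lambda>s. at_play (with_param P Z) p s =
      (p \<in> unary_payoff {x. B x (graph_value Z)}))"
    by blast
  show "determined A"
  proof (rule ccontr)
    assume "\<not> determined A"
    then have W: "\<exists>p. follows b \<sigma> p \<and> (p \<in> unary_payoff A \<longleftrightarrow> \<not> b)" for b \<sigma> by (rule not_determined_unary)
    have "for_every_estimator k (\<lambda>s. at_play (with_param P Z) p s = (p \<in> unary_payoff A))" for p
      using lim[rule_format, of p Z] unfolding Z B(2) .
    then have "for_every_estimator (k + 2) (\<lambda>s. \<not> G_decided (with_param P Z) s)"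
      by (rule for_every_not_G_decided[OF prim_rec_pred3_local[OF P] _ W])
    \<comment> \<open>One fixed parameter spoils every \<open>t\<close>: none of its elements is
      decided for this \<open>Z\<close>.\<close>
    from for_every_all_elems[OF this]
    have "for_every_estimator (k + 3) (\<lambda>t. \<forall>s\<in>elems t. \<not> G_decided (with_param P Z) s)"
      by (simp add: numeral_3_eq_3)
    then have "for_every_estimator (k + 3) (\<lambda>t. \<not> (\<forall>Z. \<exists>s\<in>elems t. G_decided (with_param P Z) s))"
      by (rule for_every_mono) blast
    with some[OF k P] show False unfolding not_for_some[symmetric] by blast
  qed
qed

theorem theorem6p7:
  shows
    "(lightface_projective_determinacy \<longleftrightarrow>
        (\<forall>k::nat. k > 0 \<longrightarrow> (\<forall>P. prim_rec_pred2 P \<longrightarrow>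
           for_some_estimator (k + 2) (\<lambda>s. G_decided P s)))) \<and>
     (lightface_projective_determinacy \<longleftrightarrow>
        (\<forall>k::nat. k > 0 \<longrightarrow> (\<forall>P. prim_rec_pred2 P \<longrightarrow>
           for_every_estimator (k + 2) (\<lambda>s. G_decided P s)))) \<and>
     (projective_determinacy \<longleftrightarrow>
        (\<forall>k::nat. k > 0 \<longrightarrow> (\<forall>P. prim_rec_pred3 P \<longrightarrow>
           for_some_estimator (k + 3)
             (\<lambda>t. \<forall>Z. \<exists>s\<in>elems t. G_decided (\<lambda>n X Y. P n X Y Z) s)))) \<and>
     (projective_determinacy \<longleftrightarrow>
        (\<forall>k::nat. k > 0 \<longrightarrow> (\<forall>P. prim_rec_pred3 P \<longrightarrow>
           for_every_estimator (k + 3)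
             (\<lambda>t. \<forall>Z. \<exists>s\<in>elems t. G_decided (\<lambda>n X Y. P n X Y Z) s))))"
  (is "(_ \<longleftrightarrow> ?S2) \<and> (_ \<longleftrightarrow> ?E2) \<and> (_ \<longleftrightarrow> ?S3) \<and> (_ \<longleftrightarrow> ?E3)")
proof -
  \<comment> \<open>Each part is a cycle from determinacy through for every and for some back to
    determinacy; both of its equivalences follow.\<close>
  have l1: "lightface_projective_determinacy \<Longrightarrow> ?E2" using lightface_for_every by blast
  have l2: "?E2 \<Longrightarrow> ?S2" using for_every_imp_for_some by blast
  have l3: "?S2 \<Longrightarrow> lightface_projective_determinacy" by (rule for_some_lightface) blast
  have b1: "projective_determinacy \<Longrightarrow> ?E3" using boldface_for_every_uniform by blast
  have b2: "?E3 \<Longrightarrow> ?S3" using for_every_imp_for_some by blast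
  have b3: "?S3 \<Longrightarrow> projective_determinacy" by (rule for_some_boldface) blast
  show ?thesis
  proof (intro conjI)
    show "lightface_projective_determinacy \<longleftrightarrow> ?S2" by (rule iffI, rule l2, erule l1, erule l3)
    show "lightface_projective_determinacy \<longleftrightarrow> ?E2" by (rule iffI, erule l1, rule l3, erule l2)
    show "projective_determinacy \<longleftrightarrow> ?S3" by (rule iffI, rule b2, erule b1, erule b3)
    show "projective_determinacy \<longleftrightarrow> ?E3" by (rule iffI, erule b1, rule b3, erule b2)
  qed
qed

end
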